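(* The system $\mathsf{Z}_2^\omega$ does not prove $\mathsf{HBC}$.
   Context: Metatheory is ZFC. Framework: Kohlenbach's higher-order arithmetic with base theory $\mathsf{RCA}_0^\omega$ (language with variables of all finite types over $\mathbb{N}$; axioms: basic arithmetic, combinators, primitive recursor $\mathbf{R}_0$, extensionality, quantifier-free induction, quantifier-free choice $\mathsf{QF\text{-}AC}^{1,0}$). For $k\ge 1$, $\mathsf{S}_k^2$ is the type-2 functional with values in $\{0,1\}$ deciding the truth of $\Sigma^1_k$-formulas with function parameters (for $k=0$ it is Kleene's $\exists^2$, deciding $(\exists n)f(n)=0$); $\Pi^1_k\text{-}\mathsf{CA}_0^\omega$ is $\mathsf{RCA}_0^\omega$ plus the axiom that $\mathsf{S}_k^2$ exists, and $\mathsf{Z}_2^\omega=\bigcup_k\Pi^1_k\text{-}\mathsf{CA}_0^\omega$. Reals are represented by fast-converging Cauchy sequences of rationals. A set of reals is given by a function $Y:\mathbb{R}\to\mathbb{R}$, where $x\in Y$ means $Y(x)>0$; $Y$ is open if for every $x\in Y$ there is a rational $r>0$ with $B(x,r)\subseteq Y$; $Y$ is closed if its complement is open. $\mathsf{HBC}$: for every closed $C\subseteq[0,1]$ and sequences of reals $(a_n),(b_n)$ with $C\subseteq\bigcup_{n\in\mathbb{N}}(a_n,b_n)$, there is $n_0\in\mathbb{N}$ with $C\subseteq\bigcup_{n\le n_0}(a_n,b_n)$. *)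

theory Defs
  imports Main
begin

section \<open>Language of higher-order arithmetic\<close>

datatype ty = N | Arrow ty ty  (infixr "\<rightarrow>" 65)

abbreviation One :: ty where "One \<equiv> N \<rightarrow> N"
abbreviation Two :: ty where "Two \<equiv> One \<rightarrow> N"

text \<open>Variables carry their type: (i, \<open>\<tau>\<close>) is the \<open>i\<close>-th variable of type \<open>\<tau>\<close>.\<close>

type_synonym var = "nat \<times> ty"

datatype const =
    CZero | CSuc | CPlus | CTimes
  | CPi ty ty
  | CSigma ty ty ty
  | CRec

datatype tm = Var var | Const const | Ap tm tm  (infixl "\<cdot>" 75)

fun const_ty :: "const \<Rightarrow> ty" where
  "const_ty CZero = N"
| "const_ty CSuc = N \<rightarrow> N"
| "const_ty CPlus = N \<rightarrow> N \<rightarrow> N"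
| "const_ty CTimes = N \<rightarrow> N \<rightarrow> N"
| "const_ty (CPi \<rho> \<sigma>) = \<rho> \<rightarrow> \<sigma> \<rightarrow> \<rho>"
| "const_ty (CSigma \<rho> \<sigma> \<tau>) = (\<rho> \<rightarrow> \<sigma> \<rightarrow> \<tau>) \<rightarrow> (\<rho> \<rightarrow> \<sigma>) \<rightarrow> \<rho> \<rightarrow> \<tau>"
| "const_ty CRec = (N \<rightarrow> N \<rightarrow> N) \<rightarrow> N \<rightarrow> N \<rightarrow> N"

fun cod :: "ty \<Rightarrow> ty" where
  "cod (\<rho> \<rightarrow> \<tau>) = \<tau>"
| "cod N = N"

text \<open>The type of a term; meaningful for well-typed terms only.\<close>

fun ty_of :: "tm \<Rightarrow> ty" where
  "ty_of (Var v) = snd v"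
| "ty_of (Const c) = const_ty c"
| "ty_of (t \<cdot> u) = cod (ty_of t)"

fun wt :: "tm \<Rightarrow> bool" where
  "wt (Var v) \<longleftrightarrow> True"
| "wt (Const c) \<longleftrightarrow> True"
| "wt (t \<cdot> u) \<longleftrightarrow> wt t \<and> wt u \<and> (\<exists>\<tau>. ty_of t = ty_of u \<rightarrow> \<tau>)"

text \<open>The only primitive equality is the one at type \<open>0\<close>. The logic is classical, so the
  remaining connectives are defined.\<close>

datatype fm =
    Eq tm tm  (infix "\<doteq>" 55)
  | Less tm tm  (infix "\<prec>" 55)
  | Bot
  | Imp fm fm  (infixr "\<^bold>\<longrightarrow>" 35)
  | All var fm  ("(\<^bold>\<forall>_./ _)" [1000, 20] 20)

definition Neg :: "fm \<Rightarrow> fm"  ("\<^bold>\<not> _" [50] 50) where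
  "Neg \<phi> = (\<phi> \<^bold>\<longrightarrow> Bot)"

definition Or :: "fm \<Rightarrow> fm \<Rightarrow> fm"  (infixr "\<^bold>\<or>" 40) where
  "(\<phi> \<^bold>\<or> \<psi>) = (\<^bold>\<not> \<phi> \<^bold>\<longrightarrow> \<psi>)"

definition And :: "fm \<Rightarrow> fm \<Rightarrow> fm"  (infixr "\<^bold>\<and>" 45) where
  "(\<phi> \<^bold>\<and> \<psi>) = (\<^bold>\<not> (\<phi> \<^bold>\<longrightarrow> \<^bold>\<not> \<psi>))"

definition Iff :: "fm \<Rightarrow> fm \<Rightarrow> fm"  (infix "\<^bold>\<longleftrightarrow>" 30) where
  "(\<phi> \<^bold>\<longleftrightarrow> \<psi>) = ((\<phi> \<^bold>\<longrightarrow> \<psi>) \<^bold>\<and> (\<psi> \<^bold>\<longrightarrow> \<phi>))"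

definition Ex :: "var \<Rightarrow> fm \<Rightarrow> fm"  ("(\<^bold>\<exists>_./ _)" [1000, 20] 20) where
  "(\<^bold>\<exists>v. \<phi>) = (\<^bold>\<not> (\<^bold>\<forall>v. \<^bold>\<not> \<phi>))"

fun wff :: "fm \<Rightarrow> bool" where
  "wff (t \<doteq> u) \<longleftrightarrow> wt t \<and> wt u \<and> ty_of t = N \<and> ty_of u = N"
| "wff (t \<prec> u) \<longleftrightarrow> wt t \<and> wt u \<and> ty_of t = N \<and> ty_of u = N"
| "wff Bot \<longleftrightarrow> True"
| "wff (\<phi> \<^bold>\<longrightarrow> \<psi>) \<longleftrightarrow> wff \<phi> \<and> wff \<psi>"
| "wff (\<^bold>\<forall>v. \<phi>) \<longleftrightarrow> wff \<phi>"

fun qf :: "fm \<Rightarrow> bool" where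
  "qf (t \<doteq> u) \<longleftrightarrow> True"
| "qf (t \<prec> u) \<longleftrightarrow> True"
| "qf Bot \<longleftrightarrow> True"
| "qf (\<phi> \<^bold>\<longrightarrow> \<psi>) \<longleftrightarrow> qf \<phi> \<and> qf \<psi>"
| "qf (\<^bold>\<forall>v. \<phi>) \<longleftrightarrow> False"

fun tvars :: "tm \<Rightarrow> var set" where
  "tvars (Var v) = {v}"
| "tvars (Const c) = {}"
| "tvars (t \<cdot> u) = tvars t \<union> tvars u"

fun fvars :: "fm \<Rightarrow> var set" where
  "fvars (t \<doteq> u) = tvars t \<union> tvars u"
| "fvars (t \<prec> u) = tvars t \<union> tvars u"
| "fvars Bot = {}"
| "fvars (\<phi> \<^bold>\<longrightarrow> \<psi>) = fvars \<phi> \<union> fvars \<psi>"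
| "fvars (\<^bold>\<forall>v. \<phi>) = fvars \<phi> - {v}"

fun tsubst :: "var \<Rightarrow> tm \<Rightarrow> tm \<Rightarrow> tm" where
  "tsubst v s (Var w) = (if w = v then s else Var w)"
| "tsubst v s (Const c) = Const c"
| "tsubst v s (t \<cdot> u) = tsubst v s t \<cdot> tsubst v s u"

text \<open>Substitution does not rename bound variables; \<open>free_for v s \<phi>\<close> says that no variable
  of \<open>s\<close> is captured in \<open>subst v s \<phi>\<close>.\<close>

fun subst :: "var \<Rightarrow> tm \<Rightarrow> fm \<Rightarrow> fm" where
  "subst v s (t \<doteq> u) = (tsubst v s t \<doteq> tsubst v s u)"
| "subst v s (t \<prec> u) = (tsubst v s t \<prec> tsubst v s u)"
| "subst v s Bot = Bot"
| "subst v s (\<phi> \<^bold>\<longrightarrow> \<psi>) = (subst v s \<phi> \<^bold>\<longrightarrow> subst v s \<psi>)"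
| "subst v s (\<^bold>\<forall>w. \<phi>) = (if w = v then (\<^bold>\<forall>w. \<phi>) else (\<^bold>\<forall>w. subst v s \<phi>))"

fun free_for :: "var \<Rightarrow> tm \<Rightarrow> fm \<Rightarrow> bool" where
  "free_for v s (t \<doteq> u) \<longleftrightarrow> True"
| "free_for v s (t \<prec> u) \<longleftrightarrow> True"
| "free_for v s Bot \<longleftrightarrow> True"
| "free_for v s (\<phi> \<^bold>\<longrightarrow> \<psi>) \<longleftrightarrow> free_for v s \<phi> \<and> free_for v s \<psi>"
| "free_for v s (\<^bold>\<forall>w. \<phi>) \<longleftrightarrow> v \<notin> fvars (\<^bold>\<forall>w. \<phi>) \<or> w \<notin> tvars s \<and> free_for v s \<phi>"

text \<open>Variables with index at least \<open>fresh t\<close> do not occur in \<open>t\<close>.\<close>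

fun fresh :: "tm \<Rightarrow> nat" where
  "fresh (Var v) = Suc (fst v)"
| "fresh (Const c) = 0"
| "fresh (t \<cdot> u) = max (fresh t) (fresh u)"


section \<open>Classical many-sorted predicate logic with equality at type \<open>0\<close>\<close>

text \<open>A Hilbert calculus. Formulas of \<open>T\<close> are non-logical axioms and are understood
  universally closed, so generalisation is unrestricted.\<close>

inductive proves :: "fm set \<Rightarrow> fm \<Rightarrow> bool"  (infix "\<turnstile>" 15) for T where
  axiom: "\<phi> \<in> T \<Longrightarrow> T \<turnstile> \<phi>"
| weaken: "wff \<phi> \<Longrightarrow> wff \<psi> \<Longrightarrow> T \<turnstile> \<phi> \<^bold>\<longrightarrow> \<psi> \<^bold>\<longrightarrow> \<phi>"
| distr: "wff \<phi> \<Longrightarrow> wff \<psi> \<Longrightarrow> wff \<chi> \<Longrightarrow>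
    T \<turnstile> (\<phi> \<^bold>\<longrightarrow> \<psi> \<^bold>\<longrightarrow> \<chi>) \<^bold>\<longrightarrow> (\<phi> \<^bold>\<longrightarrow> \<psi>) \<^bold>\<longrightarrow> \<phi> \<^bold>\<longrightarrow> \<chi>"
| classical: "wff \<phi> \<Longrightarrow> T \<turnstile> \<^bold>\<not> \<^bold>\<not> \<phi> \<^bold>\<longrightarrow> \<phi>"
| instance_of: "wff \<phi> \<Longrightarrow> wt t \<Longrightarrow> ty_of t = snd v \<Longrightarrow> free_for v t \<phi> \<Longrightarrow>
    T \<turnstile> (\<^bold>\<forall>v. \<phi>) \<^bold>\<longrightarrow> subst v t \<phi>"
| all_imp: "wff \<phi> \<Longrightarrow> wff \<psi> \<Longrightarrow> v \<notin> fvars \<phi> \<Longrightarrow>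
    T \<turnstile> (\<^bold>\<forall>v. \<phi> \<^bold>\<longrightarrow> \<psi>) \<^bold>\<longrightarrow> \<phi> \<^bold>\<longrightarrow> (\<^bold>\<forall>v. \<psi>)"
| eq_refl: "wt t \<Longrightarrow> ty_of t = N \<Longrightarrow> T \<turnstile> t \<doteq> t"
| eq_subst: "wff \<phi> \<Longrightarrow> snd v = N \<Longrightarrow> wt t \<Longrightarrow> ty_of t = N \<Longrightarrow> wt u \<Longrightarrow> ty_of u = N \<Longrightarrow>
    free_for v t \<phi> \<Longrightarrow> free_for v u \<phi> \<Longrightarrow>
    T \<turnstile> t \<doteq> u \<^bold>\<longrightarrow> subst v t \<phi> \<^bold>\<longrightarrow> subst v u \<phi>"
| mp: "T \<turnstile> \<phi> \<^bold>\<longrightarrow> \<psi> \<Longrightarrow> T \<turnstile> \<phi> \<Longrightarrow> T \<turnstile> \<psi>"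
| gen: "T \<turnstile> \<phi> \<Longrightarrow> T \<turnstile> \<^bold>\<forall>v. \<phi>"


section \<open>The base theory \<open>RCA\<^sub>0\<^sup>\<omega>\<close>\<close>

abbreviation zero :: tm where "zero \<equiv> Const CZero"
abbreviation suc :: "tm \<Rightarrow> tm" where "suc t \<equiv> Const CSuc \<cdot> t"
abbreviation plus :: "tm \<Rightarrow> tm \<Rightarrow> tm"  (infixl "\<^bold>+" 65) where "t \<^bold>+ u \<equiv> Const CPlus \<cdot> t \<cdot> u"
abbreviation times :: "tm \<Rightarrow> tm \<Rightarrow> tm"  (infixl "\<^bold>*" 70) where "t \<^bold>* u \<equiv> Const CTimes \<cdot> t \<cdot> u"
abbreviation rec :: "tm \<Rightarrow> tm \<Rightarrow> tm \<Rightarrow> tm" where "rec f m n \<equiv> Const CRec \<cdot> f \<cdot> m \<cdot> n"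

text \<open>Equality at higher types: \<open>x =\<^sub>\<tau> y\<close> abbreviates
  \<open>\<forall>z\<^sub>1 \<dots> z\<^sub>k. x z\<^sub>1 \<dots> z\<^sub>k =\<^sub>0 y z\<^sub>1 \<dots> z\<^sub>k\<close>.\<close>

fun eq_at :: "ty \<Rightarrow> tm \<Rightarrow> tm \<Rightarrow> fm" where
  "eq_at N t u = (t \<doteq> u)"
| "eq_at (\<rho> \<rightarrow> \<tau>) t u =
    (let z = (max (fresh t) (fresh u), \<rho>) in \<^bold>\<forall>z. eq_at \<tau> (t \<cdot> Var z) (u \<cdot> Var z))"

text \<open>The axioms for \<open>0\<close>, successor, \<open>+\<close>, \<open>\<times>\<close> and \<open><\<close> are the basic axioms of second-order
  arithmetic; with quantifier-free induction they yield a discretely ordered semiring.\<close>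

definition arith_axioms :: "fm set" where
  "arith_axioms =
    (let m = Var (0, N); n = Var (1, N)
     in {\<^bold>\<not> suc m \<doteq> zero,
         suc m \<doteq> suc n \<^bold>\<longrightarrow> m \<doteq> n,
         m \<^bold>+ zero \<doteq> m,
         m \<^bold>+ suc n \<doteq> suc (m \<^bold>+ n),
         m \<^bold>* zero \<doteq> zero,
         m \<^bold>* suc n \<doteq> m \<^bold>* n \<^bold>+ m,
         \<^bold>\<not> m \<prec> zero,
         m \<prec> suc n \<^bold>\<longleftrightarrow> (m \<prec> n \<^bold>\<or> m \<doteq> n)})"

inductive_set RCA0_omega :: "fm set" where
  arith: "\<phi> \<in> arith_axioms \<Longrightarrow> \<phi> \<in> RCA0_omega"
| comb_Pi: "x = Var (0, \<rho>) \<Longrightarrow> y = Var (1, \<sigma>) \<Longrightarrow>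
    eq_at \<rho> (Const (CPi \<rho> \<sigma>) \<cdot> x \<cdot> y) x \<in> RCA0_omega"
| comb_Sigma: "x = Var (0, \<rho> \<rightarrow> \<sigma> \<rightarrow> \<tau>) \<Longrightarrow> y = Var (1, \<rho> \<rightarrow> \<sigma>) \<Longrightarrow> z = Var (2, \<rho>) \<Longrightarrow>
    eq_at \<tau> (Const (CSigma \<rho> \<sigma> \<tau>) \<cdot> x \<cdot> y \<cdot> z) (x \<cdot> z \<cdot> (y \<cdot> z)) \<in> RCA0_omega"
| rec_zero: "f = Var (0, N \<rightarrow> N \<rightarrow> N) \<Longrightarrow> m = Var (1, N) \<Longrightarrow>
    (rec f m zero \<doteq> m) \<in> RCA0_omega"
| rec_suc: "f = Var (0, N \<rightarrow> N \<rightarrow> N) \<Longrightarrow> m = Var (1, N) \<Longrightarrow> n = Var (2, N) \<Longrightarrow>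
    (rec f m (suc n) \<doteq> f \<cdot> n \<cdot> rec f m n) \<in> RCA0_omega"
| extensionality: "x = Var (0, \<rho>) \<Longrightarrow> y = Var (1, \<rho>) \<Longrightarrow> f = Var (2, \<rho> \<rightarrow> \<tau>) \<Longrightarrow>
    (eq_at \<rho> x y \<^bold>\<longrightarrow> eq_at \<tau> (f \<cdot> x) (f \<cdot> y)) \<in> RCA0_omega"
| QF_induction: "wff \<phi> \<Longrightarrow> qf \<phi> \<Longrightarrow> snd n = N \<Longrightarrow>
    (subst n zero \<phi> \<^bold>\<and> (\<^bold>\<forall>n. \<phi> \<^bold>\<longrightarrow> subst n (suc (Var n)) \<phi>) \<^bold>\<longrightarrow> (\<^bold>\<forall>n. \<phi>)) \<in> RCA0_omega"
| QF_AC: "wff \<phi> \<Longrightarrow> qf \<phi> \<Longrightarrow> snd x = One \<Longrightarrow> snd y = N \<Longrightarrow> snd Y = Two \<Longrightarrow> Y \<notin> fvars \<phi> \<Longrightarrow>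
    ((\<^bold>\<forall>x. \<^bold>\<exists>y. \<phi>) \<^bold>\<longrightarrow> (\<^bold>\<exists>Y. \<^bold>\<forall>x. subst y (Var Y \<cdot> Var x) \<phi>)) \<in> RCA0_omega"


section \<open>Primitive recursive terms\<close>

text \<open>\<open>lam v t\<close> is \<open>\<lambda>v. t\<close>, by bracket abstraction. Below it is only applied so as to form
  closed terms, which are then applied to arguments; hence no variable of an argument can be
  captured.\<close>

fun lam :: "var \<Rightarrow> tm \<Rightarrow> tm" where
  "lam v (Var w) =
    (if w = v
     then Const (CSigma (snd v) (snd v \<rightarrow> snd v) (snd v))
            \<cdot> Const (CPi (snd v) (snd v \<rightarrow> snd v)) \<cdot> Const (CPi (snd v) (snd v))
     else Const (CPi (snd w) (snd v)) \<cdot> Var w)"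
| "lam v (Const c) = Const (CPi (const_ty c) (snd v)) \<cdot> Const c"
| "lam v (t \<cdot> u) =
    Const (CSigma (snd v) (ty_of u) (ty_of (t \<cdot> u))) \<cdot> lam v t \<cdot> lam v u"

definition one :: tm where "one = suc zero"

definition pred :: "tm \<Rightarrow> tm" where
  "pred t = rec (lam (0, N) (lam (1, N) (Var (0, N)))) zero t"

definition monus :: "tm \<Rightarrow> tm \<Rightarrow> tm"  (infixl "\<^bold>-" 65) where
  "t \<^bold>- u = rec (lam (0, N) (lam (1, N) (pred (Var (1, N))))) t u"

definition two_pow :: "tm \<Rightarrow> tm" where
  "two_pow t = rec (lam (0, N) (lam (1, N) (Var (1, N) \<^bold>+ Var (1, N)))) one t"

text \<open>Pairing \<open>(m, n) \<mapsto> (m + n)\<^sup>2 + m\<close>; as \<open>(m + n)\<^sup>2 \<le> p < (m + n + 1)\<^sup>2\<close> for the code \<open>p\<close>,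
  the components are recovered from the integer square root. In the recursion for the latter,
  \<open>s = \<lfloor>\<surd>m\<rfloor>\<close> is increased iff \<open>(s + 1)\<^sup>2 \<le> m + 1\<close>.\<close>

definition pair :: "tm \<Rightarrow> tm \<Rightarrow> tm" where
  "pair t u = (t \<^bold>+ u) \<^bold>* (t \<^bold>+ u) \<^bold>+ t"

definition isqrt :: "tm \<Rightarrow> tm" where
  "isqrt t =
    (let m = Var (0, N); s = Var (1, N)
     in rec (lam (0, N) (lam (1, N)
          (s \<^bold>+ (one \<^bold>- (one \<^bold>- (suc (suc m) \<^bold>- suc s \<^bold>* suc s)))))) zero t)"

definition p1 :: "tm \<Rightarrow> tm" where "p1 t = t \<^bold>- isqrt t \<^bold>* isqrt t"
definition p2 :: "tm \<Rightarrow> tm" where "p2 t = isqrt t \<^bold>- p1 t"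

text \<open>\<open>initial g n\<close> codes the finite sequence \<open>\<langle>g 0, \<dots>, g (n - 1)\<rangle>\<close>.\<close>

definition initial :: "tm \<Rightarrow> tm \<Rightarrow> tm" where
  "initial g n =
    rec (lam (0, One) (lam (0, N) (lam (1, N)
          (suc (pair (Var (1, N)) (Var (0, One) \<cdot> Var (0, N)))))) \<cdot> g) zero n"


section \<open>The functionals \<open>S\<^sub>k\<^sup>2\<close> and the system \<open>Z\<^sub>2\<^sup>\<omega>\<close>\<close>

text \<open>\<open>Sigma_formula k\<close> is the universal \<open>\<Sigma>\<^sup>1\<^sub>k\<close>-formula in Kleene normal form
  \<open>\<exists>g\<^sub>0 \<forall>g\<^sub>1 \<dots> Q g\<^sub>k\<^sub>-\<^sub>1 Q' n. f \<langle>g\<^sub>0|n, \<dots>, g\<^sub>k\<^sub>-\<^sub>1|n\<rangle> = 0\<close> with function parameter \<open>f\<close>,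
  where the quantifiers alternate. It is \<open>\<exists>n. f n = 0\<close> for \<open>k = 0\<close> and \<open>\<exists>g \<forall>n. f (g|n) = 0\<close>,
  the formula decided by the Suslin functional, for \<open>k = 1\<close>. The value \<open>0\<close> of \<open>S\<^sub>k\<^sup>2\<close> stands
  for truth.\<close>

definition alternating :: "nat \<Rightarrow> var \<Rightarrow> fm \<Rightarrow> fm" where
  "alternating i v \<phi> = (if even i then (\<^bold>\<exists>v. \<phi>) else (\<^bold>\<forall>v. \<phi>))"

definition f_par :: var where "f_par = (0, One)"
definition g_var :: "nat \<Rightarrow> var" where "g_var i = (Suc i, One)"
definition n_var :: var where "n_var = (0, N)"

fun initials :: "nat \<Rightarrow> tm" where
  "initials 0 = Var n_var"
| "initials (Suc 0) = initial (Var (g_var 0)) (Var n_var)"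
| "initials (Suc (Suc i)) = pair (initials (Suc i)) (initial (Var (g_var (Suc i))) (Var n_var))"

definition Sigma_formula :: "nat \<Rightarrow> fm" where
  "Sigma_formula k =
    foldr (\<lambda>i. alternating i (g_var i)) [0..<k]
      (alternating k n_var (Var f_par \<cdot> initials k \<doteq> zero))"

definition S_exists :: "nat \<Rightarrow> fm" where
  "S_exists k =
    (let S = (0, Two)
     in \<^bold>\<exists>S. \<^bold>\<forall>f_par.
          (Var S \<cdot> Var f_par \<doteq> zero \<^bold>\<or> Var S \<cdot> Var f_par \<doteq> one) \<^bold>\<and>
          (Var S \<cdot> Var f_par \<doteq> zero \<^bold>\<longleftrightarrow> Sigma_formula k))"

definition Pi1_CA0_omega :: "nat \<Rightarrow> fm set" where
  "Pi1_CA0_omega k = insert (S_exists k) RCA0_omega"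

definition Z2_omega :: "fm set" where
  "Z2_omega = (\<Union>k. Pi1_CA0_omega k)"


section \<open>Rational and real numbers\<close>

text \<open>Every number codes a rational: \<open>\<langle>a, \<langle>b, c\<rangle>\<rangle>\<close> codes \<open>(a - b) / (c + 1)\<close>.\<close>

definition mk_rat :: "tm \<Rightarrow> tm \<Rightarrow> tm \<Rightarrow> tm" where "mk_rat a b c = pair a (pair b c)"
definition pos_part :: "tm \<Rightarrow> tm" where "pos_part q = p1 q"
definition neg_part :: "tm \<Rightarrow> tm" where "neg_part q = p1 (p2 q)"
definition denom :: "tm \<Rightarrow> tm" where "denom q = suc (p2 (p2 q))"

definition rat_less :: "tm \<Rightarrow> tm \<Rightarrow> fm"  (infix "<\<^sub>Q" 55) where
  "q <\<^sub>Q r =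
    (pos_part q \<^bold>* denom r \<^bold>+ neg_part r \<^bold>* denom q \<prec> pos_part r \<^bold>* denom q \<^bold>+ neg_part q \<^bold>* denom r)"

definition rat_le :: "tm \<Rightarrow> tm \<Rightarrow> fm"  (infix "\<le>\<^sub>Q" 55) where
  "q \<le>\<^sub>Q r = (\<^bold>\<not> r <\<^sub>Q q)"

definition rat_zero :: tm where "rat_zero = mk_rat zero zero zero"
definition rat_one :: tm where "rat_one = mk_rat one zero zero"

definition rat_add :: "tm \<Rightarrow> tm \<Rightarrow> tm"  (infixl "+\<^sub>Q" 65) where
  "q +\<^sub>Q r =
    mk_rat (pos_part q \<^bold>* denom r \<^bold>+ pos_part r \<^bold>* denom q)
      (neg_part q \<^bold>* denom r \<^bold>+ neg_part r \<^bold>* denom q)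
      (pred (denom q \<^bold>* denom r))"

definition rat_neg :: "tm \<Rightarrow> tm" where
  "rat_neg q = mk_rat (neg_part q) (pos_part q) (pred (denom q))"

definition rat_abs :: "tm \<Rightarrow> tm" where
  "rat_abs q =
    mk_rat ((pos_part q \<^bold>- neg_part q) \<^bold>+ (neg_part q \<^bold>- pos_part q)) zero (pred (denom q))"

definition rat_diff :: "tm \<Rightarrow> tm \<Rightarrow> tm"  (infixl "-\<^sub>Q" 65) where
  "q -\<^sub>Q r = q +\<^sub>Q rat_neg r"

text \<open>\<open>half_pow n\<close> is \<open>2\<^sup>-\<^sup>n\<close>.\<close>

definition half_pow :: "tm \<Rightarrow> tm" where
  "half_pow n = mk_rat one zero (pred (two_pow n))"

text \<open>A type \<open>1\<close> object \<open>x\<close> represents a real if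
  \<open>\<bar>x(n) - x(n + i)\<bar> < 2\<^sup>-\<^sup>n\<close> for all \<open>n\<close> and \<open>i\<close>. Equality of reals is
  \<open>\<forall>n. \<bar>x(n) - y(n)\<bar> \<le> 2\<^sup>-\<^sup>n\<^sup>+\<^sup>1\<close>, and \<open>x < y\<close> is \<open>\<exists>n. x(n) + 2\<^sup>-\<^sup>n\<^sup>+\<^sup>1 < y(n)\<close>.\<close>

definition is_real :: "tm \<Rightarrow> fm" where
  "is_real x =
    (let n = (fresh x, N); i = (Suc (fresh x), N)
     in \<^bold>\<forall>n. \<^bold>\<forall>i. rat_abs (x \<cdot> Var n -\<^sub>Q x \<cdot> (Var n \<^bold>+ Var i)) <\<^sub>Q half_pow (Var n))"

definition real_eq :: "tm \<Rightarrow> tm \<Rightarrow> fm"  (infix "=\<^sub>R" 55) where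
  "x =\<^sub>R y =
    (let n = (max (fresh x) (fresh y), N)
     in \<^bold>\<forall>n. rat_abs (x \<cdot> Var n -\<^sub>Q y \<cdot> Var n) \<le>\<^sub>Q half_pow (Var n) +\<^sub>Q half_pow (Var n))"

definition real_less :: "tm \<Rightarrow> tm \<Rightarrow> fm"  (infix "<\<^sub>R" 55) where
  "x <\<^sub>R y =
    (let n = (max (fresh x) (fresh y), N)
     in \<^bold>\<exists>n. x \<cdot> Var n +\<^sub>Q (half_pow (Var n) +\<^sub>Q half_pow (Var n)) <\<^sub>Q y \<cdot> Var n)"

definition real_le :: "tm \<Rightarrow> tm \<Rightarrow> fm"  (infix "\<le>\<^sub>R" 55) where
  "x \<le>\<^sub>R y = (\<^bold>\<not> y <\<^sub>R x)"

definition rat_real :: "tm \<Rightarrow> tm" where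
  "rat_real q = Const (CPi N N) \<cdot> q"

text \<open>\<open>\<bar>x - y\<bar>\<close> has the \<open>n\<close>-th approximation \<open>\<bar>x(n + 1) - y(n + 1)\<bar>\<close>.\<close>

definition real_dist :: "tm \<Rightarrow> tm \<Rightarrow> tm" where
  "real_dist x y =
    lam (0, One) (lam (1, One) (lam (0, N)
      (rat_abs (Var (0, One) \<cdot> suc (Var (0, N)) -\<^sub>Q Var (1, One) \<cdot> suc (Var (0, N)))))) \<cdot> x \<cdot> y"

definition all_real :: "var \<Rightarrow> fm \<Rightarrow> fm"  ("(\<^bold>\<forall>_ \<in> R./ _)" [1000, 20] 20) where
  "(\<^bold>\<forall>x \<in> R. \<phi>) = (\<^bold>\<forall>x. is_real (Var x) \<^bold>\<longrightarrow> \<phi>)"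


section \<open>Sets of reals and \<open>HBC\<close>\<close>

definition real_function :: "tm \<Rightarrow> fm" where
  "real_function F =
    (let x = (fresh F, One); y = (Suc (fresh F), One)
     in (\<^bold>\<forall>x \<in> R. is_real (F \<cdot> Var x)) \<^bold>\<and>
        (\<^bold>\<forall>x \<in> R. \<^bold>\<forall>y \<in> R. Var x =\<^sub>R Var y \<^bold>\<longrightarrow> F \<cdot> Var x =\<^sub>R F \<cdot> Var y))"

definition mem :: "tm \<Rightarrow> tm \<Rightarrow> fm"  (infix "\<epsilon>" 55) where
  "x \<epsilon> Y = (rat_real rat_zero <\<^sub>R Y \<cdot> x)"

text \<open>Openness of \<open>{x \<in> \<real>. M x}\<close>, where the free variables of \<open>M x\<close> other than \<open>x\<close> have index
  below \<open>k\<close>. It is used for \<open>M\<close> the membership in a set and in the complement of a set; the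
  rational \<open>r\<close> is quantified as a code.\<close>

definition open_where :: "nat \<Rightarrow> (tm \<Rightarrow> fm) \<Rightarrow> fm" where
  "open_where k M =
    (let x = (k, One); y = (Suc k, One); r = (k, N)
     in \<^bold>\<forall>x \<in> R. M (Var x) \<^bold>\<longrightarrow>
          (\<^bold>\<exists>r. rat_zero <\<^sub>Q Var r \<^bold>\<and>
             (\<^bold>\<forall>y \<in> R. real_dist (Var x) (Var y) <\<^sub>R rat_real (Var r) \<^bold>\<longrightarrow> M (Var y))))"

definition open_set :: "tm \<Rightarrow> fm" where
  "open_set Y = open_where (fresh Y) (\<lambda>x. x \<epsilon> Y)"

definition closed_set :: "tm \<Rightarrow> fm" where
  "closed_set Y = open_where (fresh Y) (\<lambda>x. \<^bold>\<not> x \<epsilon> Y)"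

definition HBC :: fm where
  "HBC =
    (let C = (0, One \<rightarrow> One); a = (0, N \<rightarrow> One); b = (1, N \<rightarrow> One);
         n = (0, N); n\<^sub>0 = (1, N); x = (0, One);
         covered = Var a \<cdot> Var n <\<^sub>R Var x \<^bold>\<and> Var x <\<^sub>R Var b \<cdot> Var n
     in \<^bold>\<forall>C. real_function (Var C) \<^bold>\<and> closed_set (Var C) \<^bold>\<and>
          (\<^bold>\<forall>x \<in> R. Var x \<epsilon> Var C \<^bold>\<longrightarrow>
             rat_real rat_zero \<le>\<^sub>R Var x \<^bold>\<and> Var x \<le>\<^sub>R rat_real rat_one) \<^bold>\<longrightarrow>
        (\<^bold>\<forall>a. \<^bold>\<forall>b. (\<^bold>\<forall>n. is_real (Var a \<cdot> Var n) \<^bold>\<and> is_real (Var b \<cdot> Var n)) \<^bold>\<and>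
          (\<^bold>\<forall>x \<in> R. Var x \<epsilon> Var C \<^bold>\<longrightarrow> (\<^bold>\<exists>n. covered)) \<^bold>\<longrightarrow>
          (\<^bold>\<exists>n\<^sub>0. \<^bold>\<forall>x \<in> R. Var x \<epsilon> Var C \<^bold>\<longrightarrow> (\<^bold>\<exists>n. \<^bold>\<not> Var n\<^sub>0 \<prec> Var n \<^bold>\<and> covered))))"

end

(* A Henkin model with standard numbers refutes HBC. Its functions N -> N form the union A of
   countable sets A_0, A_1, ... Each A_k is closed under Skolem functions for the formulas in
   which all variables have type 0 or 1; so these formulas have the same truth value over A as
   over all functions, and each A_k can be closed under their truth sets as well, which puts all
   S_k into the model. A functional belongs to the model iff, from some k on, it maps sequences
   that are uniformly in A_j to sequences that are uniformly in A_j, hereditarily. Hence an infinite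
   set of reals that meets every A_k in a finite set belongs to the model, although the model has
   no infinite sequence of its points.
   Let U be the union of intervals of total length 1/2 around all rationals, and let z be a
   point of [0,1] that is neither in U nor a real of A. Reals c_k in U that belong to A_(k+1) but not to A_k
   and converge to z form such a set. It is closed in the sense of A because z is missing, and the
   intervals of U cover it, but finitely many of them stay away from z. *)

theory Submission
  imports
    "HOL-Analysis.Analysis"
    "HOL-Library.Countable_Set_Type"
    "HOL-Library.Discrete_Functions"
    Defs
begin

text \<open>Two demands pull against each other: choice and the functionals S_k call for closure
  under search and truth, yet nothing in the model may list the points c_k. The way out is to ask
  functionals to preserve levels. Applied to parameters from A_j, with j late enough, they never
  lead to a point added after A_j, however discontinuous they are. Membership of the bad set passes
  this test, because on a sequence from A_j only the c_i with i < j count, and they lie in A_j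
  themselves. Truth sets and Skolem functions are taken over all functions, hence fixed before the
  chain exists. Closing a level under them is thus an ordinary countable closure and not circular.
  As U has measure at most 1/2 and the reals of A are countable, some z is left over. That U
  contains all rationals matters twice: U is dense, so the c_k can be found near z, and U contains
  the ends of its intervals, so that z has positive distance from each single interval.\<close>

no_notation funcset (infixr "\<rightarrow>" 60)

section \<open>A countably continuous graph model\<close>

text \<open>Elements of all finite types live in the single type \<open>tok set\<close>. A token \<open>Arr a t\<close> says that
  \<open>t\<close> is in the value whenever \<open>a\<close> is included in the argument. As \<open>a\<close> may be countably infinite and thus
  contain a whole function on the numbers, every functional of type 2 is represented, however
  discontinuous.\<close>

datatype tok = At nat | Arr "tok cset" tok

definition app :: "tok set \<Rightarrow> tok set \<Rightarrow> tok set" where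
  "app u v = {t. \<exists>a. Arr a t \<in> u \<and> rcset a \<subseteq> v}"

definition num :: "nat \<Rightarrow> tok set" where "num n = {At n}"

lemma num_inject [simp]: "num m = num n \<longleftrightarrow> m = n"
  by (simp add: num_def)

lemma At_in_num [simp]: "At m \<in> num n \<longleftrightarrow> m = n"
  by (simp add: num_def)

definition small_below :: "(nat \<Rightarrow> tok set) \<Rightarrow> (nat \<Rightarrow> tok set) \<Rightarrow> bool" where
  "small_below \<sigma> \<rho> \<longleftrightarrow> (\<forall>i. countable (\<sigma> i) \<and> \<sigma> i \<subseteq> \<rho> i)"

text \<open>The index of \<open>\<rho>\<close> numbers the variables of an expression; \<open>abs1\<close>, \<open>abs2\<close> and \<open>abs3\<close> below abstract over
  the variables \<open>0\<close>, \<open>1\<close>, \<open>2\<close>.\<close>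

definition cont :: "((nat \<Rightarrow> tok set) \<Rightarrow> tok set) \<Rightarrow> bool" where
  "cont F \<longleftrightarrow> (\<forall>\<rho> t. t \<in> F \<rho> \<longleftrightarrow> (\<exists>\<sigma>. small_below \<sigma> \<rho> \<and> t \<in> F \<sigma>))"

lemma small_below_mono: "small_below \<sigma> \<rho> \<Longrightarrow> (\<And>i. \<rho> i \<subseteq> \<rho>' i) \<Longrightarrow> small_below \<sigma> \<rho>'"
  unfolding small_below_def by (meson subset_trans)

lemma cont_mono: "cont F \<Longrightarrow> (\<And>i. \<rho> i \<subseteq> \<rho>' i) \<Longrightarrow> F \<rho> \<subseteq> F \<rho>'"
  unfolding cont_def using small_below_mono[of _ \<rho> \<rho>'] by (metis subsetI)

text \<open>One approximation serves a countable set of tokens: unite the approximations found for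
  its members. This is what \<open>cont_app\<close> needs, where a token \<open>Arr a t\<close> asks
  for all of the countable set \<open>a\<close> at once.\<close>

lemma cont_countable:
  assumes "cont F" "countable T" "T \<subseteq> F \<rho>"
  obtains \<sigma> where "small_below \<sigma> \<rho>" "T \<subseteq> F \<sigma>"
proof -
  have "\<exists>\<sigma>. small_below \<sigma> \<rho> \<and> t \<in> F \<sigma>" if "t \<in> T" for t
    using assms that unfolding cont_def by blast
  then obtain s where s: "\<And>t. t \<in> T \<Longrightarrow> small_below (s t) \<rho> \<and> t \<in> F (s t)" by metis
  let ?\<sigma> = "\<lambda>i. \<Union>t\<in>T. s t i"
  have 1: "small_below ?\<sigma> \<rho>"
    using s assms(2) unfolding small_below_def by (auto intro!: countable_UN)
  have "t \<in> F ?\<sigma>" if "t \<in> T" for t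
    using cont_mono[OF assms(1), of "s t" ?\<sigma>] s that by blast
  with 1 show ?thesis using that by blast
qed

lemma contI:
  assumes "\<And>\<rho> \<rho>'. (\<And>i. \<rho> i \<subseteq> \<rho>' i) \<Longrightarrow> F \<rho> \<subseteq> F \<rho>'"
    and "\<And>\<rho> t. t \<in> F \<rho> \<Longrightarrow> \<exists>\<sigma>. small_below \<sigma> \<rho> \<and> t \<in> F \<sigma>"
  shows "cont F"
  unfolding cont_def
proof (intro allI iffI)
  fix \<rho> t
  assume "\<exists>\<sigma>. small_below \<sigma> \<rho> \<and> t \<in> F \<sigma>"
  then obtain \<sigma> where s: "small_below \<sigma> \<rho>" "t \<in> F \<sigma>" by blast
  then have "\<sigma> i \<subseteq> \<rho> i" for i unfolding small_below_def by simp
  with assms(1)[of \<sigma> \<rho>] s show "t \<in> F \<rho>" by blast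
qed (rule assms(2))

lemma cont_var: "cont (\<lambda>\<rho>. \<rho> i)"
proof (rule contI)
  fix \<rho> :: "nat \<Rightarrow> tok set" and t
  assume "t \<in> \<rho> i"
  then show "\<exists>\<sigma>. small_below \<sigma> \<rho> \<and> t \<in> \<sigma> i"
    by (intro exI[of _ "(\<lambda>_. {})(i := {t})"]) (auto simp: small_below_def)
next
  fix \<rho> \<rho>' :: "nat \<Rightarrow> tok set"
  assume "\<And>i. \<rho> i \<subseteq> \<rho>' i"
  then show "\<rho> i \<subseteq> \<rho>' i" .
qed

lemma cont_const: "cont (\<lambda>\<rho>. c)"
proof (rule contI)
  fix \<rho> :: "nat \<Rightarrow> tok set" and t
  assume "t \<in> c"
  then show "\<exists>\<sigma>. small_below \<sigma> \<rho> \<and> t \<in> c"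
    by (intro exI[of _ "\<lambda>_. {}"]) (simp add: small_below_def)
qed (rule subset_refl)

lemma cont_UN:
  assumes "\<And>n. cont (F n)"
  shows "cont (\<lambda>\<rho>. \<Union>n. F n \<rho>)"
proof (rule contI)
  fix \<rho> \<rho>' :: "nat \<Rightarrow> tok set"
  assume *: "\<And>i. \<rho> i \<subseteq> \<rho>' i"
  show "(\<Union>n. F n \<rho>) \<subseteq> (\<Union>n. F n \<rho>')" by (rule UN_mono[OF subset_refl cont_mono[OF assms *]])
next
  fix \<rho> t assume "t \<in> (\<Union>n. F n \<rho>)"
  then obtain n where "t \<in> F n \<rho>" by blast
  then obtain \<sigma> where "small_below \<sigma> \<rho>" "t \<in> F n \<sigma>"
    using assms[of n] unfolding cont_def by blast
  then show "\<exists>\<sigma>. small_below \<sigma> \<rho> \<and> t \<in> (\<Union>n. F n \<sigma>)" by blast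
qed

lemma cont_app:
  assumes F: "cont F" and G: "cont G"
  shows "cont (\<lambda>\<rho>. app (F \<rho>) (G \<rho>))"
proof (rule contI)
  fix \<rho> \<rho>' :: "nat \<Rightarrow> tok set"
  assume *: "\<And>i. \<rho> i \<subseteq> \<rho>' i"
  show "app (F \<rho>) (G \<rho>) \<subseteq> app (F \<rho>') (G \<rho>')"
    using cont_mono[OF F, of \<rho> \<rho>', OF *] cont_mono[OF G, of \<rho> \<rho>', OF *]
    unfolding app_def by blast
next
  fix \<rho> t assume "t \<in> app (F \<rho>) (G \<rho>)"
  then obtain a where a: "Arr a t \<in> F \<rho>" "rcset a \<subseteq> G \<rho>" unfolding app_def by blast
  obtain \<sigma> where s: "small_below \<sigma> \<rho>" "Arr a t \<in> F \<sigma>"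
    using F a(1) unfolding cont_def by blast
  obtain \<sigma>' where s': "small_below \<sigma>' \<rho>" "rcset a \<subseteq> G \<sigma>'"
    using cont_countable[OF G _ a(2)] by (auto simp: rcset)
  let ?\<tau> = "\<lambda>i. \<sigma> i \<union> \<sigma>' i"
  have "small_below ?\<tau> \<rho>" using s s' by (auto simp: small_below_def)
  moreover have "Arr a t \<in> F ?\<tau>" using cont_mono[OF F, of \<sigma> ?\<tau>] s by blast
  moreover have "rcset a \<subseteq> G ?\<tau>" using cont_mono[OF G, of \<sigma>' ?\<tau>] s' by blast
  ultimately show "\<exists>\<sigma>. small_below \<sigma> \<rho> \<and> t \<in> app (F \<sigma>) (G \<sigma>)"
    unfolding app_def by blast
qed

text \<open>Countably many conditions on continuous expressions depend on countably many tokens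
  only. \<open>X t\<close> collects the data from which the token \<open>t\<close> is built.\<close>

lemma cont_Collect:
  assumes F: "\<And>i::nat. cont (F i)"
  shows "cont (\<lambda>\<rho>. {t. \<exists>x\<in>X t. \<forall>i. T x i \<in> F i \<rho>})"
proof (rule contI)
  fix \<rho> \<rho>' :: "nat \<Rightarrow> tok set"
  assume *: "\<And>i. \<rho> i \<subseteq> \<rho>' i"
  have "F i \<rho> \<subseteq> F i \<rho>'" for i
    by (rule cont_mono[OF F *])
  then show "{t. \<exists>x\<in>X t. \<forall>i. T x i \<in> F i \<rho>} \<subseteq> {t. \<exists>x\<in>X t. \<forall>i. T x i \<in> F i \<rho>'}"
    by blast
next
  fix \<rho> t assume "t \<in> {t. \<exists>x\<in>X t. \<forall>i. T x i \<in> F i \<rho>}"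
  then obtain x where x: "x \<in> X t" "\<And>i. T x i \<in> F i \<rho>" by blast
  have "\<exists>\<sigma>. small_below \<sigma> \<rho> \<and> T x i \<in> F i \<sigma>" for i
    using F x(2) unfolding cont_def by blast
  then obtain s where s: "\<And>i. small_below (s i) \<rho>" "\<And>i. T x i \<in> F i (s i)" by metis
  let ?\<sigma> = "\<lambda>j. \<Union>i. s i j"
  have "small_below ?\<sigma> \<rho>" using s(1) by (auto simp: small_below_def)
  moreover have "T x i \<in> F i ?\<sigma>" for i using cont_mono[OF F, of "s i" ?\<sigma>] s(2) by blast
  ultimately show "\<exists>\<sigma>. small_below \<sigma> \<rho> \<and> t \<in> {t. \<exists>x\<in>X t. \<forall>i. T x i \<in> F i \<sigma>}"
    using x(1) by blast
qed

section \<open>Graphs of continuous maps in up to three arguments\<close>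

definition abs1 :: "(tok set \<Rightarrow> tok set) \<Rightarrow> tok set" where
  "abs1 F = {Arr a t |a t. t \<in> F (rcset a)}"

text \<open>The nested graph is written out at once, so that joint continuity of \<open>F\<close>
  suffices and no continuity of an inner abstraction has to be shown.\<close>

definition abs2 :: "(tok set \<Rightarrow> tok set \<Rightarrow> tok set) \<Rightarrow> tok set" where
  "abs2 F = {Arr a (Arr b t) |a b t. t \<in> F (rcset a) (rcset b)}"

definition abs3 :: "(tok set \<Rightarrow> tok set \<Rightarrow> tok set \<Rightarrow> tok set) \<Rightarrow> tok set" where
  "abs3 F = {Arr a (Arr b (Arr c t)) |a b c t. t \<in> F (rcset a) (rcset b) (rcset c)}"

lemma rcset_surj: "countable a \<Longrightarrow> \<exists>b. rcset b = a"
  by (intro exI[of _ "acset a"]) (simp add: acset_inverse)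

lemma cont_app3:
  assumes "cont (\<lambda>\<rho>. F (\<rho> 0) (\<rho> 1) (\<rho> (2::nat)))"
  shows "t \<in> F u v w \<longleftrightarrow>
    (\<exists>a b c. rcset a \<subseteq> u \<and> rcset b \<subseteq> v \<and> rcset c \<subseteq> w \<and> t \<in> F (rcset a) (rcset b) (rcset c))"
proof
  \<comment> \<open>\<open>cont\<close> speaks of assignments to infinitely many variables; the
    third argument is repeated at all later indices.\<close>
  define \<rho> where "\<rho> i = (if i = 0 then u else if i = 1 then v else w)" for i :: nat
  assume "t \<in> F u v w"
  then have "t \<in> F (\<rho> 0) (\<rho> 1) (\<rho> 2)" by (simp add: \<rho>_def)
  then obtain \<sigma> where s: "small_below \<sigma> \<rho>" "t \<in> F (\<sigma> 0) (\<sigma> 1) (\<sigma> 2)"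
    using assms unfolding cont_def by blast
  obtain a b c where "rcset a = \<sigma> 0" "rcset b = \<sigma> 1" "rcset c = \<sigma> 2"
    using s(1) rcset_surj unfolding small_below_def by meson
  moreover have "\<sigma> i \<subseteq> \<rho> i" for i
    using s(1) unfolding small_below_def by simp
  from this[of 0] this[of 1] this[of 2] have "\<sigma> 0 \<subseteq> u" "\<sigma> 1 \<subseteq> v" "\<sigma> 2 \<subseteq> w"
    by (simp_all add: \<rho>_def)
  ultimately show "\<exists>a b c. rcset a \<subseteq> u \<and> rcset b \<subseteq> v \<and> rcset c \<subseteq> w \<and>
      t \<in> F (rcset a) (rcset b) (rcset c)"
    using s(2) by metis
next
  define \<rho> where "\<rho> i = (if i = 0 then u else if i = 1 then v else w)" for i :: nat
  assume "\<exists>a b c. rcset a \<subseteq> u \<and> rcset b \<subseteq> v \<and> rcset c \<subseteq> w \<and>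
      t \<in> F (rcset a) (rcset b) (rcset c)"
  then obtain a b c where abc: "rcset a \<subseteq> u" "rcset b \<subseteq> v" "rcset c \<subseteq> w"
    "t \<in> F (rcset a) (rcset b) (rcset c)" by blast
  define \<sigma> where "\<sigma> i = (if i = 0 then rcset a else if i = 1 then rcset b else rcset c)" for i :: nat
  have "\<And>i. \<sigma> i \<subseteq> \<rho> i" using abc by (simp add: \<sigma>_def \<rho>_def)
  with cont_mono[OF assms, of \<sigma> \<rho>] abc(4) show "t \<in> F u v w"
    by (auto simp: \<sigma>_def \<rho>_def)
qed

lemma app_abs3:
  assumes "cont (\<lambda>\<rho>. F (\<rho> 0) (\<rho> 1) (\<rho> 2))"
  shows "app (app (app (abs3 F) u) v) w = F u v w"
  unfolding set_eq_iff cont_app3[OF assms, of _ u v w] by (auto simp: app_def abs3_def)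

lemma app_abs2:
  assumes "cont (\<lambda>\<rho>. F (\<rho> 0) (\<rho> 1))"
  shows "app (app (abs2 F) u) v = F u v"
proof -
  have "t \<in> F u v \<longleftrightarrow> (\<exists>a b. rcset a \<subseteq> u \<and> rcset b \<subseteq> v \<and> t \<in> F (rcset a) (rcset b))" for t
    using cont_app3[of "\<lambda>x y _. F x y" t u v UNIV] assms by auto
  then show ?thesis unfolding set_eq_iff app_def abs2_def by simp blast
qed

lemma app_abs1:
  assumes "cont (\<lambda>\<rho>. F (\<rho> 0))"
  shows "app (abs1 F) u = F u"
proof -
  have "t \<in> F u \<longleftrightarrow> (\<exists>a. rcset a \<subseteq> u \<and> t \<in> F (rcset a))" for t
    using cont_app3[of "\<lambda>x _ _. F x" t u UNIV UNIV] assms by auto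
  then show ?thesis by (auto simp: app_def abs1_def)
qed

lemma all_nat_split: "(\<forall>i. P i) \<longleftrightarrow> P 0 \<and> (\<forall>i. P (Suc i))"
  by (metis nat.exhaust)

lemma cont_Int:
  assumes "cont F" "cont G"
  shows "cont (\<lambda>\<rho>. {t. s \<in> F \<rho> \<and> t \<in> G \<rho>})"
proof -
  have "cont (\<lambda>\<rho>. {t. \<exists>x\<in>{t}. \<forall>i::nat. (if i = 0 then s else x) \<in> (if i = 0 then F else G) \<rho>})"
    by (rule cont_Collect) (simp add: assms)
  moreover have "(\<forall>i::nat. (if i = 0 then s else x) \<in> (if i = 0 then F else G) \<rho>) \<longleftrightarrow>
      s \<in> F \<rho> \<and> x \<in> G \<rho>" for x \<rho>
    by (subst all_nat_split) simp
  ultimately show ?thesis by simp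
qed

lemma cont_At2:
  assumes "cont F" "cont G"
  shows "cont (\<lambda>\<rho>. {At (f m n) |m n. At m \<in> F \<rho> \<and> At n \<in> G \<rho>})"
proof -
  have "cont (\<lambda>\<rho>. {t. \<exists>x\<in>{(m, n). t = At (f m n)}.
      \<forall>i::nat. At ((if i = 0 then fst else snd) x) \<in> (if i = 0 then F else G) \<rho>})"
    by (rule cont_Collect) (simp add: assms)
  moreover have "(\<forall>i::nat. At ((if i = 0 then fst else snd) x) \<in> (if i = 0 then F else G) \<rho>) \<longleftrightarrow>
      At (fst x) \<in> F \<rho> \<and> At (snd x) \<in> G \<rho>" for x \<rho>
    by (subst all_nat_split) simp
  ultimately show ?thesis by (simp add: Bex_def conj_commute conj_left_commute)
qed

text \<open>Reading off a whole function takes one condition for each argument, hence a countable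
  conjunction. No condition on \<open>\<Phi>\<close> arises, which is why all functionals of type 2
  are representable. Condition 0 concerns \<open>G\<close>, condition \<open>Suc n\<close> the value
  at \<open>n\<close>.\<close>

lemma cont_At_fun:
  assumes "cont F" "cont G"
  shows "cont (\<lambda>\<rho>. {At (\<Phi> f m) |f m. (\<forall>n. At (f n) \<in> app (F \<rho>) (num n)) \<and> At m \<in> G \<rho>})"
proof -
  let ?H = "\<lambda>i::nat. if i = 0 then G else (\<lambda>\<rho>. app (F \<rho>) (num (i - 1)))"
  let ?T = "\<lambda>x i. At (if i = 0 then snd x else fst x (i - 1))"
  have "cont (\<lambda>\<rho>. {t. \<exists>x\<in>{(f, m). t = At (\<Phi> f m)}. \<forall>i::nat. ?T x i \<in> ?H i \<rho>})"
    by (rule cont_Collect) (simp add: assms cont_app cont_const)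
  moreover have "(\<forall>i::nat. ?T x i \<in> ?H i \<rho>) \<longleftrightarrow>
      (\<forall>n. At (fst x n) \<in> app (F \<rho>) (num n)) \<and> At (snd x) \<in> G \<rho>" for x \<rho>
    by (subst all_nat_split) auto
  ultimately show ?thesis by (simp add: Bex_def conj_commute conj_left_commute)
qed


section \<open>Token sets for numerical functions and functionals of type 2\<close>

definition rep1 :: "(nat \<Rightarrow> nat) \<Rightarrow> tok set" where
  "rep1 f = abs1 (\<lambda>u. {At (f m) |m n. At m \<in> u \<and> At n \<in> u})"

definition rep2 :: "(nat \<Rightarrow> nat \<Rightarrow> nat) \<Rightarrow> tok set" where
  "rep2 f = abs2 (\<lambda>u v. {At (f m n) |m n. At m \<in> u \<and> At n \<in> v})"

definition repF1 :: "((nat \<Rightarrow> nat) \<Rightarrow> nat \<Rightarrow> nat) \<Rightarrow> tok set" where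
  "repF1 \<Phi> = abs2 (\<lambda>u v. {At (\<Phi> f m) |f m. (\<forall>n. At (f n) \<in> app u (num n)) \<and> At m \<in> v})"

text \<open>The condition on \<open>num 0\<close> is met by \<open>m = 0\<close> and gives the body
  the shape of \<open>cont_At_fun\<close>.\<close>

definition repF :: "((nat \<Rightarrow> nat) \<Rightarrow> nat) \<Rightarrow> tok set" where
  "repF \<Phi> = abs1 (\<lambda>u. {At (\<Phi> f) |f m. (\<forall>n. At (f n) \<in> app u (num n)) \<and> At m \<in> num 0})"

text \<open>Many token sets represent the same function, since only the values at numerals count;
  \<open>rep1 f\<close> is the canonical one.\<close>

definition represents :: "tok set \<Rightarrow> (nat \<Rightarrow> nat) \<Rightarrow> bool" where
  "represents u f \<longleftrightarrow> (\<forall>n. app u (num n) = num (f n))"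

lemma represents_app: "represents u f \<Longrightarrow> app u (num n) = num (f n)"
  by (simp add: represents_def)

lemma app_rep1: "app (rep1 f) (num n) = num (f n)"
  unfolding rep1_def by (subst app_abs1, intro cont_At2 cont_var) (simp add: num_def)

lemma represents_rep1: "represents (rep1 f) f"
  by (simp add: represents_def app_rep1)

lemma app_rep2: "app (app (rep2 f) (num m)) (num n) = num (f m n)"
  unfolding rep2_def by (subst app_abs2, intro cont_At2 cont_var) (simp add: num_def)

lemma At_app_represents: "represents u f \<Longrightarrow> (\<forall>n. At (g n) \<in> app u (num n)) \<longleftrightarrow> g = f"
  by (auto simp: represents_def fun_eq_iff)

lemma app_repF1: "represents u f \<Longrightarrow> app (app (repF1 \<Phi>) u) (num n) = num (\<Phi> f n)"
  unfolding repF1_def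
  by (subst app_abs2, intro cont_At_fun cont_var) (simp add: At_app_represents, simp add: num_def)

lemma app_repF: "represents u f \<Longrightarrow> app (repF \<Phi>) u = num (\<Phi> f)"
  unfolding repF_def
  by (subst app_abs1, intro cont_At_fun cont_var cont_const) (simp add: At_app_represents, simp add: num_def)

fun iter_rec :: "tok set \<Rightarrow> tok set \<Rightarrow> nat \<Rightarrow> tok set" where
  "iter_rec f m 0 = m"
| "iter_rec f m (Suc k) = app (app f (num k)) (iter_rec f m k)"

lemma cont_iter_rec: "cont F \<Longrightarrow> cont G \<Longrightarrow> cont (\<lambda>\<rho>. iter_rec (F \<rho>) (G \<rho>) k)"
  by (induction k) (simp_all add: cont_app cont_const)

lemma iter_rec_eq:
  assumes "\<And>a b. app (app f (num a)) (num b) = num (g a b)"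
  shows "iter_rec f (num m) k = num (rec_nat m g k)"
  by (induction k) (simp_all add: assms)

text \<open>In the clause for \<open>CRec\<close>, the union over all \<open>k\<close> with
  \<open>At k\<close> in \<open>n\<close> is a continuous way to read the number off
  \<open>n\<close>; at a numeral it reduces to a single iterate.\<close>

fun const_val :: "const \<Rightarrow> tok set" where
  "const_val CZero = num 0"
| "const_val CSuc = rep1 Suc"
| "const_val CPlus = rep2 (+)"
| "const_val CTimes = rep2 (*)"
| "const_val (CPi \<rho> \<sigma>) = abs2 (\<lambda>u v. u)"
| "const_val (CSigma \<rho> \<sigma> \<tau>) = abs3 (\<lambda>u v w. app (app u w) (app v w))"
| "const_val CRec = abs3 (\<lambda>f m n. \<Union>k. {t. At k \<in> n \<and> t \<in> iter_rec f m k})"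

lemma app_K: "app (app (const_val (CPi \<rho> \<sigma>)) u) v = u"
  by (simp add: app_abs2 cont_var)

lemma app_S: "app (app (app (const_val (CSigma \<rho> \<sigma> \<tau>)) u) v) w = app (app u w) (app v w)"
  by (simp add: app_abs3 cont_var cont_app)

lemma app_R: "app (app (app (const_val CRec) f) m) (num k) = iter_rec f m k"
  by (simp add: app_abs3 cont_var cont_UN cont_Int cont_iter_rec) auto

declare const_val.simps(5-7) [simp del]

section \<open>Evaluation of terms\<close>

fun eval :: "(var \<Rightarrow> tok set) \<Rightarrow> tm \<Rightarrow> tok set" where
  "eval e (Var v) = e v"
| "eval e (Const c) = const_val c"
| "eval e (t \<cdot> u) = app (eval e t) (eval e u)"

text \<open>No typing hypothesis is called for: \<open>app_K\<close> and \<open>app_S\<close> hold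
  for arbitrary token sets, whatever types index the combinators.\<close>

lemma eval_lam: "app (eval e (lam v t)) x = eval (e(v := x)) t"
  by (induction t) (simp_all add: app_S app_K)

lemma eval_cong: "(\<And>v. v \<in> tvars t \<Longrightarrow> e v = e' v) \<Longrightarrow> eval e t = eval e' t"
  by (induction t) auto

lemma eval_tsubst: "eval e (tsubst v s t) = eval (e(v := eval e s)) t"
  by (induction t) auto

definition npair :: "nat \<Rightarrow> nat \<Rightarrow> nat" where "npair m n = prod_encode (m, n)"
definition nfst :: "nat \<Rightarrow> nat" where "nfst p = fst (prod_decode p)"
definition nsnd :: "nat \<Rightarrow> nat" where "nsnd p = snd (prod_decode p)"

lemma npair_simps [simp]: "nfst (npair m n) = m" "nsnd (npair m n) = n" "npair (nfst p) (nsnd p) = p"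
  by (simp_all add: npair_def nfst_def nsnd_def)

section \<open>Henkin models from increasing chains of sets of functions\<close>

text \<open>A function stands for a truth set by being \<open>0\<close> on it; \<open>OEq\<close>, \<open>OLess\<close> and \<open>OImp\<close> follow this
  convention.\<close>

datatype base_op = OConst nat | OId | OFst | OSnd | OComp | OPair | OPlus | OTimes | OEq | OLess | OImp | OMu | ORec

text \<open>\<open>OMu\<close> is the search behind \<open>QF_AC\<close>, and \<open>ORec\<close> is
  the recursor. Both hand \<open>n\<close> on to \<open>f\<close> as a parameter and thus treat a
  whole sequence of instances at once.\<close>

fun base_op_fun :: "base_op \<Rightarrow> (nat \<Rightarrow> nat) \<Rightarrow> (nat \<Rightarrow> nat) \<Rightarrow> nat \<Rightarrow> nat" where
  "base_op_fun (OConst c) f g n = c"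
| "base_op_fun OId f g n = n"
| "base_op_fun OFst f g n = nfst n"
| "base_op_fun OSnd f g n = nsnd n"
| "base_op_fun OComp f g n = f (g n)"
| "base_op_fun OPair f g n = npair (f n) (g n)"
| "base_op_fun OPlus f g n = f n + g n"
| "base_op_fun OTimes f g n = f n * g n"
| "base_op_fun OEq f g n = of_bool (f n \<noteq> g n)"
| "base_op_fun OLess f g n = of_bool (\<not> f n < g n)"
| "base_op_fun OImp f g n = of_bool (\<not> (f n = 0 \<longrightarrow> g n = 0))"
| "base_op_fun OMu f g n = (LEAST m. f (npair n m) = 0)"
| "base_op_fun ORec f g n = rec_nat (nfst (g n)) (\<lambda>a b. f (npair n (npair a b))) (nsnd (g n))"

definition clone :: "(nat \<Rightarrow> nat) set \<Rightarrow> bool" where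
  "clone X \<longleftrightarrow> X \<noteq> {} \<and> (\<forall>i. \<forall>f\<in>X. \<forall>g\<in>X. base_op_fun i f g \<in> X)"

lemma
  assumes "clone X"
  shows clone_const: "(\<lambda>_. c) \<in> X" and clone_id: "(\<lambda>n. n) \<in> X"
    and clone_fst: "nfst \<in> X" and clone_snd: "nsnd \<in> X"
    and clone_comp: "f \<in> X \<Longrightarrow> g \<in> X \<Longrightarrow> (\<lambda>n. f (g n)) \<in> X"
    and clone_pair: "f \<in> X \<Longrightarrow> g \<in> X \<Longrightarrow> (\<lambda>n. npair (f n) (g n)) \<in> X"
    and clone_plus: "f \<in> X \<Longrightarrow> g \<in> X \<Longrightarrow> (\<lambda>n. f n + g n) \<in> X"
    and clone_times: "f \<in> X \<Longrightarrow> g \<in> X \<Longrightarrow> (\<lambda>n. f n * g n) \<in> X"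
    and clone_eq: "f \<in> X \<Longrightarrow> g \<in> X \<Longrightarrow> (\<lambda>n. of_bool (f n \<noteq> g n)) \<in> X"
    and clone_less: "f \<in> X \<Longrightarrow> g \<in> X \<Longrightarrow> (\<lambda>n. of_bool (\<not> f n < g n)) \<in> X"
    and clone_imp: "f \<in> X \<Longrightarrow> g \<in> X \<Longrightarrow> (\<lambda>n. of_bool (\<not> (f n = 0 \<longrightarrow> g n = 0))) \<in> X"
    and clone_mu: "f \<in> X \<Longrightarrow> (\<lambda>n. LEAST m. f (npair n m) = 0) \<in> X"
    and clone_rec: "f \<in> X \<Longrightarrow> g \<in> X \<Longrightarrow> (\<lambda>n. rec_nat (nfst (g n)) (\<lambda>a b. f (npair n (npair a b))) (nsnd (g n))) \<in> X"
proof -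
  from assms obtain h where h: "h \<in> X" and *: "\<And>i f g. f \<in> X \<Longrightarrow> g \<in> X \<Longrightarrow> (\<lambda>n. base_op_fun i f g n) \<in> X"
    unfolding clone_def by auto
  show "(\<lambda>_. c) \<in> X" "(\<lambda>n. n) \<in> X" "nfst \<in> X" "nsnd \<in> X"
    using *[OF h h, of "OConst c"] *[OF h h, of OId] *[OF h h, of OFst] *[OF h h, of OSnd] by simp_all
  show "f \<in> X \<Longrightarrow> g \<in> X \<Longrightarrow> (\<lambda>n. f (g n)) \<in> X" using *[of f g OComp] by simp
  show "f \<in> X \<Longrightarrow> g \<in> X \<Longrightarrow> (\<lambda>n. npair (f n) (g n)) \<in> X" using *[of f g OPair] by simp
  show "f \<in> X \<Longrightarrow> g \<in> X \<Longrightarrow> (\<lambda>n. f n + g n) \<in> X" using *[of f g OPlus] by simp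
  show "f \<in> X \<Longrightarrow> g \<in> X \<Longrightarrow> (\<lambda>n. f n * g n) \<in> X" using *[of f g OTimes] by simp
  show "f \<in> X \<Longrightarrow> g \<in> X \<Longrightarrow> (\<lambda>n. of_bool (f n \<noteq> g n)) \<in> X" using *[of f g OEq] by simp
  show "f \<in> X \<Longrightarrow> g \<in> X \<Longrightarrow> (\<lambda>n. of_bool (\<not> f n < g n)) \<in> X" using *[of f g OLess] by simp
  show "f \<in> X \<Longrightarrow> g \<in> X \<Longrightarrow> (\<lambda>n. of_bool (\<not> (f n = 0 \<longrightarrow> g n = 0))) \<in> X" using *[of f g OImp] by simp
  show "f \<in> X \<Longrightarrow> (\<lambda>n. LEAST m. f (npair n m) = 0) \<in> X" using *[of f f OMu] by simp
  show "f \<in> X \<Longrightarrow> g \<in> X \<Longrightarrow> (\<lambda>n. rec_nat (nfst (g n)) (\<lambda>a b. f (npair n (npair a b))) (nsnd (g n))) \<in> X"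
    using *[of f g ORec] by simp
qed

text \<open>A Kripke logical relation between sequences of elements. With single elements in place of
  sequences, the base case would be trivial and type 1 unrestricted; the reindexing \<open>h\<close> makes the
  case of type 1 say that a sequence of functions is in \<open>A k\<close> as a binary function.\<close>

fun Rel :: "(nat \<Rightarrow> (nat \<Rightarrow> nat) set) \<Rightarrow> ty \<Rightarrow> nat \<Rightarrow> (nat \<Rightarrow> tok set) \<Rightarrow> (nat \<Rightarrow> tok set) \<Rightarrow> bool" where
  "Rel A N k u v \<longleftrightarrow> u = v \<and> (\<exists>f\<in>A k. u = (\<lambda>n. num (f n)))"
| "Rel A (\<sigma> \<rightarrow> \<tau>) k u v \<longleftrightarrow>
    (\<forall>j\<ge>k. \<forall>h\<in>A j. \<forall>x y. Rel A \<sigma> j x y \<longrightarrow>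
      Rel A \<tau> j (\<lambda>n. app (u (h n)) (x n)) (\<lambda>n. app (v (h n)) (y n)))"

declare Rel.simps(2) [simp del]

lemma Rel_arrowI:
  assumes "\<And>j h x y. k \<le> j \<Longrightarrow> h \<in> A j \<Longrightarrow> Rel A \<sigma> j x y \<Longrightarrow>
    Rel A \<tau> j (\<lambda>n. app (u (h n)) (x n)) (\<lambda>n. app (v (h n)) (y n))"
  shows "Rel A (\<sigma> \<rightarrow> \<tau>) k u v"
  unfolding Rel.simps by (intro allI impI ballI) (rule assms)

lemma Rel_arrowD:
  assumes "Rel A (\<sigma> \<rightarrow> \<tau>) k u v" "k \<le> j" "h \<in> A j" "Rel A \<sigma> j x y"
  shows "Rel A \<tau> j (\<lambda>n. app (u (h n)) (x n)) (\<lambda>n. app (v (h n)) (y n))"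
  using assms(1)[unfolded Rel.simps, rule_format, OF assms(2-4)] .

text \<open>A single object is regarded as a constant sequence. This is only a partial equivalence
  relation: the objects of type \<open>\<tau>\<close> are the token sets related to themselves, and
  no quotient is formed.\<close>

definition ext_eq :: "(nat \<Rightarrow> (nat \<Rightarrow> nat) set) \<Rightarrow> ty \<Rightarrow> tok set \<Rightarrow> tok set \<Rightarrow> bool" where
  "ext_eq A \<tau> u v \<longleftrightarrow> (\<exists>k. Rel A \<tau> k (\<lambda>_. u) (\<lambda>_. v))"

abbreviation elem :: "(nat \<Rightarrow> (nat \<Rightarrow> nat) set) \<Rightarrow> ty \<Rightarrow> tok set \<Rightarrow> bool" where
  "elem A \<tau> u \<equiv> ext_eq A \<tau> u u"

section \<open>Satisfaction in the model and substitution\<close>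

fun sat :: "(nat \<Rightarrow> (nat \<Rightarrow> nat) set) \<Rightarrow> (var \<Rightarrow> tok set) \<Rightarrow> fm \<Rightarrow> bool" where
  "sat A e (t \<doteq> u) \<longleftrightarrow> eval e t = eval e u"
| "sat A e (t \<prec> u) \<longleftrightarrow> (\<exists>m n. eval e t = num m \<and> eval e u = num n \<and> m < n)"
| "sat A e Bot \<longleftrightarrow> False"
| "sat A e (\<phi> \<^bold>\<longrightarrow> \<psi>) \<longleftrightarrow> (sat A e \<phi> \<longrightarrow> sat A e \<psi>)"
| "sat A e (\<^bold>\<forall>v. \<phi>) \<longleftrightarrow> (\<forall>u. elem A (snd v) u \<longrightarrow> sat A (e(v := u)) \<phi>)"

lemma sat_connectives [simp]:
  "sat A e (\<^bold>\<not> \<phi>) \<longleftrightarrow> \<not> sat A e \<phi>"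
  "sat A e (\<phi> \<^bold>\<or> \<psi>) \<longleftrightarrow> sat A e \<phi> \<or> sat A e \<psi>"
  "sat A e (\<phi> \<^bold>\<and> \<psi>) \<longleftrightarrow> sat A e \<phi> \<and> sat A e \<psi>"
  "sat A e (\<phi> \<^bold>\<longleftrightarrow> \<psi>) \<longleftrightarrow> (sat A e \<phi> \<longleftrightarrow> sat A e \<psi>)"
  "sat A e (\<^bold>\<exists>v. \<phi>) \<longleftrightarrow> (\<exists>u. elem A (snd v) u \<and> sat A (e(v := u)) \<phi>)"
  by (auto simp: Neg_def Or_def And_def Iff_def Ex_def)

lemma sat_fvars_cong: "(\<And>v. v \<in> fvars \<phi> \<Longrightarrow> e v = e' v) \<Longrightarrow> sat A e \<phi> \<longleftrightarrow> sat A e' \<phi>"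
proof (induction \<phi> arbitrary: e e')
  case (Eq t u)
  then have "eval e t = eval e' t" "eval e u = eval e' u"
    using eval_cong[of t e e'] eval_cong[of u e e'] by simp_all
  then show ?case by simp
next
  case (Less t u)
  then have "eval e t = eval e' t" "eval e u = eval e' u"
    using eval_cong[of t e e'] eval_cong[of u e e'] by simp_all
  then show ?case by simp
next
  case (Imp \<phi> \<psi>)
  have "sat A e \<phi> \<longleftrightarrow> sat A e' \<phi>" by (rule Imp.IH) (simp add: Imp.prems)
  moreover have "sat A e \<psi> \<longleftrightarrow> sat A e' \<psi>" by (rule Imp.IH) (simp add: Imp.prems)
  ultimately show ?case by simp
next
  case (All v \<phi>)
  have "sat A (e(v := u)) \<phi> \<longleftrightarrow> sat A (e'(v := u)) \<phi>" for u
    by (rule All.IH) (simp add: All.prems)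
  then show ?case by simp
qed simp

lemma tsubst_notin: "v \<notin> tvars t \<Longrightarrow> tsubst v s t = t"
  by (induction t) auto

lemma subst_notin: "v \<notin> fvars \<phi> \<Longrightarrow> subst v s \<phi> = \<phi>"
  by (induction \<phi>) (auto simp: tsubst_notin)

lemma sat_subst: "free_for v s \<phi> \<Longrightarrow> sat A e (subst v s \<phi>) \<longleftrightarrow> sat A (e(v := eval e s)) \<phi>"
proof (induction \<phi> arbitrary: e)
  case (All w \<phi>)
  show ?case
  proof (cases "v \<in> fvars (\<^bold>\<forall>w. \<phi>)")
    case True
    with All.prems have *: "w \<notin> tvars s" "free_for v s \<phi>" "w \<noteq> v" by auto
    then have "eval (e(w := u)) s = eval e s" for u by (intro eval_cong) auto
    then show ?thesis using * by (simp add: All.IH[OF *(2)] fun_upd_twist[OF *(3)] del: fun_upd_apply)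
  next
    \<comment> \<open>Here \<open>free_for\<close> says nothing about \<open>s\<close>, but neither
      the substitution nor the change of the assignment has any effect.\<close>
    case False
    then have "sat A e (subst v s (\<^bold>\<forall>w. \<phi>)) \<longleftrightarrow> sat A e (\<^bold>\<forall>w. \<phi>)"
      by (simp only: subst_notin[OF False])
    also have "\<dots> \<longleftrightarrow> sat A (e(v := eval e s)) (\<^bold>\<forall>w. \<phi>)"
      using False by (intro sat_fvars_cong) (metis fun_upd_other)
    finally show ?thesis .
  qed
qed (simp_all add: eval_tsubst)

lemma qf_free_for: "qf \<phi> \<Longrightarrow> free_for v s \<phi>"
  by (induction \<phi>) auto

lemma finite_tvars: "finite (tvars t)"
  by (induction t) auto

lemma finite_fvars: "finite (fvars \<phi>)"
  by (induction \<phi>) (auto simp: finite_tvars)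

text \<open>These two assumptions carry all of \<open>RCA0_omega\<close>. The constant chain of all
  functions satisfies them as well, so standard truth is the special case
  \<open>sat Full\<close>.\<close>

locale world =
  fixes A :: "nat \<Rightarrow> (nat \<Rightarrow> nat) set"
  assumes A_mono: "j \<le> k \<Longrightarrow> A j \<subseteq> A k"
    and A_clone: "clone (A k)"
begin

lemmas A_const = clone_const[OF A_clone]
lemmas A_id = clone_id[OF A_clone]
lemmas A_fst = clone_fst[OF A_clone]
lemmas A_snd = clone_snd[OF A_clone]
lemmas A_comp = clone_comp[OF A_clone]
lemmas A_pair = clone_pair[OF A_clone]
lemmas A_plus = clone_plus[OF A_clone]
lemmas A_times = clone_times[OF A_clone]
lemmas A_eq = clone_eq[OF A_clone]
lemmas A_less = clone_less[OF A_clone]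
lemmas A_imp = clone_imp[OF A_clone]
lemmas A_mu = clone_mu[OF A_clone]
lemmas A_rec = clone_rec[OF A_clone]

section \<open>The logical relation as a uniform partial equivalence\<close>

lemma Rel_num: "f \<in> A k \<Longrightarrow> Rel A N k (\<lambda>n. num (f n)) (\<lambda>n. num (f n))"
  by auto

text \<open>At arrow types persistence is built into the quantifier over later levels, so a case
  distinction replaces the induction.\<close>

lemma Rel_mono:
  assumes "Rel A \<tau> j u v" "j \<le> k"
  shows "Rel A \<tau> k u v"
proof (cases \<tau>)
  case N
  then show ?thesis using assms A_mono by auto
next
  case (Arrow \<rho> \<sigma>)
  show ?thesis unfolding Arrow
  proof (rule Rel_arrowI)
    fix i h x y
    assume *: "k \<le> i" "h \<in> A i" "Rel A \<rho> i x y"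
    from Rel_arrowD[OF assms(1)[unfolded Arrow] order_trans[OF assms(2) *(1)] *(2,3)]
    show "Rel A \<sigma> i (\<lambda>n. app (u (h n)) (x n)) (\<lambda>n. app (v (h n)) (y n))" .
  qed
qed

lemma Rel_reindex:
  assumes "Rel A \<tau> k u v" "h \<in> A k"
  shows "Rel A \<tau> k (\<lambda>n. u (h n)) (\<lambda>n. v (h n))"
proof (cases \<tau>)
  case N
  then show ?thesis using assms A_comp[of _ k h] by auto
next
  case (Arrow \<rho> \<sigma>)
  show ?thesis unfolding Arrow
  proof (rule Rel_arrowI)
    fix j h' x y
    assume *: "k \<le> j" "h' \<in> A j" "Rel A \<rho> j x y"
    have "(\<lambda>n. h (h' n)) \<in> A j" using A_comp A_mono[OF *(1)] assms(2) *(2) by blast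
    from Rel_arrowD[OF assms(1)[unfolded Arrow] *(1) this *(3)]
    show "Rel A \<sigma> j (\<lambda>n. app (u (h (h' n))) (x n)) (\<lambda>n. app (v (h (h' n))) (y n))" .
  qed
qed

lemma Rel_sym: "Rel A \<tau> k u v \<Longrightarrow> Rel A \<tau> k v u"
proof (induction \<tau> arbitrary: k u v)
  case (Arrow \<rho> \<sigma>)
  show ?case
  proof (rule Rel_arrowI)
    fix j h x y
    assume *: "k \<le> j" "h \<in> A j" "Rel A \<rho> j x y"
    from Arrow.IH(2)[OF Rel_arrowD[OF Arrow.prems *(1,2) Arrow.IH(1)[OF *(3)]]]
    show "Rel A \<sigma> j (\<lambda>n. app (v (h n)) (x n)) (\<lambda>n. app (u (h n)) (y n))" .
  qed
qed auto

lemma Rel_trans: "Rel A \<tau> k u v \<Longrightarrow> Rel A \<tau> k v w \<Longrightarrow> Rel A \<tau> k u w"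
proof (induction \<tau> arbitrary: k u v w)
  case (Arrow \<rho> \<sigma>)
  show ?case
  proof (rule Rel_arrowI)
    fix j h x y
    assume *: "k \<le> j" "h \<in> A j" "Rel A \<rho> j x y"
    have "Rel A \<rho> j x x" using Arrow.IH(1)[OF *(3) Rel_sym[OF *(3)]] .
    from Arrow.IH(2)[OF Rel_arrowD[OF Arrow.prems(1) *(1,2) this] Rel_arrowD[OF Arrow.prems(2) *]]
    show "Rel A \<sigma> j (\<lambda>n. app (u (h n)) (x n)) (\<lambda>n. app (w (h n)) (y n))" .
  qed
qed auto

lemma Rel_refl_left: "Rel A \<tau> k u v \<Longrightarrow> Rel A \<tau> k u u"
  by (rule Rel_trans[OF _ Rel_sym])

lemma Rel_app:
  assumes "Rel A (\<rho> \<rightarrow> \<sigma>) k u v" "Rel A \<rho> k x y"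
  shows "Rel A \<sigma> k (\<lambda>n. app (u n) (x n)) (\<lambda>n. app (v n) (y n))"
  using Rel_arrowD[OF assms(1) order_refl A_id assms(2)] .

lemma Rel_const_famI:
  assumes "\<And>j x y. k \<le> j \<Longrightarrow> Rel A \<rho> j x y \<Longrightarrow> Rel A \<sigma> j (\<lambda>n. app c (x n)) (\<lambda>n. app d (y n))"
  shows "Rel A (\<rho> \<rightarrow> \<sigma>) k (\<lambda>_. c) (\<lambda>_. d)"
  by (rule Rel_arrowI) (rule assms)

lemma Rel_const_famD:
  assumes "Rel A (\<rho> \<rightarrow> \<sigma>) k (\<lambda>_. c) (\<lambda>_. d)" "k \<le> j" "Rel A \<rho> j x y"
  shows "Rel A \<sigma> j (\<lambda>n. app c (x n)) (\<lambda>n. app d (y n))"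
  using Rel_arrowD[OF assms(1,2) A_id assms(3)] .

text \<open>After the first application the family is no longer constant; the reindexing of the
  second one is absorbed into \<open>x\<close> and \<open>y\<close> by
  \<open>Rel_reindex\<close>.\<close>

lemma Rel_const_famI2:
  assumes "\<And>j x y x' y'. k \<le> j \<Longrightarrow> Rel A \<rho> j x y \<Longrightarrow> Rel A \<sigma> j x' y' \<Longrightarrow>
    Rel A \<tau> j (\<lambda>n. app (app c (x n)) (x' n)) (\<lambda>n. app (app d (y n)) (y' n))"
  shows "Rel A (\<rho> \<rightarrow> \<sigma> \<rightarrow> \<tau>) k (\<lambda>_. c) (\<lambda>_. d)"
proof (rule Rel_const_famI, rule Rel_arrowI)
  fix i x y j h x' y'
  assume *: "k \<le> i" "Rel A \<rho> i x y" "i \<le> j" "h \<in> A j" "Rel A \<sigma> j x' y'"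
  from assms[OF order_trans[OF *(1,3)] Rel_reindex[OF Rel_mono[OF *(2,3)] *(4)] *(5)]
  show "Rel A \<tau> j (\<lambda>n. app (app c (x (h n))) (x' n)) (\<lambda>n. app (app d (y (h n))) (y' n))" .
qed

lemma Rel_const_famI3:
  assumes "\<And>j x y x' y' x'' y''. k \<le> j \<Longrightarrow> Rel A \<rho> j x y \<Longrightarrow> Rel A \<sigma> j x' y' \<Longrightarrow> Rel A \<tau> j x'' y'' \<Longrightarrow>
    Rel A \<upsilon> j (\<lambda>n. app (app (app c (x n)) (x' n)) (x'' n)) (\<lambda>n. app (app (app d (y n)) (y' n)) (y'' n))"
  shows "Rel A (\<rho> \<rightarrow> \<sigma> \<rightarrow> \<tau> \<rightarrow> \<upsilon>) k (\<lambda>_. c) (\<lambda>_. d)"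
proof (rule Rel_const_famI2, rule Rel_arrowI)
  fix i x y x' y' j h x'' y''
  assume *: "k \<le> i" "Rel A \<rho> i x y" "Rel A \<sigma> i x' y'" "i \<le> j" "h \<in> A j" "Rel A \<tau> j x'' y''"
  from assms[OF order_trans[OF *(1,4)] Rel_reindex[OF Rel_mono[OF *(2,4)] *(5)]
    Rel_reindex[OF Rel_mono[OF *(3,4)] *(5)] *(6)]
  show "Rel A \<upsilon> j (\<lambda>n. app (app (app c (x (h n))) (x' (h n))) (x'' n))
    (\<lambda>n. app (app (app d (y (h n))) (y' (h n))) (y'' n))" .
qed

lemma Rel_One:
  "Rel A One k u v \<longleftrightarrow> (\<exists>F\<in>A k. \<forall>n. represents (u n) (\<lambda>m. F (npair n m)) \<and> represents (v n) (\<lambda>m. F (npair n m)))"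
proof
  assume *: "Rel A One k u v"
  \<comment> \<open>With \<open>nfst\<close> as reindexing and \<open>nsnd\<close> as argument, one
    sequence runs through all values of all members.\<close>
  have "Rel A N k (\<lambda>n. num (nsnd n)) (\<lambda>n. num (nsnd n))"
    using A_snd by auto
  from Rel_arrowD[OF * order_refl A_fst this] obtain F where F: "F \<in> A k" "(\<lambda>n. app (u (nfst n)) (num (nsnd n))) = (\<lambda>n. num (F n))"
    "(\<lambda>n. app (u (nfst n)) (num (nsnd n))) = (\<lambda>n. app (v (nfst n)) (num (nsnd n)))"
    unfolding Rel.simps(1) by metis
  have "app (u n) (num m) = num (F (npair n m)) \<and> app (v n) (num m) = num (F (npair n m))" for n m
    using F(2,3)[THEN fun_cong, of "npair n m"] by simp
  with F(1) show "\<exists>F\<in>A k. \<forall>n. represents (u n) (\<lambda>m. F (npair n m)) \<and> represents (v n) (\<lambda>m. F (npair n m))"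
    by (auto simp: represents_def)
next
  assume "\<exists>F\<in>A k. \<forall>n. represents (u n) (\<lambda>m. F (npair n m)) \<and> represents (v n) (\<lambda>m. F (npair n m))"
  then obtain F where F: "F \<in> A k" "\<And>n m. app (u n) (num m) = num (F (npair n m))"
    "\<And>n m. app (v n) (num m) = num (F (npair n m))"
    by (auto simp: represents_def)
  show "Rel A One k u v"
  proof (rule Rel_arrowI)
    fix j h x y
    assume *: "k \<le> j" "h \<in> A j" "Rel A N j x y"
    then obtain g where g: "g \<in> A j" "x = (\<lambda>n. num (g n))" "y = (\<lambda>n. num (g n))" by auto
    have "(\<lambda>n. F (npair (h n) (g n))) \<in> A j"
      by (rule A_comp[OF subsetD[OF A_mono[OF *(1)] F(1)] A_pair[OF *(2) g(1)]])
    then show "Rel A N j (\<lambda>n. app (u (h n)) (x n)) (\<lambda>n. app (v (h n)) (y n))"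
      unfolding F(2,3) g by (rule Rel_num)
  qed
qed

lemma ext_eqI: "Rel A \<tau> k (\<lambda>_. u) (\<lambda>_. v) \<Longrightarrow> ext_eq A \<tau> u v"
  by (auto simp: ext_eq_def)

lemma ext_eq_sym: "ext_eq A \<tau> u v \<Longrightarrow> ext_eq A \<tau> v u"
  unfolding ext_eq_def by (erule exE, rule exI, rule Rel_sym)

lemma ext_eq_both:
  assumes "ext_eq A \<rho> u v" "ext_eq A \<sigma> x y"
  obtains k where "Rel A \<rho> k (\<lambda>_. u) (\<lambda>_. v)" "Rel A \<sigma> k (\<lambda>_. x) (\<lambda>_. y)"
proof -
  obtain i j where "Rel A \<rho> i (\<lambda>_. u) (\<lambda>_. v)" "Rel A \<sigma> j (\<lambda>_. x) (\<lambda>_. y)"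
    using assms unfolding ext_eq_def by (elim exE)
  from Rel_mono[OF this(1) max.cobounded1] Rel_mono[OF this(2) max.cobounded2] show ?thesis
    by (rule that)
qed

lemma ext_eq_trans:
  assumes "ext_eq A \<tau> u v" "ext_eq A \<tau> v w"
  shows "ext_eq A \<tau> u w"
proof -
  obtain k where "Rel A \<tau> k (\<lambda>_. u) (\<lambda>_. v)" "Rel A \<tau> k (\<lambda>_. v) (\<lambda>_. w)"
    using ext_eq_both[OF assms] .
  from ext_eqI[OF Rel_trans[OF this]] show ?thesis .
qed

lemma ext_eq_app:
  assumes "ext_eq A (\<rho> \<rightarrow> \<sigma>) u v" "ext_eq A \<rho> x y"
  shows "ext_eq A \<sigma> (app u x) (app v y)"
proof -
  obtain k where "Rel A (\<rho> \<rightarrow> \<sigma>) k (\<lambda>_. u) (\<lambda>_. v)" "Rel A \<rho> k (\<lambda>_. x) (\<lambda>_. y)"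
    using ext_eq_both[OF assms] .
  from ext_eqI[OF Rel_app[OF this]] show ?thesis .
qed

lemma ext_eq_N: "ext_eq A N u v \<longleftrightarrow> u = v \<and> (\<exists>n. u = num n)"
proof
  assume "u = v \<and> (\<exists>n. u = num n)"
  then obtain n where "u = num n" "v = num n" by blast
  moreover have "Rel A N 0 (\<lambda>_. num n) (\<lambda>_. num n)"
    using A_const[of n 0] by auto
  ultimately show "ext_eq A N u v" by (auto simp: ext_eq_def)
qed (auto simp: ext_eq_def fun_eq_iff)

lemma ext_eq_One: "ext_eq A One u v \<longleftrightarrow> (\<exists>f k. f \<in> A k \<and> represents u f \<and> represents v f)"
proof
  assume "ext_eq A One u v"
  then obtain k F where *: "F \<in> A k" "represents u (\<lambda>m. F (npair 0 m))" "represents v (\<lambda>m. F (npair 0 m))"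
    unfolding ext_eq_def Rel_One by blast
  have "(\<lambda>m. F (npair 0 m)) \<in> A k"
    by (rule A_comp[OF *(1) A_pair[OF A_const A_id]])
  with * show "\<exists>f k. f \<in> A k \<and> represents u f \<and> represents v f" by blast
next
  assume "\<exists>f k. f \<in> A k \<and> represents u f \<and> represents v f"
  then obtain f k where f: "f \<in> A k" "represents u f" "represents v f" by blast
  have "(\<lambda>p. f (nsnd p)) \<in> A k" by (rule A_comp[OF f(1) A_snd])
  then have "Rel A One k (\<lambda>_. u) (\<lambda>_. v)"
    unfolding Rel_One using f by (intro bexI[of _ "\<lambda>p. f (nsnd p)"]) auto
  then show "ext_eq A One u v" by (rule ext_eqI)
qed

lemma elem_N [simp]: "elem A N u \<longleftrightarrow> (\<exists>n. u = num n)"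
  by (simp add: ext_eq_N)

lemma elem_One: "elem A One u \<longleftrightarrow> (\<exists>f k. f \<in> A k \<and> represents u f)"
  by (auto simp: ext_eq_One)

lemma Rel_member:
  assumes "Rel A \<tau> k x y"
  shows "Rel A \<tau> k (\<lambda>_. x m) (\<lambda>_. y m)"
  using Rel_reindex[OF assms A_const] .

text \<open>The levels that witness the pointwise equalities may be unbounded in \<open>n\<close>.
  This does no harm: at type \<open>N\<close> the relation \<open>ext_eq\<close> is identity, and
  uniformity comes from the self-relatedness of \<open>x\<close> and \<open>y\<close>.\<close>

lemma Rel_pointwise:
  assumes "Rel A \<tau> k x x" "Rel A \<tau> k y y" "\<And>n. ext_eq A \<tau> (x n) (y n)"
  shows "Rel A \<tau> k x y"
  using assms
proof (induction \<tau> arbitrary: k x y)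
  case N
  then have "x n = y n" for n by (auto simp: ext_eq_N)
  then have "x = y" by (rule ext)
  with N show ?case by simp
next
  case (Arrow \<rho> \<sigma>)
  show ?case
  proof (rule Rel_arrowI)
    fix j h a b
    assume j: "k \<le> j" "h \<in> A j" "Rel A \<rho> j a b"
    have bb: "Rel A \<rho> j b b" by (rule Rel_refl_left[OF Rel_sym[OF j(3)]])
    have "Rel A \<sigma> j (\<lambda>n. app (x (h n)) (a n)) (\<lambda>n. app (x (h n)) (b n))"
      by (rule Rel_arrowD[OF Arrow.prems(1) j(1,2) Rel_trans[OF j(3) Rel_sym[OF bb]]]) 
    moreover have "Rel A \<sigma> j (\<lambda>n. app (x (h n)) (b n)) (\<lambda>n. app (y (h n)) (b n))"
    proof (rule Arrow.IH(2))
      show "Rel A \<sigma> j (\<lambda>n. app (x (h n)) (b n)) (\<lambda>n. app (x (h n)) (b n))"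
        by (rule Rel_arrowD[OF Arrow.prems(1) j(1,2) bb])
      show "Rel A \<sigma> j (\<lambda>n. app (y (h n)) (b n)) (\<lambda>n. app (y (h n)) (b n))"
        by (rule Rel_arrowD[OF Arrow.prems(2) j(1,2) bb])
      show "ext_eq A \<sigma> (app (x (h n)) (b n)) (app (y (h n)) (b n))" for n
        by (rule ext_eq_app[OF Arrow.prems(3) ext_eqI[OF Rel_member[OF bb]]])
    qed
    ultimately show "Rel A \<sigma> j (\<lambda>n. app (x (h n)) (a n)) (\<lambda>n. app (y (h n)) (b n))"
      by (rule Rel_trans)
  qed
qed

text \<open>Compare \<open>u\<close> and \<open>v\<close> along one sequence \<open>x\<close> by
  \<open>Rel_pointwise\<close>; the passage from \<open>x\<close> to a related \<open>y\<close> is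
  then a property of \<open>v\<close> alone.\<close>

lemma ext_eq_extensional:
  assumes "elem A (\<rho> \<rightarrow> \<sigma>) u" "elem A (\<rho> \<rightarrow> \<sigma>) v"
    and "\<And>x. elem A \<rho> x \<Longrightarrow> ext_eq A \<sigma> (app u x) (app v x)"
  shows "ext_eq A (\<rho> \<rightarrow> \<sigma>) u v"
proof -
  obtain k where k: "Rel A (\<rho> \<rightarrow> \<sigma>) k (\<lambda>_. u) (\<lambda>_. u)" "Rel A (\<rho> \<rightarrow> \<sigma>) k (\<lambda>_. v) (\<lambda>_. v)"
    using ext_eq_both assms(1,2) .
  have "Rel A (\<rho> \<rightarrow> \<sigma>) k (\<lambda>_. u) (\<lambda>_. v)"
  proof (rule Rel_const_famI)
    fix j x y
    assume j: "k \<le> j" "Rel A \<rho> j x y"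
    have xx: "Rel A \<rho> j x x" using j(2) by (rule Rel_refl_left)
    have "Rel A \<sigma> j (\<lambda>n. app u (x n)) (\<lambda>n. app v (x n))"
    proof (rule Rel_pointwise)
      show "Rel A \<sigma> j (\<lambda>n. app u (x n)) (\<lambda>n. app u (x n))"
        by (rule Rel_const_famD[OF k(1) j(1) xx])
      show "Rel A \<sigma> j (\<lambda>n. app v (x n)) (\<lambda>n. app v (x n))"
        by (rule Rel_const_famD[OF k(2) j(1) xx])
      show "ext_eq A \<sigma> (app u (x n)) (app v (x n))" for n
        by (rule assms(3)[OF ext_eqI[OF Rel_member[OF xx]]])
    qed
    then show "Rel A \<sigma> j (\<lambda>n. app u (x n)) (\<lambda>n. app v (y n))"
      by (rule Rel_trans) (rule Rel_const_famD[OF k(2) j])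
  qed
  then show ?thesis by (rule ext_eqI)
qed

section \<open>Constants and terms respect the relation\<close>

lemma Rel_rep1:
  assumes "f \<in> A k"
  shows "Rel A One k (\<lambda>_. rep1 f) (\<lambda>_. rep1 f)"
proof (rule Rel_const_famI)
  fix j x y
  assume j: "k \<le> j" "Rel A N j x y"
  then obtain a where a: "a \<in> A j" "x = (\<lambda>n. num (a n))" "y = (\<lambda>n. num (a n))" by auto
  have "(\<lambda>n. f (a n)) \<in> A j" by (rule A_comp[OF subsetD[OF A_mono[OF j(1)] assms] a(1)])
  then show "Rel A N j (\<lambda>n. app (rep1 f) (x n)) (\<lambda>n. app (rep1 f) (y n))"
    unfolding a app_rep1 by (rule Rel_num)
qed

lemma Rel_rep2:
  assumes "(\<lambda>p. f (nfst p) (nsnd p)) \<in> A k"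
  shows "Rel A (N \<rightarrow> N \<rightarrow> N) k (\<lambda>_. rep2 f) (\<lambda>_. rep2 f)"
proof (rule Rel_const_famI2)
  fix j x y x' y'
  assume j: "k \<le> j" "Rel A N j x y" "Rel A N j x' y'"
  then obtain a b where ab: "a \<in> A j" "b \<in> A j" "x = (\<lambda>n. num (a n))" "x' = (\<lambda>n. num (b n))"
    "y = (\<lambda>n. num (a n))" "y' = (\<lambda>n. num (b n))" by auto
  have "(\<lambda>p. f (nfst p) (nsnd p)) \<in> A j" using A_mono assms j(1) by blast
  from A_comp[OF this A_pair[OF ab(1,2)]] have "(\<lambda>n. f (a n) (b n)) \<in> A j" by simp
  then show "Rel A N j (\<lambda>n. app (app (rep2 f) (x n)) (x' n)) (\<lambda>n. app (app (rep2 f) (y n)) (y' n))"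
    unfolding ab app_rep2 by (rule Rel_num)
qed

lemma Rel_const_val: "Rel A (const_ty c) k (\<lambda>_. const_val c) (\<lambda>_. const_val c)"
proof (cases c)
  case CZero
  then show ?thesis using A_const by auto
next
  case CSuc
  have "(\<lambda>n. n + 1) \<in> A k" using A_plus[OF A_id A_const] .
  with CSuc Rel_rep1[of Suc k] show ?thesis by simp
next
  case CPlus
  then show ?thesis using Rel_rep2[of "(+)" k] A_plus[OF A_fst A_snd] by simp
next
  case CTimes
  then show ?thesis using Rel_rep2[of "(*)" k] A_times[OF A_fst A_snd] by simp
next
  case (CPi \<rho> \<sigma>)
  have "Rel A (\<rho> \<rightarrow> \<sigma> \<rightarrow> \<rho>) k (\<lambda>_. const_val c) (\<lambda>_. const_val c)"
    by (rule Rel_const_famI2) (simp add: CPi app_K)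
  then show ?thesis by (simp only: CPi const_ty.simps)
next
  case (CSigma \<rho> \<sigma> \<tau>)
  have "Rel A ((\<rho> \<rightarrow> \<sigma> \<rightarrow> \<tau>) \<rightarrow> (\<rho> \<rightarrow> \<sigma>) \<rightarrow> \<rho> \<rightarrow> \<tau>) k (\<lambda>_. const_val c) (\<lambda>_. const_val c)"
    unfolding CSigma
    by (rule Rel_const_famI3, unfold app_S) (intro Rel_app[of \<sigma> \<tau>] Rel_app[of \<rho> "\<sigma> \<rightarrow> \<tau>"] Rel_app[of \<rho> \<sigma>])
  then show ?thesis by (simp only: CSigma const_ty.simps)
next
  case CRec
  have "Rel A ((N \<rightarrow> N \<rightarrow> N) \<rightarrow> N \<rightarrow> N \<rightarrow> N) k (\<lambda>_. const_val c) (\<lambda>_. const_val c)"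
  proof (rule Rel_const_famI3)
    fix j x y x' y' x'' y''
    assume j: "Rel A (N \<rightarrow> N \<rightarrow> N) j x y" "Rel A N j x' y'" "Rel A N j x'' y''"
    obtain a b where ab: "a \<in> A j" "b \<in> A j" "x' = (\<lambda>n. num (a n))" "x'' = (\<lambda>n. num (b n))"
      "y' = (\<lambda>n. num (a n))" "y'' = (\<lambda>n. num (b n))" using j(2,3) by auto
    have s: "nfst \<in> A j" "(\<lambda>p. nfst (nsnd p)) \<in> A j" "(\<lambda>p. nsnd (nsnd p)) \<in> A j"
      using A_fst A_snd A_comp by auto
    \<comment> \<open>A single function \<open>F\<close> of the level tabulates the step functions
      of all members, with index and both arguments coded in one number. This is the form that
      \<open>ORec\<close> expects.\<close>
    have "Rel A N j (\<lambda>p. app (app (x (nfst p)) (num (nfst (nsnd p)))) (num (nsnd (nsnd p))))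
        (\<lambda>p. app (app (y (nfst p)) (num (nfst (nsnd p)))) (num (nsnd (nsnd p))))"
      by (intro Rel_app[of N N] Rel_app[of N "N \<rightarrow> N"] Rel_reindex[OF j(1)] Rel_num s)
    then obtain F where F: "F \<in> A j"
      "(\<lambda>p. app (app (x (nfst p)) (num (nfst (nsnd p)))) (num (nsnd (nsnd p)))) = (\<lambda>p. num (F p))"
      "(\<lambda>p. app (app (y (nfst p)) (num (nfst (nsnd p)))) (num (nsnd (nsnd p)))) = (\<lambda>p. num (F p))"
      by auto
    have xy: "app (app (x n) (num c)) (num d) = num (F (npair n (npair c d)))"
      "app (app (y n) (num c)) (num d) = num (F (npair n (npair c d)))" for n c d
      using F(2,3)[THEN fun_cong, of "npair n (npair c d)"] by simp_all
    have "iter_rec (x n) (num (a n)) (b n) = num (rec_nat (a n) (\<lambda>c d. F (npair n (npair c d))) (b n))"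
      "iter_rec (y n) (num (a n)) (b n) = num (rec_nat (a n) (\<lambda>c d. F (npair n (npair c d))) (b n))" for n
      by (rule iter_rec_eq, rule xy)+
    moreover have "(\<lambda>n. rec_nat (a n) (\<lambda>c d. F (npair n (npair c d))) (b n)) \<in> A j"
      using A_rec[OF F(1) A_pair[OF ab(1,2)]] by simp
    ultimately show "Rel A N j (\<lambda>n. app (app (app (const_val c) (x n)) (x' n)) (x'' n))
        (\<lambda>n. app (app (app (const_val c) (y n)) (y' n)) (y'' n))"
      unfolding CRec ab app_R by (simp del: Rel.simps(1) add: Rel_num)
  qed
  then show ?thesis by (simp only: CRec const_ty.simps)
qed

text \<open>The fundamental lemma of logical relations, here for assignments that vary along a
  sequence; \<open>qf_char\<close> depends on this uniformity.\<close>

lemma Rel_eval: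
  assumes "wt t" "\<And>v. v \<in> tvars t \<Longrightarrow> Rel A (snd v) k (\<lambda>n. e n v) (\<lambda>n. e' n v)"
  shows "Rel A (ty_of t) k (\<lambda>n. eval (e n) t) (\<lambda>n. eval (e' n) t)"
  using assms
proof (induction t)
  case (Const c)
  then show ?case using Rel_const_val by simp
next
  case (Ap t u)
  then obtain \<tau> where "ty_of t = ty_of u \<rightarrow> \<tau>" by auto
  with Ap show ?case using Rel_app[of "ty_of u" \<tau> k] by simp
qed simp

lemma ext_eq_eval:
  assumes "wt t" "\<And>v. v \<in> tvars t \<Longrightarrow> ext_eq A (snd v) (e v) (e' v)"
  shows "ext_eq A (ty_of t) (eval e t) (eval e' t)"
  using assms
proof (induction t)
  case (Const c)
  then show ?case using ext_eqI[OF Rel_const_val] by simp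
next
  case (Ap t u)
  then obtain \<tau> where "ty_of t = ty_of u \<rightarrow> \<tau>" by auto
  with Ap show ?case using ext_eq_app[of "ty_of u" \<tau>] by simp
qed simp

text \<open>Used to replace any token set that represents a function by the canonical
  \<open>rep1 f\<close>. In the quantifier case the two assignments receive the same
  \<open>u\<close>, which is related to itself since quantifiers range over elements only.\<close>

lemma sat_ext_cong:
  "wff \<phi> \<Longrightarrow> (\<And>v. v \<in> fvars \<phi> \<Longrightarrow> ext_eq A (snd v) (e v) (e' v)) \<Longrightarrow> sat A e \<phi> \<longleftrightarrow> sat A e' \<phi>"
proof (induction \<phi> arbitrary: e e')
  case (Eq t u)
  then have "eval e t = eval e' t" "eval e u = eval e' u"
    using ext_eq_eval[of t e e'] ext_eq_eval[of u e e'] by (auto simp: ext_eq_N)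
  then show ?case by simp
next
  case (Less t u)
  then have "eval e t = eval e' t" "eval e u = eval e' u"
    using ext_eq_eval[of t e e'] ext_eq_eval[of u e e'] by (auto simp: ext_eq_N)
  then show ?case by simp
next
  case (Imp \<phi> \<psi>)
  have "sat A e \<phi> \<longleftrightarrow> sat A e' \<phi>" using Imp.prems by (intro Imp.IH) auto
  moreover have "sat A e \<psi> \<longleftrightarrow> sat A e' \<psi>" using Imp.prems by (intro Imp.IH) auto
  ultimately show ?case by simp
next
  case (All v \<phi>)
  have "sat A (e(v := u)) \<phi> \<longleftrightarrow> sat A (e'(v := u)) \<phi>" if "elem A (snd v) u" for u
    using All.prems that by (intro All.IH) auto
  then show ?case by auto
qed simp

end

lemma fresh_tvars: "v \<in> tvars t \<Longrightarrow> fst v < fresh t"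
  by (induction t) auto

lemma eval_fresh: "fresh t \<le> i \<Longrightarrow> eval (e((i, \<tau>) := u)) t = eval e t"
  by (rule eval_cong) (use fresh_tvars in fastforce)

context world
begin

section \<open>Soundness and the axioms of the base theory\<close>

definition typed :: "(var \<Rightarrow> tok set) \<Rightarrow> bool" where
  "typed e \<longleftrightarrow> (\<forall>v. elem A (snd v) (e v))"

lemma typed_upd: "typed e \<Longrightarrow> elem A (snd v) u \<Longrightarrow> typed (e(v := u))"
  unfolding typed_def by (metis fun_upd_apply)

lemma typed_elem: "typed e \<Longrightarrow> elem A (snd v) (e v)"
  unfolding typed_def by (rule spec)

lemma elem_eval:
  assumes "wt t" "typed e"
  shows "elem A (ty_of t) (eval e t)"
  by (rule ext_eq_eval[OF assms(1) typed_elem[OF assms(2)]])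

theorem soundness:
  assumes "T \<turnstile> \<phi>" and "\<And>\<psi> e. \<psi> \<in> T \<Longrightarrow> typed e \<Longrightarrow> sat A e \<psi>"
  shows "typed e \<Longrightarrow> sat A e \<phi>"
  using assms(1)
proof (induction arbitrary: e rule: proves.induct)
  case (instance_of \<phi> t v)
  have "elem A (snd v) (eval e t)"
    using elem_eval[OF instance_of(2,5)] instance_of(3) by simp
  then show ?case by (simp add: sat_subst[OF instance_of(4)])
next
  case (all_imp \<phi> \<psi> v)
  have "sat A (e(v := u)) \<phi> \<longleftrightarrow> sat A e \<phi>" for u
    using all_imp(3) by (intro sat_fvars_cong) (metis fun_upd_other)
  then show ?case by simp
next
  case (eq_subst \<phi> v t u)
  then show ?case by (simp add: sat_subst)
next
  case (gen \<phi> v)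
  show ?case unfolding sat.simps using typed_upd[OF gen.prems] gen.IH by blast
qed (simp_all add: assms(2))

text \<open>Reduces the extensionality axiom to \<open>ext_eq_app\<close> and the combinator axioms
  to equations between token sets.\<close>

lemma sat_eq_at:
  assumes "wt t" "wt u" "ty_of t = \<tau>" "ty_of u = \<tau>" "typed e"
  shows "sat A e (eq_at \<tau> t u) \<longleftrightarrow> ext_eq A \<tau> (eval e t) (eval e u)"
  using assms
proof (induction \<tau> arbitrary: t u e)
  case N
  have "elem A N (eval e t)" using elem_eval[OF N(1,5)] N(3) by simp
  then show ?case using ext_eq_N by auto
next
  case (Arrow \<rho> \<tau>)
  define z where "z = (max (fresh t) (fresh u), \<rho>)"
  have z: "eval (e(z := x)) t = eval e t" "eval (e(z := x)) u = eval e u" for x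
    unfolding z_def by (simp_all add: eval_fresh)
  have "sat A e (eq_at (\<rho> \<rightarrow> \<tau>) t u) \<longleftrightarrow>
    (\<forall>x. elem A \<rho> x \<longrightarrow> sat A (e(z := x)) (eq_at \<tau> (t \<cdot> Var z) (u \<cdot> Var z)))"
    by (simp add: z_def Let_def)
  also have "\<dots> \<longleftrightarrow> (\<forall>x. elem A \<rho> x \<longrightarrow> ext_eq A \<tau> (app (eval e t) x) (app (eval e u) x))"
  proof -
    have "sat A (e(z := x)) (eq_at \<tau> (t \<cdot> Var z) (u \<cdot> Var z)) \<longleftrightarrow>
      ext_eq A \<tau> (app (eval e t) x) (app (eval e u) x)" if "elem A \<rho> x" for x
    proof -
      have sz: "snd z = \<rho>" by (simp add: z_def)
      then have "typed (e(z := x))" using typed_upd[of e z x] Arrow.prems(5) that by simp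
      then show ?thesis
        using Arrow.IH(2)[of "t \<cdot> Var z" "u \<cdot> Var z" "e(z := x)"] Arrow.prems(1-4) z sz
        by (simp del: fun_upd_apply add: fun_upd_same)
    qed
    then show ?thesis by blast
  qed
  also have "\<dots> \<longleftrightarrow> ext_eq A (\<rho> \<rightarrow> \<tau>) (eval e t) (eval e u)"
    using ext_eq_extensional[of \<rho> \<tau> "eval e t" "eval e u"] elem_eval[OF Arrow.prems(1,5)]
      elem_eval[OF Arrow.prems(2,5)] Arrow.prems(3,4) ext_eq_app[of \<rho> \<tau> "eval e t" "eval e u"] by auto
  finally show ?case .
qed

text \<open>Levels increase, so finitely many parameters share one. This suffices because a formula
  has finitely many free variables.\<close>

lemma common_level:
  assumes "finite V" "\<And>v. v \<in> V \<Longrightarrow> elem A (snd v) (e v)"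
  shows "\<exists>k. \<forall>v\<in>V. Rel A (snd v) k (\<lambda>_. e v) (\<lambda>_. e v)"
  using assms
proof (induction V rule: finite_induct)
  case (insert v V)
  then obtain k where k: "\<forall>w\<in>V. Rel A (snd w) k (\<lambda>_. e w) (\<lambda>_. e w)" by auto
  obtain j where j: "Rel A (snd v) j (\<lambda>_. e v) (\<lambda>_. e v)"
    using insert.prems[of v] unfolding ext_eq_def by auto
  show ?case
  proof (intro exI ballI)
    fix w assume "w \<in> insert v V"
    then show "Rel A (snd w) (max j k) (\<lambda>_. e w) (\<lambda>_. e w)"
      using Rel_mono[OF j max.cobounded1] k Rel_mono[of "snd w" k "\<lambda>_. e w" "\<lambda>_. e w" "max j k"] by auto
  qed
qed simp

text \<open>The parameters may have any type: by \<open>Rel_eval\<close> the numerical values of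
  terms along the sequence of assignments still form a function in \<open>A k\<close>, and
  \<open>OEq\<close>, \<open>OLess\<close> and \<open>OImp\<close> do the rest.\<close>

lemma qf_char:
  assumes "qf \<phi>" "wff \<phi>" "\<And>v. v \<in> fvars \<phi> \<Longrightarrow> Rel A (snd v) k (\<lambda>n. e n v) (\<lambda>n. e n v)"
  shows "(\<lambda>n. of_bool (\<not> sat A (e n) \<phi>)) \<in> A k"
  using assms
proof (induction \<phi>)
  case (Eq t u)
  from Eq obtain f g where fg: "f \<in> A k" "g \<in> A k"
    "(\<lambda>n. eval (e n) t) = (\<lambda>n. num (f n))" "(\<lambda>n. eval (e n) u) = (\<lambda>n. num (g n))"
    using Rel_eval[of t k e e] Rel_eval[of u k e e] by auto
  then have "sat A (e n) (t \<doteq> u) \<longleftrightarrow> f n = g n" for n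
    by (simp add: fun_eq_iff)
  then show ?case using A_eq[OF fg(1,2)] by simp
next
  case (Less t u)
  from Less obtain f g where fg: "f \<in> A k" "g \<in> A k"
    "(\<lambda>n. eval (e n) t) = (\<lambda>n. num (f n))" "(\<lambda>n. eval (e n) u) = (\<lambda>n. num (g n))"
    using Rel_eval[of t k e e] Rel_eval[of u k e e] by auto
  then have "sat A (e n) (t \<prec> u) \<longleftrightarrow> f n < g n" for n
    by (simp add: fun_eq_iff)
  then show ?case using A_less[OF fg(1,2)] by simp
next
  case Bot
  then show ?case using A_const[of 1 k] by simp
next
  case (Imp \<phi> \<psi>)
  then have "(\<lambda>n. of_bool (\<not> sat A (e n) \<phi>)) \<in> A k" "(\<lambda>n. of_bool (\<not> sat A (e n) \<psi>)) \<in> A k"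
    by auto
  from A_imp[OF this] show ?case by simp
qed simp

text \<open>The choice functional returns the least witness. Along a sequence of functions from
  \<open>A j\<close> this is one unbounded search for a zero of a function in \<open>A j\<close>,
  provided that \<open>A j\<close> contains the parameters of \<open>\<phi>\<close>.\<close>

lemma sat_QF_AC:
  assumes \<phi>: "wff \<phi>" "qf \<phi>" and x: "snd x = One" and y: "snd y = N" and Y: "snd Y = Two"
    and "Y \<notin> fvars \<phi>" and e: "typed e"
  shows "sat A e ((\<^bold>\<forall>x. \<^bold>\<exists>y. \<phi>) \<^bold>\<longrightarrow> (\<^bold>\<exists>Y. \<^bold>\<forall>x. subst y (Var Y \<cdot> Var x) \<phi>))"
proof -
  have ne: "x \<noteq> y" "Y \<noteq> x" "Y \<noteq> y" using x y Y by auto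
  \<comment> \<open>Evaluation at \<open>rep1 f\<close> makes the choice depend on the function only
    and not on the token set that represents it.\<close>
  define \<Phi> where "\<Phi> f = (LEAST m. sat A (e(x := rep1 f, y := num m)) \<phi>)" for f
  have "elem A Two (repF \<Phi>)"
  proof -
    obtain k where k: "\<And>v. v \<in> fvars \<phi> \<Longrightarrow> Rel A (snd v) k (\<lambda>_. e v) (\<lambda>_. e v)"
      using common_level[OF finite_fvars typed_elem[OF e]] by blast
    have "Rel A Two k (\<lambda>_. repF \<Phi>) (\<lambda>_. repF \<Phi>)"
    proof (rule Rel_const_famI)
      fix j u v
      assume kj: "k \<le> j" and uv: "Rel A One j u v"
      then obtain F where F: "F \<in> A j" "\<And>n. represents (u n) (\<lambda>m. F (npair n m))" "\<And>n. represents (v n) (\<lambda>m. F (npair n m))"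
        unfolding Rel_One by blast
      \<comment> \<open>\<open>p\<close> codes the index of a member together with a candidate for
        \<open>y\<close>, so that \<open>qf_char\<close> yields a single function to be
        searched.\<close>
      define E where "E p = e(x := rep1 (\<lambda>m. F (npair (nfst p) m)), y := num (nsnd p))" for p
      have G: "(\<lambda>q. F (npair (nfst (nfst q)) (nsnd q))) \<in> A j"
        by (rule A_comp[OF F(1) A_pair[OF A_comp[OF A_fst A_fst] A_snd]])
      have "Rel A (snd w) j (\<lambda>p. E p w) (\<lambda>p. E p w)" if "w \<in> fvars \<phi>" for w
      proof -
        consider "w = x" | "w = y" | "w \<noteq> x" "w \<noteq> y" by blast
        then show ?thesis
        proof cases
          case 1
          then show ?thesis using ne G
            by (simp add: E_def x Rel_One represents_rep1) (rule bexI[of _ "\<lambda>q. F (npair (nfst (nfst q)) (nsnd q))"], simp_all add: represents_rep1)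
        next
          case 2
          then show ?thesis using A_snd[of j] by (simp add: E_def y) blast
        next
          case 3
          then show ?thesis using Rel_mono[OF k[OF that] kj] by (simp add: E_def)
        qed
      qed
      from A_mu[OF qf_char[OF \<phi>(2,1) this]]
      have "(\<lambda>n. LEAST m. sat A (E (npair n m)) \<phi>) \<in> A j" by simp
      then have "(\<lambda>n. \<Phi> (\<lambda>m. F (npair n m))) \<in> A j" by (simp add: E_def \<Phi>_def)
      then show "Rel A N j (\<lambda>n. app (repF \<Phi>) (u n)) (\<lambda>n. app (repF \<Phi>) (v n))"
        unfolding app_repF[OF F(2)] app_repF[OF F(3)] by (rule Rel_num)
    qed
    then show ?thesis by (rule ext_eqI)
  qed
  moreover have "sat A (e(Y := repF \<Phi>, x := u)) (subst y (Var Y \<cdot> Var x) \<phi>)"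
    if H: "sat A e (\<^bold>\<forall>x. \<^bold>\<exists>y. \<phi>)" and "elem A One u" for u
  proof -
    from that obtain f k where f: "f \<in> A k" "represents u f" by (auto simp: elem_One)
    have el: "elem A One (rep1 f)" using f(1) represents_rep1 by (auto simp: elem_One)
    with H x y obtain m where "sat A (e(x := rep1 f, y := num m)) \<phi>" by auto
    then have "sat A (e(x := rep1 f, y := num (\<Phi> f))) \<phi>"
      unfolding \<Phi>_def by (rule LeastI)
    also have "sat A (e(x := rep1 f, y := num (\<Phi> f))) \<phi> \<longleftrightarrow>
        sat A (e(Y := repF \<Phi>, x := u, y := num (\<Phi> f))) \<phi>"
    proof (rule sat_ext_cong[OF \<phi>(1)])
      fix v assume "v \<in> fvars \<phi>"
      then have "v \<noteq> Y" using assms(6) by blast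
      moreover have "ext_eq A One (rep1 f) u"
        unfolding ext_eq_One using f represents_rep1 by blast
      ultimately show "ext_eq A (snd v) ((e(x := rep1 f, y := num (\<Phi> f))) v)
          ((e(Y := repF \<Phi>, x := u, y := num (\<Phi> f))) v)"
        using x y typed_elem[OF e, of v] by (auto simp: ext_eq_N)
    qed
    finally show ?thesis
      using ne by (simp add: sat_subst[OF qf_free_for[OF \<phi>(2)]] app_repF[OF f(2)])
  qed
  ultimately show ?thesis using x Y by auto
qed

lemma sat_RCA0_omega:
  assumes "\<phi> \<in> RCA0_omega" "typed e"
  shows "sat A e \<phi>"
  using assms
proof (cases rule: RCA0_omega.cases)
  case arith
  obtain m n where "e (0, N) = num m" "e (1, N) = num n"
    using typed_elem[OF assms(2), of "(0, N)"] typed_elem[OF assms(2), of "(1, N)"] by auto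
  with arith show ?thesis
    by (auto simp: arith_axioms_def Let_def app_rep1 app_rep2)
next
  case (comb_Pi x \<rho> y \<sigma>)
  show ?thesis unfolding comb_Pi(1)
    by (subst sat_eq_at) (use comb_Pi(2,3) typed_elem[OF assms(2), of "(0, \<rho>)"] assms(2) in \<open>simp_all add: app_K\<close>)
next
  case (comb_Sigma x \<rho> \<sigma> \<tau> y z)
  have "elem A \<tau> (eval e (x \<cdot> z \<cdot> (y \<cdot> z)))"
    using elem_eval[of "x \<cdot> z \<cdot> (y \<cdot> z)" e] assms(2) comb_Sigma by simp
  then show ?thesis unfolding comb_Sigma(1)
    by (subst sat_eq_at) (use comb_Sigma(2-) assms(2) in \<open>simp_all add: app_S\<close>)
next
  case (rec_zero f m)
  then show ?thesis by (simp add: app_R)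
next
  case (rec_suc f m n)
  obtain k where "e (2, N) = num k" using typed_elem[OF assms(2), of "(2, N)"] by auto
  with rec_suc show ?thesis by (simp add: app_rep1 app_R)
next
  case (extensionality x \<rho> y f \<tau>)
  have "elem A (\<rho> \<rightarrow> \<tau>) (eval e f)"
    using typed_elem[OF assms(2), of "(2, \<rho> \<rightarrow> \<tau>)"] extensionality by simp
  then show ?thesis unfolding extensionality(1)
    using extensionality(2-) assms(2) ext_eq_app by (simp add: sat_eq_at)
next
  case (QF_induction \<psi> n)
  have *: "sat A e (subst n t \<psi>) \<longleftrightarrow> sat A (e(n := eval e t)) \<psi>" for t e
    by (rule sat_subst[OF qf_free_for[OF QF_induction(3)]])
  have "sat A (e(n := num k)) \<psi>"
    if "sat A (e(n := num 0)) \<psi>" "\<And>k. sat A (e(n := num k)) \<psi> \<Longrightarrow> sat A (e(n := num (Suc k))) \<psi>" for k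
    using that by (induction k) (simp_all del: fun_upd_apply)
  moreover have "sat A (e(n := num (Suc k))) \<psi>"
    if "\<forall>u. (\<exists>n. u = num n) \<longrightarrow> sat A (e(n := u)) \<psi> \<longrightarrow> sat A (e(n := app (rep1 Suc) u)) \<psi>"
      "sat A (e(n := num k)) \<psi>" for k
    using that(1)[rule_format, of "num k"] that(2) by (simp add: app_rep1 del: fun_upd_apply)
  ultimately show ?thesis using QF_induction(4) unfolding QF_induction(1)
    by (auto simp: *)
next
  case (QF_AC \<psi> x y Y)
  then show ?thesis using sat_QF_AC assms(2) by blast
qed

end

section \<open>Elementarity and the functionals \<open>S\<^sub>k\<^sup>2\<close>\<close>

declare lam.simps [simp del]

lemma wt_lam [simp]: "wt t \<Longrightarrow> wt (lam v t)"
  and ty_of_lam [simp]: "wt t \<Longrightarrow> ty_of (lam v t) = snd v \<rightarrow> ty_of t"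
proof -
  have "wt t \<Longrightarrow> wt (lam v t) \<and> ty_of (lam v t) = snd v \<rightarrow> ty_of t"
    by (induction t) (auto simp: lam.simps)
  then show "wt t \<Longrightarrow> wt (lam v t)" "wt t \<Longrightarrow> ty_of (lam v t) = snd v \<rightarrow> ty_of t" by auto
qed

lemma tvars_lam [simp]: "tvars (lam v t) = tvars t - {v}"
  by (induction t) (auto simp: lam.simps)

lemmas coding_defs = initial_def pair_def isqrt_def p1_def p2_def one_def pred_def monus_def two_pow_def Let_def

lemma initials_props:
  "wt (initials k) \<and> ty_of (initials k) = N \<and> tvars (initials k) \<subseteq> insert n_var (g_var ` {..<k})"
proof (induction k rule: initials.induct)
  case (3 i)
  have "g_var ` {..<Suc i} \<subseteq> g_var ` {..<Suc (Suc i)}" by auto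
  with 3 show ?case by (auto simp: coding_defs n_var_def g_var_def)
qed (auto simp: coding_defs n_var_def g_var_def)

definition low_var :: "var \<Rightarrow> bool" where "low_var v \<longleftrightarrow> snd v = N \<or> snd v = One"

text \<open>Only variables are restricted; constants of every type may occur, as they do in
  \<open>initials\<close>.\<close>

fun low :: "fm \<Rightarrow> bool" where
  "low (t \<doteq> u) \<longleftrightarrow> (\<forall>v\<in>tvars t \<union> tvars u. low_var v)"
| "low (t \<prec> u) \<longleftrightarrow> (\<forall>v\<in>tvars t \<union> tvars u. low_var v)"
| "low Bot \<longleftrightarrow> True"
| "low (\<phi> \<^bold>\<longrightarrow> \<psi>) \<longleftrightarrow> low \<phi> \<and> low \<psi>"
| "low (\<^bold>\<forall>v. \<phi>) \<longleftrightarrow> low_var v \<and> low \<phi>"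

lemma alternating_props:
  "wff (alternating i v \<phi>) \<longleftrightarrow> wff \<phi>"
  "fvars (alternating i v \<phi>) = fvars \<phi> - {v}"
  "low (alternating i v \<phi>) \<longleftrightarrow> low_var v \<and> low \<phi>"
  by (auto simp: alternating_def Ex_def Neg_def)

lemma foldr_alternating_props:
  "wff (foldr (\<lambda>i. alternating i (v i)) xs \<phi>) \<longleftrightarrow> wff \<phi>"
  "fvars (foldr (\<lambda>i. alternating i (v i)) xs \<phi>) = fvars \<phi> - v ` set xs"
  "low (foldr (\<lambda>i. alternating i (v i)) xs \<phi>) \<longleftrightarrow> (\<forall>i\<in>set xs. low_var (v i)) \<and> low \<phi>"
  by (induction xs) (auto simp: alternating_props)

lemma Sigma_formula_props:
  shows wff_Sigma: "wff (Sigma_formula k)"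
    and fvars_Sigma: "fvars (Sigma_formula k) \<subseteq> {f_par}"
    and low_Sigma: "low (Sigma_formula k)"
proof -
  show "wff (Sigma_formula k)"
    using initials_props[of k]
    by (simp add: Sigma_formula_def alternating_props foldr_alternating_props f_par_def)
  show "fvars (Sigma_formula k) \<subseteq> {f_par}"
    using initials_props[of k]
    by (auto simp: Sigma_formula_def alternating_props foldr_alternating_props atLeast0LessThan)
  show "low (Sigma_formula k)"
    using initials_props[of k]
    by (auto simp: Sigma_formula_def alternating_props foldr_alternating_props low_var_def
        f_par_def g_var_def n_var_def)
qed

text \<open>A single function codes the values of all variables of types 0 and 1, so that unary Skolem
  functions suffice.\<close>

definition decode :: "(nat \<Rightarrow> nat) \<Rightarrow> var \<Rightarrow> tok set" where
  "decode F v =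
    (if snd v = N then num (F (npair 0 (npair (fst v) 0)))
     else if snd v = One then rep1 (\<lambda>m. F (npair 1 (npair (fst v) m)))
     else num 0)"

text \<open>A code has one row for each variable: first the type (0 or 1), then the index, then the
  argument. An update overwrites the whole row, of which \<open>decode\<close> reads only entry 0 if
  the type is \<open>N\<close>.\<close>

definition upd :: "var \<Rightarrow> (nat \<Rightarrow> nat) \<Rightarrow> (nat \<Rightarrow> nat) \<Rightarrow> nat \<Rightarrow> nat" where
  "upd v F G p =
    (if nfst p = of_bool (snd v = One) \<and> nfst (nsnd p) = fst v then G (nsnd (nsnd p)) else F p)"

lemma decode_upd_N: "snd v = N \<Longrightarrow> decode (upd v F G) = (decode F)(v := num (G 0))"
proof (rule ext)
  fix w assume "snd v = N"
  then show "decode (upd v F G) w = ((decode F)(v := num (G 0))) w"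
    by (cases "fst w = fst v"; cases "snd w = N") (auto simp: decode_def upd_def prod_eq_iff)
qed

lemma decode_upd_One: "snd v = One \<Longrightarrow> decode (upd v F G) = (decode F)(v := rep1 G)"
proof (rule ext)
  fix w assume "snd v = One"
  then show "decode (upd v F G) w = ((decode F)(v := rep1 G)) w"
    by (cases "fst w = fst v"; cases "snd w = One") (auto simp: decode_def upd_def prod_eq_iff)
qed

lemma low_fvars: "low \<phi> \<Longrightarrow> v \<in> fvars \<phi> \<Longrightarrow> low_var v"
  by (induction \<phi>) auto

lemma (in world) elem_decode:
  assumes "low_var v" "F \<in> A k"
  shows "elem A (snd v) (decode F v)"
proof (cases "snd v = N")
  case False
  then have v: "snd v = One" using assms(1) by (simp add: low_var_def)
  have "(\<lambda>m. F (npair 1 (npair (fst v) m))) \<in> A k"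
    by (rule A_comp[OF assms(2) A_pair[OF A_const A_pair[OF A_const A_id]]])
  then show ?thesis using represents_rep1 by (auto simp: decode_def v elem_One)
qed (auto simp: decode_def)

lemma (in world) sat_decode_upd:
  assumes "wff \<phi>" "low \<phi>" "snd v = One" "F \<in> A k" "g \<in> A k" "represents u g"
  shows "sat A ((decode F)(v := u)) \<phi> \<longleftrightarrow> sat A ((decode F)(v := rep1 g)) \<phi>"
proof (rule sat_ext_cong[OF assms(1)])
  fix w assume "w \<in> fvars \<phi>"
  then have "elem A (snd w) (decode F w)"
    using low_fvars[OF assms(2)] elem_decode[OF _ assms(4)] by blast
  moreover have "ext_eq A One u (rep1 g)"
    unfolding ext_eq_One using assms(5,6) represents_rep1 by blast
  ultimately show "ext_eq A (snd w) (((decode F)(v := u)) w) (((decode F)(v := rep1 g)) w)"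
    using assms(3) by auto
qed

section \<open>Skolem functions, truth sets and elementarity\<close>

abbreviation Full :: "nat \<Rightarrow> (nat \<Rightarrow> nat) set" where "Full \<equiv> \<lambda>_. UNIV"

interpretation full: world Full
  by unfold_locales (auto simp: clone_def)

text \<open>The universal quantifier is primitive, so counterexamples are chosen. As they refer to
  \<open>Full\<close>, they do not depend on the chain to be closed under them.\<close>

definition skolem :: "fm \<Rightarrow> var \<Rightarrow> (nat \<Rightarrow> nat) \<Rightarrow> nat \<Rightarrow> nat" where
  "skolem \<phi> v F = (SOME g. \<not> sat Full ((decode F)(v := rep1 g)) \<phi>)"

text \<open>Decides \<open>\<phi>\<close> for all members of the sequence coded by \<open>F\<close>
  at once, which is what \<open>Rel\<close> demands of a functional of type
  \<open>Two\<close>.\<close>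

definition truth :: "fm \<Rightarrow> (nat \<Rightarrow> nat) \<Rightarrow> nat \<Rightarrow> nat" where
  "truth \<phi> F n = of_bool (\<not> sat Full ((\<lambda>_. num 0)(f_par := rep1 (\<lambda>m. F (npair n m)))) \<phi>)"

locale elementary = world +
  assumes upd_closed: "f \<in> A k \<Longrightarrow> g \<in> A k \<Longrightarrow> upd v f g \<in> A k"
    and skolem_closed: "f \<in> A k \<Longrightarrow> skolem \<phi> v f \<in> A k"
    and truth_closed: "f \<in> A k \<Longrightarrow> truth \<phi> f \<in> A k"
begin

text \<open>The Tarski-Vaught test for the union of the chain: if a universal formula fails in
  \<open>Full\<close>, then the Skolem function provides a counterexample on the level of the
  parameters.\<close>

lemma elementarity:
  "low \<phi> \<Longrightarrow> wff \<phi> \<Longrightarrow> F \<in> A k \<Longrightarrow> sat A (decode F) \<phi> \<longleftrightarrow> sat Full (decode F) \<phi>"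
proof (induction \<phi> arbitrary: F k)
  case (All v \<phi>)
  have \<phi>: "wff \<phi>" "low \<phi>" using All.prems by auto
  have IH: "sat A (decode G) \<phi> \<longleftrightarrow> sat Full (decode G) \<phi>" if "G \<in> A i" for G i
    using All.IH[OF \<phi>(2,1) that] .
  show ?case
  proof (cases "snd v = N")
    case True
    have "sat A ((decode F)(v := num n)) \<phi> \<longleftrightarrow> sat Full ((decode F)(v := num n)) \<phi>" for n
      using IH[OF upd_closed[OF All.prems(3) A_const], of v n] True by (simp add: decode_upd_N)
    with True show ?thesis by auto
  next
    case False
    with All.prems have v: "snd v = One" by (simp add: low_var_def)
    have IH': "sat A ((decode F)(v := rep1 g)) \<phi> \<longleftrightarrow> sat Full ((decode F)(v := rep1 g)) \<phi>"
      if "F \<in> A i" "g \<in> A i" for g i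
      using IH[OF upd_closed[OF that], of v] v by (simp add: decode_upd_One)
    show ?thesis
    proof
      assume *: "sat A (decode F) (\<^bold>\<forall>v. \<phi>)"
      show "sat Full (decode F) (\<^bold>\<forall>v. \<phi>)"
      proof (rule ccontr)
        assume "\<not> sat Full (decode F) (\<^bold>\<forall>v. \<phi>)"
        then obtain u where u: "elem Full One u" "\<not> sat Full ((decode F)(v := u)) \<phi>" using v by auto
        then obtain g where g: "represents u g" unfolding full.elem_One by blast
        then have "\<not> sat Full ((decode F)(v := rep1 g)) \<phi>"
          using u(2) full.sat_decode_upd[OF \<phi> v _ _ g] by simp
        then have "\<not> sat Full ((decode F)(v := rep1 (skolem \<phi> v F))) \<phi>"
          unfolding skolem_def by (rule someI[of "\<lambda>g. \<not> sat Full ((decode F)(v := rep1 g)) \<phi>"])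
        moreover have "elem A One (rep1 (skolem \<phi> v F))"
          unfolding elem_One using skolem_closed[OF All.prems(3)] represents_rep1 by blast
        ultimately show False
          using *[unfolded sat.simps v, rule_format]
            IH'[OF All.prems(3) skolem_closed[OF All.prems(3)]] by blast
      qed
    next
      assume *: "sat Full (decode F) (\<^bold>\<forall>v. \<phi>)"
      have "sat A ((decode F)(v := u)) \<phi>" if u: "elem A (snd v) u" for u
      proof -
        obtain g i where g: "g \<in> A i" "represents u g" using u unfolding v elem_One by blast
        \<comment> \<open>\<open>g\<close> may first appear on a later level than \<open>F\<close>,
          whereas \<open>upd_closed\<close> wants both on one level.\<close>
        have gj: "F \<in> A (max i k)" "g \<in> A (max i k)"
          using g(1) All.prems(3) A_mono[of i "max i k"] A_mono[of k "max i k"] by auto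
        have "elem Full One (rep1 g)" using represents_rep1 by (auto simp: full.elem_One)
        with * v have "sat Full ((decode F)(v := rep1 g)) \<phi>" by simp
        then show ?thesis using IH'[OF gj] sat_decode_upd[OF \<phi> v gj g(2)] by simp
      qed
      then show "sat A (decode F) (\<^bold>\<forall>v. \<phi>)" by simp
    qed
  qed
qed simp_all

lemma truth_correct:
  assumes "low \<phi>" "wff \<phi>" "fvars \<phi> \<subseteq> {f_par}" "f \<in> A k"
  shows "sat A (e(f_par := rep1 f)) \<phi> \<longleftrightarrow> sat Full (e(f_par := rep1 f)) \<phi>"
proof -
  \<comment> \<open>Elementarity is about assignments that have a code in the level; this one codes
    \<open>f\<close> and is 0 elsewhere.\<close>
  let ?F = "upd f_par (\<lambda>_. 0) f"
  have F: "?F \<in> A k" by (rule upd_closed[OF A_const assms(4)])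
  have "decode ?F = (decode (\<lambda>_. 0))(f_par := rep1 f)" by (rule decode_upd_One) (simp add: f_par_def)
  then have "sat B (e(f_par := rep1 f)) \<phi> \<longleftrightarrow> sat B (decode ?F) \<phi>" for B
    using assms(3) by (intro sat_fvars_cong) auto
  then show ?thesis using elementarity[OF assms(1,2) F] by simp
qed

text \<open>The axiom asks for a functional that decides truth in the model. To see that the
  functional is an element, elementarity turns this into truth in \<open>Full\<close>, under which
  every level is closed.\<close>

lemma sat_S_exists: "sat A e (S_exists k)"
proof -
  let ?\<phi> = "Sigma_formula k"
  define \<Phi> :: "(nat \<Rightarrow> nat) \<Rightarrow> nat" where
    "\<Phi> f = of_bool (\<not> sat A ((\<lambda>_. num 0)(f_par := rep1 f)) ?\<phi>)" for f
  have "Rel A Two 0 (\<lambda>_. repF \<Phi>) (\<lambda>_. repF \<Phi>)"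
  proof (rule Rel_const_famI)
    fix j u v
    assume "Rel A One j u v"
    then obtain F where F: "F \<in> A j" "\<And>n. represents (u n) (\<lambda>m. F (npair n m))" "\<And>n. represents (v n) (\<lambda>m. F (npair n m))"
      unfolding Rel_One by blast
    have "(\<lambda>m. F (npair n m)) \<in> A j" for n
      by (rule A_comp[OF F(1) A_pair[OF A_const A_id]])
    from truth_correct[OF low_Sigma wff_Sigma fvars_Sigma this]
    have "truth ?\<phi> F = (\<lambda>n. \<Phi> (\<lambda>m. F (npair n m)))" by (simp add: truth_def \<Phi>_def fun_eq_iff)
    with truth_closed[OF F(1), of ?\<phi>] have "(\<lambda>n. \<Phi> (\<lambda>m. F (npair n m))) \<in> A j" by simp
    then show "Rel A N j (\<lambda>n. app (repF \<Phi>) (u n)) (\<lambda>n. app (repF \<Phi>) (v n))"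
      unfolding app_repF[OF F(2)] app_repF[OF F(3)] by (rule Rel_num)
  qed
  then have "elem A Two (repF \<Phi>)" by (rule ext_eqI)
  moreover have "sat A (e((0, Two) := repF \<Phi>, f_par := u))
      ((Var (0, Two) \<cdot> Var f_par \<doteq> zero \<^bold>\<or> Var (0, Two) \<cdot> Var f_par \<doteq> one) \<^bold>\<and>
       (Var (0, Two) \<cdot> Var f_par \<doteq> zero \<^bold>\<longleftrightarrow> ?\<phi>))" if u: "elem A One u" for u
  proof -
    obtain f j where f: "f \<in> A j" "represents u f" using u unfolding elem_One by blast
    have "sat A (e((0, Two) := repF \<Phi>, f_par := u)) ?\<phi> \<longleftrightarrow>
        sat A ((\<lambda>_. num 0)(f_par := rep1 f)) ?\<phi>"
    proof (rule sat_ext_cong[OF wff_Sigma])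
      fix v assume "v \<in> fvars ?\<phi>"
      then have "v = f_par" using fvars_Sigma by blast
      moreover have "ext_eq A One u (rep1 f)" unfolding ext_eq_One using f represents_rep1 by blast
      ultimately show "ext_eq A (snd v) ((e((0, Two) := repF \<Phi>, f_par := u)) v)
          (((\<lambda>_. num 0)(f_par := rep1 f)) v)" by (simp add: f_par_def)
    qed
    then show ?thesis
      by (simp add: f_par_def app_repF[OF f(2)] one_def app_rep1) (simp add: \<Phi>_def f_par_def)
  qed
  ultimately show ?thesis
    by (auto simp: S_exists_def Let_def f_par_def simp del: fun_upd_apply)
qed

theorem sat_Z2_omega: "\<phi> \<in> Z2_omega \<Longrightarrow> typed e \<Longrightarrow> sat A e \<phi>"
  by (auto simp: Z2_omega_def Pi1_CA0_omega_def sat_S_exists sat_RCA0_omega)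

end

section \<open>Rational and real numbers in the model\<close>

text \<open>Being a numeral and its value are kept apart, so that both can be computed along the
  structure of a term by rewriting.\<close>

definition is_num :: "tok set \<Rightarrow> bool" where "is_num u \<longleftrightarrow> (\<exists>n. u = num n)"
definition the_num :: "tok set \<Rightarrow> nat" where "the_num u = (THE n. u = num n)"

lemma is_num_num [simp]: "is_num (num n)" "the_num (num n) = n"
  by (auto simp: is_num_def the_num_def)

lemma is_num_eq: "is_num u \<Longrightarrow> u = num (the_num u)"
  by (auto simp: is_num_def)

lemma app_rep1_num [simp]:
  "is_num u \<Longrightarrow> is_num (app (rep1 f) u)"
  "is_num u \<Longrightarrow> the_num (app (rep1 f) u) = f (the_num u)"
  by (auto simp: is_num_def app_rep1)

lemma app_rep2_num [simp]:
  "is_num u \<Longrightarrow> is_num v \<Longrightarrow> is_num (app (app (rep2 f) u) v)"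
  "is_num u \<Longrightarrow> is_num v \<Longrightarrow> the_num (app (app (rep2 f) u) v) = f (the_num u) (the_num v)"
  by (auto simp: is_num_def app_rep2)

lemma eval_rec_num:
  assumes "is_num (eval e m)" "is_num (eval e n)"
    and "\<And>a b. is_num (app (app (eval e f) (num a)) (num b))"
    and "\<And>a b. the_num (app (app (eval e f) (num a)) (num b)) = g a b"
  shows "is_num (eval e (rec f m n))"
    and "the_num (eval e (rec f m n)) = rec_nat (the_num (eval e m)) g (the_num (eval e n))"
proof -
  obtain k l where kl: "eval e m = num k" "eval e n = num l" using assms(1,2) unfolding is_num_def by blast
  have "app (app (eval e f) (num a)) (num b) = num (g a b)" for a b
    using is_num_eq[OF assms(3)] assms(4) by simp
  then have "eval e (rec f m n) = num (rec_nat k g l)"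
    by (simp add: kl app_R iter_rec_eq del: const_val.simps)
  then show "is_num (eval e (rec f m n))"
    "the_num (eval e (rec f m n)) = rec_nat (the_num (eval e m)) g (the_num (eval e n))"
    by (simp_all del: eval.simps add: kl)
qed

lemma eval_one [simp]: "is_num (eval e one)" "the_num (eval e one) = 1"
  by (simp_all add: one_def)

lemma eval_pred [simp]:
  assumes "is_num (eval e t)"
  shows "is_num (eval e (pred t))" "the_num (eval e (pred t)) = the_num (eval e t) - 1"
proof -
  have "rec_nat 0 (\<lambda>a b. a) n = n - 1" for n by (cases n) simp_all
  then show "is_num (eval e (pred t))" "the_num (eval e (pred t)) = the_num (eval e t) - 1"
    unfolding pred_def using assms
    by (subst eval_rec_num[where g = "\<lambda>a b. a"]; simp add: eval_lam)+
qed

lemma eval_monus [simp]: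
  assumes "is_num (eval e t)" "is_num (eval e u)"
  shows "is_num (eval e (t \<^bold>- u))" "the_num (eval e (t \<^bold>- u)) = the_num (eval e t) - the_num (eval e u)"
proof -
  have "rec_nat m (\<lambda>a b. b - 1) n = m - n" for m n by (induction n) simp_all
  then show "is_num (eval e (t \<^bold>- u))" "the_num (eval e (t \<^bold>- u)) = the_num (eval e t) - the_num (eval e u)"
    unfolding monus_def using assms
    by (subst eval_rec_num[where g = "\<lambda>a b. b - 1"]; simp add: eval_lam)+
qed

lemma eval_two_pow [simp]:
  assumes "is_num (eval e t)"
  shows "is_num (eval e (two_pow t))" "the_num (eval e (two_pow t)) = 2 ^ the_num (eval e t)"
proof -
  have "rec_nat 1 (\<lambda>a b. b + b) n = (2::nat) ^ n" for n by (induction n) simp_all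
  then show "is_num (eval e (two_pow t))" "the_num (eval e (two_pow t)) = 2 ^ the_num (eval e t)"
    unfolding two_pow_def using assms
    by (subst eval_rec_num[where g = "\<lambda>a b. b + b"]; simp add: eval_lam)+
qed

text \<open>With truncated subtraction, \<open>1 - (1 - d)\<close> is 1 if \<open>d > 0\<close> and
  0 otherwise. Here \<open>d > 0\<close> means that the square of \<open>s + 1\<close> is at most
  \<open>m + 1\<close>, where \<open>s\<close> is the root of \<open>m\<close>; since that square
  exceeds \<open>m\<close>, it then equals \<open>m + 1\<close>.\<close>

lemma floor_sqrt_rec:
  "floor_sqrt (Suc m) = floor_sqrt m + (1 - (1 - (m + 2 - (Suc (floor_sqrt m))\<^sup>2)))"
proof -
  have 1: "(floor_sqrt m)\<^sup>2 \<le> m" "m < (Suc (floor_sqrt m))\<^sup>2"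
    by (simp_all add: Suc_floor_sqrt_power2_gt)
  show ?thesis
  proof (cases "(Suc (floor_sqrt m))\<^sup>2 = Suc m")
    case True
    then have "floor_sqrt (Suc m) = Suc (floor_sqrt m)"
      by (metis floor_sqrt_inverse_power2)
    with True show ?thesis by simp
  next
    case False
    then have "floor_sqrt (Suc m) = floor_sqrt m"
      using 1 by (intro floor_sqrt_unique) linarith+
    moreover have "m + 2 - (Suc (floor_sqrt m))\<^sup>2 = 0" using 1 False by linarith
    ultimately show ?thesis by simp
  qed
qed

lemma eval_isqrt [simp]:
  assumes "is_num (eval e t)"
  shows "is_num (eval e (isqrt t))" "the_num (eval e (isqrt t)) = floor_sqrt (the_num (eval e t))"
proof -
  let ?g = "\<lambda>m s. s + (1 - (1 - (Suc (Suc m) - Suc s * Suc s)))"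
  have "rec_nat 0 ?g n = floor_sqrt n" for n
  proof (induction n)
    case (Suc n)
    then show ?case using floor_sqrt_rec[of n] by (simp add: power2_eq_square)
  qed simp
  then show "is_num (eval e (isqrt t))" "the_num (eval e (isqrt t)) = floor_sqrt (the_num (eval e t))"
    unfolding isqrt_def Let_def using assms
    by (subst eval_rec_num[where g = ?g]; simp add: eval_lam)+
qed

definition pair_val :: "nat \<Rightarrow> nat \<Rightarrow> nat" where "pair_val a b = (a + b) * (a + b) + a"
definition p1_val :: "nat \<Rightarrow> nat" where "p1_val p = p - floor_sqrt p * floor_sqrt p"
definition p2_val :: "nat \<Rightarrow> nat" where "p2_val p = floor_sqrt p - p1_val p"

lemma pair_val_simps [simp]: "p1_val (pair_val a b) = a" "p2_val (pair_val a b) = b"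
proof -
  have "floor_sqrt (pair_val a b) = a + b"
    by (rule floor_sqrt_unique) (simp_all add: pair_val_def power2_eq_square)
  then show "p1_val (pair_val a b) = a" "p2_val (pair_val a b) = b" by (simp_all add: p1_val_def p2_val_def pair_val_def)
qed

lemma eval_pair [simp]:
  assumes "is_num (eval e t)" "is_num (eval e u)"
  shows "is_num (eval e (pair t u))" "the_num (eval e (pair t u)) = pair_val (the_num (eval e t)) (the_num (eval e u))"
  using assms by (simp_all add: pair_def pair_val_def)

lemma eval_p1 [simp]:
  assumes "is_num (eval e t)"
  shows "is_num (eval e (p1 t))" "the_num (eval e (p1 t)) = p1_val (the_num (eval e t))"
  using assms by (simp_all add: p1_def p1_val_def)

lemma eval_p2 [simp]:
  assumes "is_num (eval e t)"
  shows "is_num (eval e (p2 t))" "the_num (eval e (p2 t)) = p2_val (the_num (eval e t))"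
  using assms by (simp_all add: p2_def p2_val_def)

definition rat_val :: "nat \<Rightarrow> real" where
  "rat_val q = (real (p1_val q) - real (p1_val (p2_val q))) / real (Suc (p2_val (p2_val q)))"

abbreviation rat_eval :: "(var \<Rightarrow> tok set) \<Rightarrow> tm \<Rightarrow> real" where
  "rat_eval e t \<equiv> rat_val (the_num (eval e t))"

lemma eval_mk_rat [simp]:
  assumes "is_num (eval e a)" "is_num (eval e b)" "is_num (eval e c)"
  shows "is_num (eval e (mk_rat a b c))"
    "rat_eval e (mk_rat a b c) =
      (real (the_num (eval e a)) - real (the_num (eval e b))) / real (Suc (the_num (eval e c)))"
  using assms by (simp_all add: mk_rat_def rat_val_def)

lemma eval_parts [simp]:
  assumes "is_num (eval e q)"
  shows "is_num (eval e (pos_part q))" "the_num (eval e (pos_part q)) = p1_val (the_num (eval e q))"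
    and "is_num (eval e (neg_part q))" "the_num (eval e (neg_part q)) = p1_val (p2_val (the_num (eval e q)))"
    and "is_num (eval e (denom q))" "the_num (eval e (denom q)) = Suc (p2_val (p2_val (the_num (eval e q))))"
  using assms by (simp_all add: pos_part_def neg_part_def denom_def)

lemma sat_Less: "is_num (eval e t) \<Longrightarrow> is_num (eval e u) \<Longrightarrow>
    sat A e (t \<prec> u) \<longleftrightarrow> the_num (eval e t) < the_num (eval e u)"
  by (auto simp: is_num_def)

lemma sat_rat_less [simp]:
  assumes "is_num (eval e q)" "is_num (eval e r)"
  shows "sat A e (q <\<^sub>Q r) \<longleftrightarrow> rat_eval e q < rat_eval e r"
proof -
  define a b c where "a = p1_val (the_num (eval e q))" "b = p1_val (p2_val (the_num (eval e q)))" "c = Suc (p2_val (p2_val (the_num (eval e q))))"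
  define a' b' c' where "a' = p1_val (the_num (eval e r))" "b' = p1_val (p2_val (the_num (eval e r)))" "c' = Suc (p2_val (p2_val (the_num (eval e r))))"
  note d = a_b_c_def a'_b'_c'_def
  have pos: "real c > 0" "real c' > 0" by (simp_all add: d)
  have "sat A e (q <\<^sub>Q r) \<longleftrightarrow> a * c' + b' * c < a' * c + b * c'"
    unfolding rat_less_def using assms by (subst sat_Less) (simp_all add: d)
  also have "\<dots> \<longleftrightarrow> real (a * c' + b' * c) < real (a' * c + b * c')" by (simp only: of_nat_less_iff)
  also have "\<dots> \<longleftrightarrow> (real a - real b) * real c' < (real a' - real b') * real c"
    by (simp add: algebra_simps)
  also have "\<dots> \<longleftrightarrow> (real a - real b) / real c < (real a' - real b') / real c'"
    using pos by (simp add: field_simps)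
  finally show ?thesis by (simp add: rat_val_def d)
qed

lemma sat_rat_le [simp]:
  assumes "is_num (eval e q)" "is_num (eval e r)"
  shows "sat A e (q \<le>\<^sub>Q r) \<longleftrightarrow> rat_eval e q \<le> rat_eval e r"
  using assms by (auto simp: rat_le_def)

lemma eval_rat_add [simp]:
  assumes "is_num (eval e q)" "is_num (eval e r)"
  shows "is_num (eval e (q +\<^sub>Q r))" "rat_eval e (q +\<^sub>Q r) = rat_eval e q + rat_eval e r"
proof -
  show "is_num (eval e (q +\<^sub>Q r))" using assms by (simp add: rat_add_def)
  have 1: "real (Suc (Suc a * Suc b - Suc 0)) = real (Suc a) * real (Suc b)" for a b
    by (simp del: of_nat_Suc mult_Suc mult_Suc_right add: Suc_diff_Suc flip: of_nat_mult)
  show "rat_eval e (q +\<^sub>Q r) = rat_eval e q + rat_eval e r"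
    using assms unfolding rat_add_def
    by (simp add: 1 del: of_nat_Suc mult_Suc mult_Suc_right) (simp add: rat_val_def add_frac_eq algebra_simps)
qed

lemma eval_rat_neg [simp]:
  assumes "is_num (eval e q)"
  shows "is_num (eval e (rat_neg q))" "rat_eval e (rat_neg q) = - rat_eval e q"
proof -
  show "is_num (eval e (rat_neg q))" using assms by (simp add: rat_neg_def)
  have "rat_eval e (rat_neg q) = (real (p1_val (p2_val (the_num (eval e q)))) - real (p1_val (the_num (eval e q))))
      / real (Suc (p2_val (p2_val (the_num (eval e q)))))"
    using assms by (simp add: rat_neg_def)
  also have "\<dots> = - rat_eval e q" by (simp add: rat_val_def minus_divide_left)
  finally show "rat_eval e (rat_neg q) = - rat_eval e q" .
qed

lemma eval_rat_diff [simp]: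
  assumes "is_num (eval e q)" "is_num (eval e r)"
  shows "is_num (eval e (q -\<^sub>Q r))" "rat_eval e (q -\<^sub>Q r) = rat_eval e q - rat_eval e r"
  using assms by (simp_all add: rat_diff_def)

lemma eval_rat_abs [simp]:
  assumes "is_num (eval e q)"
  shows "is_num (eval e (rat_abs q))" "rat_eval e (rat_abs q) = \<bar>rat_eval e q\<bar>"
proof -
  show "is_num (eval e (rat_abs q))" using assms by (simp add: rat_abs_def)
  have "real (a - b) + real (b - a) = \<bar>real a - real b\<bar>" for a b :: nat by linarith
  then have "rat_eval e (rat_abs q) = \<bar>real (p1_val (the_num (eval e q))) - real (p1_val (p2_val (the_num (eval e q))))\<bar>
      / real (Suc (p2_val (p2_val (the_num (eval e q)))))"
    using assms by (simp add: rat_abs_def)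
  also have "\<dots> = \<bar>rat_eval e q\<bar>" by (simp add: rat_val_def abs_divide)
  finally show "rat_eval e (rat_abs q) = \<bar>rat_eval e q\<bar>" .
qed

definition half :: "nat \<Rightarrow> real" where "half n = (1/2) ^ n"

lemma half_Suc: "half (Suc n) = half n / 2" and half_pos: "half n > 0"
  by (simp_all add: half_def)

lemma eval_half_pow [simp]:
  assumes "is_num (eval e t)"
  shows "is_num (eval e (half_pow t))" "rat_eval e (half_pow t) = half (the_num (eval e t))"
proof -
  show "is_num (eval e (half_pow t))" using assms by (simp add: half_pow_def)
  have "real (Suc (2 ^ n - Suc 0)) = 2 ^ n" for n by (simp add: of_nat_diff)
  then show "rat_eval e (half_pow t) = half (the_num (eval e t))"
    using assms by (simp add: half_pow_def half_def power_one_over del: of_nat_Suc)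
qed

lemma eval_rat_consts [simp]:
  "is_num (eval e rat_zero)" "rat_eval e rat_zero = 0" "is_num (eval e rat_one)" "rat_eval e rat_one = 1"
  by (simp_all add: rat_zero_def rat_one_def)


section \<open>Fast Cauchy sequences and their limits\<close>

definition conv :: "(nat \<Rightarrow> nat) \<Rightarrow> real \<Rightarrow> bool" where
  "conv f L \<longleftrightarrow> (\<forall>n. \<bar>rat_val (f n) - L\<bar> \<le> half n)"

definition fast :: "(nat \<Rightarrow> nat) \<Rightarrow> bool" where
  "fast f \<longleftrightarrow> (\<forall>n i. \<bar>rat_val (f n) - rat_val (f (n + i))\<bar> < half n)"

text \<open>Sequences that are not fast get a value too, so the image of a level may contain
  spurious reals. The new points avoid these as well, which is possible since the image stays
  countable.\<close>

definition real_val :: "(nat \<Rightarrow> nat) \<Rightarrow> real" where "real_val f = lim (\<lambda>n. rat_val (f n))"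

text \<open>The factor 4 pays for two approximation errors of \<open>half n\<close> and the slack
  \<open>2 * half n\<close> in the order and equality of reals.\<close>

lemma half_small:
  fixes x :: real
  assumes "x > 0"
  obtains n where "4 * half n < x"
  using real_arch_pow_inv[of "x / 4" "1/2"] assms by (auto simp: half_def field_simps)

lemma conv_unique:
  assumes "conv f L" "conv f M"
  shows "L = M"
proof (rule ccontr)
  assume "L \<noteq> M"
  then obtain n where "4 * half n < \<bar>L - M\<bar>" using half_small[of "\<bar>L - M\<bar>"] by auto
  moreover have "\<bar>rat_val (f n) - L\<bar> \<le> half n" "\<bar>rat_val (f n) - M\<bar> \<le> half n"
    using assms unfolding conv_def by blast+
  ultimately show False by linarith
qed

lemma conv_real_val:
  assumes "fast f"
  shows "conv f (real_val f)"
proof -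
  have "Cauchy (\<lambda>n. rat_val (f n))"
  proof (rule metric_CauchyI)
    fix e :: real assume "e > 0"
    then obtain M where M: "4 * half M < e" using half_small by blast
    have *: "\<bar>rat_val (f M) - rat_val (f n)\<bar> < half M" if "n \<ge> M" for n
      using assms[unfolded fast_def, rule_format, of M "n - M"] that by simp
    have "dist (rat_val (f m)) (rat_val (f n)) < e" if "m \<ge> M" "n \<ge> M" for m n
      using *[OF that(1)] *[OF that(2)] M unfolding dist_real_def by linarith
    then show "\<exists>M. \<forall>m\<ge>M. \<forall>n\<ge>M. dist (rat_val (f m)) (rat_val (f n)) < e" by blast
  qed
  then have lim: "(\<lambda>n. rat_val (f n)) \<longlonglongrightarrow> real_val f"
    unfolding real_val_def using Cauchy_convergent convergent_LIMSEQ_iff by blast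
  show ?thesis unfolding conv_def
  proof
    fix n
    have "(\<lambda>i. \<bar>rat_val (f n) - rat_val (f (i + n))\<bar>) \<longlonglongrightarrow> \<bar>rat_val (f n) - real_val f\<bar>"
      by (intro tendsto_intros LIMSEQ_ignore_initial_segment[OF lim])
    then show "\<bar>rat_val (f n) - real_val f\<bar> \<le> half n"
      by (rule LIMSEQ_le_const2)
        (use assms[unfolded fast_def, rule_format, of n] in \<open>auto simp: add.commute less_imp_le\<close>)
  qed
qed

lemma fast_const: "fast (\<lambda>_. q)"
  by (simp add: fast_def half_pos)

lemma conv_const: "conv (\<lambda>_. q) (rat_val q)"
  by (simp add: conv_def half_pos less_imp_le)

lemma conv_less:
  assumes "conv f L" "conv g M"
  shows "(\<exists>n. rat_val (f n) + 2 * half n < rat_val (g n)) \<longleftrightarrow> L < M"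
proof
  assume "\<exists>n. rat_val (f n) + 2 * half n < rat_val (g n)"
  then obtain n where "rat_val (f n) + 2 * half n < rat_val (g n)" ..
  moreover have "\<bar>rat_val (f n) - L\<bar> \<le> half n" "\<bar>rat_val (g n) - M\<bar> \<le> half n"
    using assms unfolding conv_def by blast+
  ultimately show "L < M" by linarith
next
  assume "L < M"
  then obtain n where "4 * half n < M - L" using half_small[of "M - L"] by auto
  moreover have "\<bar>rat_val (f n) - L\<bar> \<le> half n" "\<bar>rat_val (g n) - M\<bar> \<le> half n"
    using assms unfolding conv_def by blast+
  ultimately have "rat_val (f n) + 2 * half n < rat_val (g n)" by linarith
  then show "\<exists>n. rat_val (f n) + 2 * half n < rat_val (g n)" ..
qed

lemma conv_eq:
  assumes "conv f L" "conv g M"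
  shows "(\<forall>n. \<bar>rat_val (f n) - rat_val (g n)\<bar> \<le> 2 * half n) \<longleftrightarrow> L = M"
proof
  assume *: "\<forall>n. \<bar>rat_val (f n) - rat_val (g n)\<bar> \<le> 2 * half n"
  show "L = M"
  proof (rule ccontr)
    assume "L \<noteq> M"
    then obtain n where "4 * half n < \<bar>L - M\<bar>" using half_small[of "\<bar>L - M\<bar>"] by auto
    moreover have "\<bar>rat_val (f n) - L\<bar> \<le> half n" "\<bar>rat_val (g n) - M\<bar> \<le> half n"
      using assms unfolding conv_def by blast+
    ultimately show False using *[rule_format, of n] by linarith
  qed
next
  assume "L = M"
  show "\<forall>n. \<bar>rat_val (f n) - rat_val (g n)\<bar> \<le> 2 * half n"
  proof
    fix n
    have "\<bar>rat_val (f n) - L\<bar> \<le> half n" "\<bar>rat_val (g n) - M\<bar> \<le> half n"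
      using assms unfolding conv_def by blast+
    then show "\<bar>rat_val (f n) - rat_val (g n)\<bar> \<le> 2 * half n" using \<open>L = M\<close> by linarith
  qed
qed

lemma represents_rat_real: "is_num (eval e q) \<Longrightarrow> represents (eval e (rat_real q)) (\<lambda>_. the_num (eval e q))"
  using is_num_eq by (simp add: represents_def rat_real_def app_K)

text \<open>Comparisons need \<open>conv\<close> only, so the distance is not shown to be
  fast.\<close>

lemma real_dist_conv:
  assumes x: "represents (eval e x) f" and y: "represents (eval e y) g" and "conv f L" "conv g M"
  obtains h where "represents (eval e (real_dist x y)) h" "conv h \<bar>L - M\<bar>"
proof -
  let ?t = "rat_abs (Var (0, One) \<cdot> suc (Var (0, N)) -\<^sub>Q Var (1, One) \<cdot> suc (Var (0, N)))"
  define e' where "e' n = e((0, One) := eval e x, (1, One) := eval e y, (0, N) := num n)" for n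
  have "app (eval e (real_dist x y)) (num n) = eval (e' n) ?t" for n
    by (simp add: real_dist_def eval_lam e'_def)
  moreover have "is_num (eval (e' n) (Var (0, One) \<cdot> suc (Var (0, N))))"
    "the_num (eval (e' n) (Var (0, One) \<cdot> suc (Var (0, N)))) = f (Suc n)"
    "is_num (eval (e' n) (Var (1, One) \<cdot> suc (Var (0, N))))"
    "the_num (eval (e' n) (Var (1, One) \<cdot> suc (Var (0, N)))) = g (Suc n)" for n
    by (simp_all add: e'_def app_rep1 represents_app[OF x] represents_app[OF y])
  ultimately have t: "is_num (app (eval e (real_dist x y)) (num n))"
    "rat_val (the_num (app (eval e (real_dist x y)) (num n))) = \<bar>rat_val (f (Suc n)) - rat_val (g (Suc n))\<bar>" for n
    by (simp_all del: eval.simps)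
  define h where "h n = the_num (app (eval e (real_dist x y)) (num n))" for n
  have "represents (eval e (real_dist x y)) h"
    using is_num_eq[OF t(1)] by (simp add: represents_def h_def)
  moreover have "conv h \<bar>L - M\<bar>"
    unfolding conv_def
  proof
    fix n
    \<comment> \<open>The shift by one in \<open>real_dist\<close> lets the two errors add up to
      \<open>half n\<close>.\<close>
    have "\<bar>rat_val (f (Suc n)) - L\<bar> \<le> half (Suc n)" "\<bar>rat_val (g (Suc n)) - M\<bar> \<le> half (Suc n)"
      using assms(3,4) unfolding conv_def by blast+
    then show "\<bar>rat_val (h n) - \<bar>L - M\<bar>\<bar> \<le> half n"
      unfolding h_def t half_Suc by linarith
  qed
  ultimately show ?thesis by (rule that)
qed

section \<open>Formulas about real numbers in the model\<close>

context world
begin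

lemma sat_is_real:
  assumes "represents (eval e x) f"
  shows "sat A e (is_real x) \<longleftrightarrow> fast f"
proof -
  have "sat A (e((fresh x, N) := num n, (Suc (fresh x), N) := num i))
      (rat_abs (x \<cdot> Var (fresh x, N) -\<^sub>Q x \<cdot> (Var (fresh x, N) \<^bold>+ Var (Suc (fresh x), N))) <\<^sub>Q
        half_pow (Var (fresh x, N))) \<longleftrightarrow>
      \<bar>rat_val (f n) - rat_val (f (n + i))\<bar> < half n" for n i
    by (simp add: eval_fresh represents_app[OF assms] app_rep2)
  then show ?thesis by (auto simp: is_real_def Let_def fast_def simp del: fun_upd_apply)
qed

lemma sat_real_less:
  assumes "represents (eval e x) f" "represents (eval e y) g" "conv f L" "conv g M"
  shows "sat A e (x <\<^sub>R y) \<longleftrightarrow> L < M"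
proof -
  define z where "z = (max (fresh x) (fresh y), N)"
  have "sat A (e(z := num n)) (x \<cdot> Var z +\<^sub>Q (half_pow (Var z) +\<^sub>Q half_pow (Var z)) <\<^sub>Q y \<cdot> Var z) \<longleftrightarrow>
      rat_val (f n) + 2 * half n < rat_val (g n)" for n
    by (simp add: z_def eval_fresh represents_app[OF assms(1)] represents_app[OF assms(2)])
  then have "sat A e (x <\<^sub>R y) \<longleftrightarrow> (\<exists>n. rat_val (f n) + 2 * half n < rat_val (g n))"
    by (auto simp: real_less_def Let_def z_def simp del: fun_upd_apply)
  then show ?thesis using conv_less[OF assms(3,4)] by simp
qed

lemma sat_real_eq:
  assumes "represents (eval e x) f" "represents (eval e y) g" "conv f L" "conv g M"
  shows "sat A e (x =\<^sub>R y) \<longleftrightarrow> L = M"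
proof -
  define z where "z = (max (fresh x) (fresh y), N)"
  have "sat A (e(z := num n)) (rat_abs (x \<cdot> Var z -\<^sub>Q y \<cdot> Var z) \<le>\<^sub>Q half_pow (Var z) +\<^sub>Q half_pow (Var z)) \<longleftrightarrow>
      \<bar>rat_val (f n) - rat_val (g n)\<bar> \<le> 2 * half n" for n
    by (simp add: z_def eval_fresh represents_app[OF assms(1)] represents_app[OF assms(2)])
  then have "sat A e (x =\<^sub>R y) \<longleftrightarrow> (\<forall>n. \<bar>rat_val (f n) - rat_val (g n)\<bar> \<le> 2 * half n)"
    by (auto simp: real_eq_def Let_def z_def simp del: fun_upd_apply)
  then show ?thesis using conv_eq[OF assms(3,4)] by simp
qed

lemma sat_real_le:
  assumes "represents (eval e x) f" "represents (eval e y) g" "conv f L" "conv g M"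
  shows "sat A e (x \<le>\<^sub>R y) \<longleftrightarrow> L \<le> M"
  using sat_real_less[OF assms(2,1,4,3)] by (auto simp: real_le_def)

definition reals :: "(nat \<Rightarrow> nat) set" where "reals = {f. fast f \<and> (\<exists>k. f \<in> A k)}"

lemma sat_all_real:
  assumes "snd x = One"
  shows "sat A e (\<^bold>\<forall>x \<in> R. \<phi>) \<longleftrightarrow> (\<forall>f\<in>reals. \<forall>u. represents u f \<longrightarrow> sat A (e(x := u)) \<phi>)"
proof -
  have "sat A (e(x := u)) (is_real (Var x)) \<longleftrightarrow> fast f" if "represents u f" for u f
    using that by (intro sat_is_real) simp
  then show ?thesis unfolding all_real_def reals_def using assms
    by (simp add: elem_One del: fun_upd_apply) blast
qed

end

section \<open>A chain with a discrete closed set\<close>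

instance ty :: countable by countable_datatype
instance const :: countable by countable_datatype
instance tm :: countable by countable_datatype
instance fm :: countable by countable_datatype
instance base_op :: countable by countable_datatype

lemma rat_val_surj:
  assumes "x \<in> \<rat>"
  shows "\<exists>q. rat_val q = x"
proof -
  obtain a b :: int where ab: "b > 0" "x = of_int a / of_int b"
    using assms by (rule Rats_cases') 
  have "rat_val (pair_val (nat a) (pair_val (nat (- a)) (nat b - 1))) = x"
    using ab by (auto simp: rat_val_def of_nat_diff nat_le_eq_zle of_nat_nat)
  then show ?thesis ..
qed

definition code :: "real \<Rightarrow> nat" where "code x = (SOME q. rat_val q = x)"

lemma rat_val_code: "x \<in> \<rat> \<Longrightarrow> rat_val (code x) = x"
  unfolding code_def by (rule someI_ex) (rule rat_val_surj)

lemma half_antimono: "m \<le> n \<Longrightarrow> half n \<le> half m"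
  by (simp add: half_def power_decreasing)

lemma half_Rats: "half n \<in> \<rat>"
  by (simp add: half_def)

lemma ex_fast: "\<exists>f. fast f \<and> real_val f = x"
proof -
  \<comment> \<open>Half of the permitted error, since two approximations get compared.\<close>
  have "\<exists>q. \<bar>rat_val q - x\<bar> < half (Suc n)" for n
  proof -
    obtain p where "p \<in> \<rat>" "x - half (Suc n) < p" "p < x"
      using Rats_dense_in_real[of "x - half (Suc n)" x] half_pos[of "Suc n"] by auto
    then show ?thesis using rat_val_code[of p] by (intro exI[of _ "code p"]) auto
  qed
  then obtain f where f: "\<And>n. \<bar>rat_val (f n) - x\<bar> < half (Suc n)" by metis
  have "fast f" unfolding fast_def
  proof (intro allI)
    fix n i
    have "half (Suc (n + i)) \<le> half (Suc n)" by (rule half_antimono) simp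
    then show "\<bar>rat_val (f n) - rat_val (f (n + i))\<bar> < half n"
      using f[of n] f[of "n + i"] half_Suc[of n] by linarith
  qed
  moreover have "conv f x" unfolding conv_def
  proof
    fix n
    show "\<bar>rat_val (f n) - x\<bar> \<le> half n" using f[of n] half_Suc[of n] half_pos[of n] by linarith
  qed
  ultimately show ?thesis using conv_unique conv_real_val by blast
qed

section \<open>An open set of small measure around the rationals\<close>

definition left_end :: "nat \<Rightarrow> real" where "left_end n = of_rat (from_nat n) - half (n + 3)"
definition right_end :: "nat \<Rightarrow> real" where "right_end n = of_rat (from_nat n) + half (n + 3)"
text \<open>The exponent \<open>n + 3\<close> gives the \<open>n\<close>-th interval the length 1/4
  times 1/2 to the power \<open>n\<close>, in total 1/2. Rational ends allow each of them to be
  given as a constant sequence of codes.\<close>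

definition cover :: "real set" where "cover = (\<Union>n. {left_end n<..<right_end n})"

lemma ends_Rats: "left_end n \<in> \<rat>" "right_end n \<in> \<rat>"
  by (simp_all add: left_end_def right_end_def half_Rats)

lemma Rats_cover: "\<rat> \<subseteq> cover"
proof
  fix x :: real assume "x \<in> \<rat>"
  then obtain q where "x = of_rat q" by (rule Rats_cases)
  then show "x \<in> cover"
    unfolding cover_def left_end_def right_end_def
    by (intro UN_I[of "to_nat q"]) (simp_all add: half_pos)
qed

lemma open_cover: "open cover"
  by (auto simp: cover_def)

text \<open>\<open>cover\<close> has measure at most 1/2 and the countable set measure 0, which is
  too little for the unit interval.\<close>

lemma ex_uncovered:
  assumes "countable S"
  shows "\<exists>z. 0 \<le> z \<and> z \<le> 1 \<and> z \<notin> cover \<and> z \<notin> S"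
proof (rule ccontr)
  assume "\<not> ?thesis"
  then have sub: "{0..1} \<subseteq> cover \<union> S" by auto
  have S: "emeasure lborel S = 0" "S \<in> sets lborel"
    by (rule null_setsD1[OF countable_imp_null_set_lborel[OF assms]],
      rule null_setsD2[OF countable_imp_null_set_lborel[OF assms]])
  have C: "cover \<in> sets lborel" using open_cover by simp
  have "emeasure lborel cover \<le> (\<Sum>n. emeasure lborel {left_end n<..<right_end n})"
    unfolding cover_def by (rule emeasure_subadditive_countably) auto
  also have "\<dots> = (\<Sum>n. ennreal ((1/4) * (1/2) ^ n))"
  proof (rule arg_cong[where f = suminf], rule ext)
    fix n
    have "left_end n \<le> right_end n" "right_end n - left_end n = (1/4) * (1/2) ^ n"
      using half_pos[of "n + 3"] by (simp_all add: left_end_def right_end_def half_def power_add power3_eq_cube)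
    then show "emeasure lborel {left_end n<..<right_end n} = ennreal ((1/4) * (1/2) ^ n)" by simp
  qed
  also have "\<dots> = ennreal (1/2)"
  proof (rule suminf_ennreal_eq)
    have "(\<lambda>n. (1/4) * (1/2) ^ n :: real) sums (1/4 * (1 / (1 - 1/2)))"
      by (intro sums_mult geometric_sums) simp
    then show "(\<lambda>n. (1/4) * (1/2) ^ n :: real) sums (1/2)" by simp
  qed simp
  finally have "emeasure lborel cover \<le> ennreal (1/2)" .
  moreover have "emeasure lborel {0..1::real} \<le> emeasure lborel (cover \<union> S)"
    using sub S C by (intro emeasure_mono) auto
  moreover have "emeasure lborel (cover \<union> S) \<le> emeasure lborel cover + emeasure lborel S"
    using S C by (intro emeasure_subadditive) auto
  ultimately have "ennreal 1 \<le> ennreal (1/2)" using S by simp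
  then show False by (subst (asm) ennreal_le_iff) simp_all
qed

section \<open>The closure operations and the tower of levels\<close>

datatype closure_op = Base base_op | OUpd var | OSkolem fm var | OTruth fm | OSame | OLeft | ORight

instance closure_op :: countable by countable_datatype

text \<open>Picks the members of a sequence that represent one given real. Later, finitely many such
  tests decide membership in the bad set along a sequence.\<close>

definition same_real :: "(nat \<Rightarrow> nat) \<Rightarrow> (nat \<Rightarrow> nat) \<Rightarrow> nat \<Rightarrow> nat" where
  "same_real F g n = of_bool (\<not> (fast (\<lambda>m. F (npair n m)) \<and> real_val (\<lambda>m. F (npair n m)) = real_val g))"

fun closure_op_fun :: "closure_op \<Rightarrow> (nat \<Rightarrow> nat) \<Rightarrow> (nat \<Rightarrow> nat) \<Rightarrow> nat \<Rightarrow> nat" where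
  "closure_op_fun (Base i) f g = base_op_fun i f g"
| "closure_op_fun (OUpd v) f g = upd v f g"
| "closure_op_fun (OSkolem \<phi> v) f g = skolem \<phi> v f"
| "closure_op_fun (OTruth \<phi>) f g = truth \<phi> f"
| "closure_op_fun OSame f g = same_real f g"
| "closure_op_fun OLeft f g = (\<lambda>n. code (left_end n))"
| "closure_op_fun ORight f g = (\<lambda>n. code (right_end n))"

text \<open>The zero function makes even the closure of the empty set nonempty, as
  \<open>clone\<close> demands; applied to it, \<open>OLeft\<close> and \<open>ORight\<close>
  produce the ends of the intervals.\<close>

fun level :: "(nat \<Rightarrow> nat) set \<Rightarrow> nat \<Rightarrow> (nat \<Rightarrow> nat) set" where
  "level X 0 = insert (\<lambda>_. 0) X"
| "level X (Suc n) = level X n \<union> (\<lambda>(i, f, g). closure_op_fun i f g) ` (UNIV \<times> level X n \<times> level X n)"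

definition op_closure :: "(nat \<Rightarrow> nat) set \<Rightarrow> (nat \<Rightarrow> nat) set" where
  "op_closure X = (\<Union>n. level X n)"

lemma level_mono: "m \<le> n \<Longrightarrow> level X m \<subseteq> level X n"
  by (rule lift_Suc_mono_le[of "level X"]) auto

lemma op_closure_closed:
  assumes "f \<in> op_closure X" "g \<in> op_closure X"
  shows "closure_op_fun i f g \<in> op_closure X"
proof -
  obtain m n where "f \<in> level X m" "g \<in> level X n" using assms unfolding op_closure_def by blast
  then have "f \<in> level X (max m n)" "g \<in> level X (max m n)"
    using level_mono[of m "max m n"] level_mono[of n "max m n"] by auto
  then have "closure_op_fun i f g \<in> level X (Suc (max m n))" by force
  then show ?thesis unfolding op_closure_def by blast
qed

lemma op_closure_superset: "insert (\<lambda>_. 0) X \<subseteq> op_closure X"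
  using UN_upper[of 0 UNIV "level X"] unfolding op_closure_def by simp

lemma countable_op_closure: "countable X \<Longrightarrow> countable (op_closure X)"
proof -
  assume "countable X"
  then have "countable (level X n)" for n by (induction n) auto
  then show ?thesis unfolding op_closure_def by blast
qed

text \<open>The limit \<open>z\<close> must avoid all levels, while the levels depend on the rationals \<open>q\<close> chosen near \<open>z\<close>.
  Therefore levels are built for all finite sequences of rationals; these are still countably many
  countable sets, and \<open>z\<close> is chosen outside of all of them.\<close>

definition new_point :: "rat \<Rightarrow> nat \<Rightarrow> (nat \<Rightarrow> nat) set \<Rightarrow> (nat \<Rightarrow> nat) \<Rightarrow> bool" where
  "new_point q n X f \<longleftrightarrow> fast f \<and> \<bar>real_val f - of_rat q\<bar> < half n \<and> real_val f \<in> cover \<and>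
    0 < real_val f \<and> real_val f < 1 \<and> real_val f \<notin> real_val ` X"

text \<open>The open set in question contains \<open>of_rat q\<close>, because \<open>cover\<close>
  contains all rationals, and a nonempty open set of reals is not exhausted by a countable
  set.\<close>

lemma ex_new_point:
  assumes "countable X" "0 < q" "q < 1"
  shows "\<exists>f. new_point q n X f"
proof -
  let ?S = "cover \<inter> {0<..<1} \<inter> {of_rat q - half n<..<of_rat q + half n}"
  have "of_rat q \<in> ?S"
    using assms(2,3) Rats_cover half_pos[of n] by auto
  moreover have "open ?S" by (intro open_Int open_cover open_greaterThanLessThan)
  moreover have "countable (real_val ` X)" using assms(1) by simp
  ultimately obtain x where x: "x \<in> ?S" "x \<notin> real_val ` X"
    using open_minus_countable[of "real_val ` X" ?S] by blast
  obtain f where "fast f" "real_val f = x" using ex_fast by blast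
  with x show ?thesis unfolding new_point_def by (intro exI[of _ f]) auto
qed

fun tower :: "rat list \<Rightarrow> (nat \<Rightarrow> nat) set" where
  "tower [] = op_closure {}"
| "tower (q # s) = op_closure (insert (SOME f. new_point q (length s) (tower s) f) (tower s))"

lemma countable_tower: "countable (tower s)"
  by (induction s) (auto intro: countable_op_closure)

lemma tower_closed: "f \<in> tower s \<Longrightarrow> g \<in> tower s \<Longrightarrow> closure_op_fun i f g \<in> tower s"
  by (cases s) (simp_all add: op_closure_closed)

lemma zero_in_tower: "(\<lambda>_. 0) \<in> tower s"
  by (cases s) (auto intro: subsetD[OF op_closure_superset])

text \<open>\<open>r_new\<close> excludes the real and not merely the function \<open>r k\<close>:
  another representative of it in \<open>A k\<close> would equally put the point on too early a
  level.\<close>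

locale counter_model = elementary A for A +
  fixes r :: "nat \<Rightarrow> nat \<Rightarrow> nat" and z :: real
  assumes same_closed: "f \<in> A k \<Longrightarrow> g \<in> A k \<Longrightarrow> same_real f g \<in> A k"
    and left_end_in: "(\<lambda>n. code (left_end n)) \<in> A k" and right_end_in: "(\<lambda>n. code (right_end n)) \<in> A k"
    and r_in: "r k \<in> A (Suc k)" and r_fast: "fast (r k)" and r_new: "real_val (r k) \<notin> real_val ` A k"
    and r_cover: "real_val (r k) \<in> cover" and r_unit: "0 < real_val (r k)" "real_val (r k) < 1"
    and r_lim: "(\<lambda>k. real_val (r k)) \<longlonglongrightarrow> z"
    and z_cover: "z \<notin> cover" and z_new: "z \<notin> real_val ` A k"

lemma ex_counter_model: "\<exists>A r z. counter_model A r z"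
proof -
  have "countable (real_val ` (\<Union>s. tower s))" by (simp add: countable_tower)
  from ex_uncovered[OF this] obtain z where
    z: "0 \<le> z" "z \<le> 1" "z \<notin> cover" "z \<notin> real_val ` (\<Union>s. tower s)"
    by (elim exE conjE)
  have "z \<noteq> 0" "z \<noteq> 1" using z(3) Rats_cover by (auto dest: subsetD)
  then have z01: "0 < z" "z < 1" using z by auto
  \<comment> \<open>Rationals close to \<open>z\<close> are selected only now that \<open>z\<close>
    avoids the towers over all lists; they lie strictly between 0 and 1 so that
    \<open>ex_new_point\<close> applies.\<close>
  have "\<exists>q. 0 < q \<and> q < 1 \<and> \<bar>of_rat q - z\<bar> < half j" for j
  proof -
    obtain q where q: "max 0 (z - half j) < of_rat q" "of_rat q < z"
      using of_rat_dense[of "max 0 (z - half j)" z] z01 half_pos[of j] by auto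
    then have "real_of_rat q < 1" using z01 by linarith
    with q show ?thesis by (intro exI[of _ q]) auto
  qed
  then obtain qs where "\<forall>j. 0 < qs j \<and> qs j < 1 \<and> \<bar>real_of_rat (qs j) - z\<bar> < half j"
    using choice[of "\<lambda>j q. 0 < q \<and> q < 1 \<and> \<bar>real_of_rat q - z\<bar> < half j"] by blast
  then have qs: "0 < qs j" "qs j < 1" "\<bar>real_of_rat (qs j) - z\<bar> < half j" for j by simp_all
  define s where "s j = rev (map qs [0..<j])" for j
  have s: "s (Suc j) = qs j # s j" "length (s j) = j" for j by (simp_all add: s_def)
  define A where "A j = tower (s j)" for j
  define r where "r j = (SOME f. new_point (qs j) j (A j) f)" for j
  have r: "new_point (qs j) j (A j) (r j)" for j
    unfolding r_def A_def by (rule someI_ex[OF ex_new_point[OF countable_tower qs(1,2)]])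
  have A_Suc: "A (Suc j) = op_closure (insert (r j) (A j))" for j
    by (simp add: A_def s r_def)
  have A_sub: "insert (r j) (A j) \<subseteq> A (Suc j)" for j
    using op_closure_superset[of "insert (r j) (A j)"] by (simp add: A_Suc)
  have closed: "closure_op_fun i f g \<in> A k" if "f \<in> A k" "g \<in> A k" for i f g k
    using that tower_closed by (simp add: A_def)
  have zero: "(\<lambda>_. 0) \<in> A k" for k by (simp add: A_def zero_in_tower)
  have "counter_model A r z"
  proof
    show "A j \<subseteq> A k" if "j \<le> k" for j k
      by (rule lift_Suc_mono_le[of A, OF _ that]) (use A_sub in auto)
    show "clone (A k)" for k
      unfolding clone_def
    proof (intro conjI allI ballI)
      show "A k \<noteq> {}" using zero by blast
      show "base_op_fun i f g \<in> A k" if "f \<in> A k" "g \<in> A k" for i f g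
        using closed[OF that, of "Base i"] by simp
    qed
    show "upd v f g \<in> A k" if "f \<in> A k" "g \<in> A k" for v f g k
      using closed[OF that, of "OUpd v"] by simp
    show "skolem \<phi> v f \<in> A k" if "f \<in> A k" for \<phi> v f k
      using closed[OF that that, of "OSkolem \<phi> v"] by simp
    show "truth \<phi> f \<in> A k" if "f \<in> A k" for \<phi> f k
      using closed[OF that that, of "OTruth \<phi>"] by simp
    show "same_real f g \<in> A k" if "f \<in> A k" "g \<in> A k" for f g k
      using closed[OF that, of OSame] by simp
    show "(\<lambda>n. code (left_end n)) \<in> A k" "(\<lambda>n. code (right_end n)) \<in> A k" for k
      using closed[OF zero[of k] zero[of k], of OLeft] closed[OF zero[of k] zero[of k], of ORight] by simp_all
    show "r k \<in> A (Suc k)" for k using A_sub[of k] by simp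
    show "fast (r k)" "real_val (r k) \<notin> real_val ` A k" "real_val (r k) \<in> cover" "0 < real_val (r k)" "real_val (r k) < 1" for k
      using r[of k] unfolding new_point_def by auto
    show "z \<notin> cover" by (rule z(3))
    show "z \<notin> real_val ` A k" for k using z(4) unfolding A_def by blast
    show "(\<lambda>k. real_val (r k)) \<longlonglongrightarrow> z"
    proof (rule LIMSEQ_I)
      fix e :: real assume "e > 0"
      then obtain M where M: "4 * half M < e" by (rule half_small)
      have "norm (real_val (r n) - z) < e" if "n \<ge> M" for n
      proof -
        have "\<bar>real_val (r n) - of_rat (qs n)\<bar> < half n" using r[of n] unfolding new_point_def by blast
        then show ?thesis
          using qs(3)[of n] M half_antimono[OF that] half_pos[of M] unfolding real_norm_def by linarith
      qed
      then show "\<exists>M. \<forall>n\<ge>M. norm (real_val (r n) - z) < e" by blast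
    qed
  qed
  then show ?thesis by blast
qed

section \<open>Failure of \<open>HBC\<close>\<close>

definition zero_code :: nat where "zero_code = pair_val 0 (pair_val 0 0)"
definition one_code :: nat where "one_code = pair_val 1 (pair_val 0 0)"

lemma rat_val_codes [simp]: "rat_val zero_code = 0" "rat_val one_code = 1"
  by (simp_all add: rat_val_def zero_code_def one_code_def)

context counter_model
begin

definition points :: "real set" where "points = range (\<lambda>k. real_val (r k))"

definition chi :: "(nat \<Rightarrow> nat) \<Rightarrow> nat" where
  "chi f = (if fast f \<and> real_val f \<in> points then one_code else zero_code)"

text \<open>The \<open>i\<close>-th point avoids the reals of \<open>A i\<close>, and for
  \<open>i \<ge> j\<close> these include the reals of \<open>A j\<close>.\<close>

lemma points_below:
  assumes "f \<in> A j"
  shows "real_val f \<in> points \<longleftrightarrow> (\<exists>i<j. real_val f = real_val (r i))"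
proof
  assume "real_val f \<in> points"
  then obtain i where i: "real_val f = real_val (r i)" unfolding points_def by blast
  have "i < j"
  proof (rule ccontr)
    assume "\<not> i < j"
    then have "f \<in> A i" using assms A_mono[of j i] by auto
    then have "real_val f \<in> real_val ` A i" by (rule imageI)
    with i r_new[of i] show False by simp
  qed
  with i show "\<exists>i<j. real_val f = real_val (r i)" by blast
qed (auto simp: points_def)

text \<open>By \<open>points_below\<close>, membership on level \<open>j\<close> is a finite
  disjunction of tests \<open>same_real\<close> against the points \<open>r i\<close> with
  \<open>i < j\<close>, all of which lie in \<open>A j\<close>. The number of tests grows with
  \<open>j\<close>, but for each level it is fixed.\<close>

lemma chi_uniform:
  assumes "F \<in> A j"
  shows "(\<lambda>n. chi (\<lambda>m. F (npair n m))) \<in> A j"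
proof -
  let ?P = "\<lambda>i n. fast (\<lambda>m. F (npair n m)) \<and> real_val (\<lambda>m. F (npair n m)) = real_val (r i)"
  \<comment> \<open>Negation is implication of falsity, for which the constant 1 stands.\<close>
  have not_in: "(\<lambda>n. of_bool (P n)) \<in> A j" if "(\<lambda>n. of_bool (\<not> P n)) \<in> A j" for P :: "nat \<Rightarrow> bool"
    using A_imp[OF that A_const[of 1]] by simp
  have "(\<lambda>n. of_bool (\<not> (\<exists>i<l. ?P i n))) \<in> A j" if "l \<le> j" for l
    using that
  proof (induction l)
    case 0
    then show ?case using A_const[of 1 j] by simp
  next
    case (Suc l)
    have "r l \<in> A j" using r_in[of l] A_mono[OF Suc.prems] by blast
    from same_closed[OF assms this]
    have 1: "(\<lambda>n. of_bool (\<not> ?P l n)) \<in> A j" by (simp add: same_real_def[abs_def])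
    have 2: "(\<lambda>n. of_bool (\<not> (\<exists>i<l. ?P i n))) \<in> A j" using Suc by simp
    have "(\<lambda>n. of_bool (\<not> (of_bool (\<exists>i<l. ?P i n) = (0::nat) \<longrightarrow> of_bool (\<not> ?P l n) = (0::nat)))) \<in> A j"
      by (rule A_imp[OF not_in[OF 2] 1])
    moreover have "(of_bool (\<exists>i<l. ?P i n) = (0::nat) \<longrightarrow> of_bool (\<not> ?P l n) = (0::nat)) \<longleftrightarrow>
        (\<exists>i<Suc l. ?P i n)" for n
      by (auto simp: less_Suc_eq)
    ultimately show ?case by (simp only:)
  qed
  from this[of j] have out: "(\<lambda>n. of_bool (\<not> (\<exists>i<j. ?P i n))) \<in> A j" by simp
  have "chi (\<lambda>m. F (npair n m)) =
      one_code * of_bool (\<exists>i<j. ?P i n) + zero_code * of_bool (\<not> (\<exists>i<j. ?P i n))" for n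
  proof -
    have "(\<lambda>m. F (npair n m)) \<in> A j"
      by (rule A_comp[OF assms A_pair[OF A_const A_id]])
    from points_below[OF this] show ?thesis by (auto simp: chi_def)
  qed
  then show ?thesis
    using A_plus[OF A_times[OF A_const[of one_code] not_in[OF out]]
        A_times[OF A_const[of zero_code] out]] by simp
qed

text \<open>The value at a real is the constant sequence of a code of 0 or 1, which is fast.\<close>

definition chi_hat :: "tok set" where "chi_hat = repF1 (\<lambda>f m. chi f)"

lemma elem_chi_hat: "elem A (One \<rightarrow> One) chi_hat"
proof (rule ext_eqI, rule Rel_const_famI2)
  fix j x y x' y'
  assume "Rel A One j x y" "Rel A N j x' y'"
  then obtain F a where F: "F \<in> A j" "\<And>n. represents (x n) (\<lambda>m. F (npair n m))" "\<And>n. represents (y n) (\<lambda>m. F (npair n m))"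
    and a: "a \<in> A j" "x' = (\<lambda>n. num (a n))" "y' = (\<lambda>n. num (a n))"
    unfolding Rel_One by auto
  show "Rel A N j (\<lambda>n. app (app chi_hat (x n)) (x' n)) (\<lambda>n. app (app chi_hat (y n)) (y' n))"
    unfolding a chi_hat_def app_repF1[OF F(2)] app_repF1[OF F(3)] by (rule Rel_num[OF chi_uniform[OF F(1)]])
qed

lemma elem_rat_seq:
  assumes "f \<in> A 0"
  shows "elem A (N \<rightarrow> One) (rep2 (\<lambda>n m. f n))"
  by (rule ext_eqI[OF Rel_rep2[of _ 0]]) (rule A_comp[OF assms A_fst])

lemma represents_chi_hat: "represents u f \<Longrightarrow> represents (app chi_hat u) (\<lambda>_. chi f)"
  unfolding chi_hat_def by (subst represents_def) (simp add: app_repF1)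

lemma represents_rep2: "represents (app (rep2 (\<lambda>n m. f n)) (num n)) (\<lambda>_. f n)"
  by (simp add: represents_def app_rep2)

lemma sat_mem:
  assumes "eval e Y = chi_hat" "represents (eval e t) f" "fast f"
  shows "sat A e (t \<epsilon> Y) \<longleftrightarrow> real_val f \<in> points"
proof -
  have "sat A e (t \<epsilon> Y) \<longleftrightarrow> 0 < rat_val (chi f)"
    unfolding mem_def
    using sat_real_less[OF represents_rat_real[OF eval_rat_consts(1)] _ conv_const conv_const,
        of e "Y \<cdot> t" "chi f"] represents_chi_hat[OF assms(2)] assms(1) by simp
  then show ?thesis using assms(3) by (simp add: chi_def)
qed

lemma sat_real_function:
  assumes "eval e Y = chi_hat"
  shows "sat A e (real_function Y)"
proof -
  let ?x = "(fresh Y, One)" and ?y = "(Suc (fresh Y), One)"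
  have Y: "eval (e(?x := u)) Y = chi_hat" "eval (e(?x := u, ?y := v)) Y = chi_hat" for u v
    using assms by (simp_all add: eval_fresh)
  have 1: "sat A (e(?x := u)) (is_real (Y \<cdot> Var ?x))" if "represents u f" for u f
    using sat_is_real[of "e(?x := u)" "Y \<cdot> Var ?x" "\<lambda>_. chi f"] represents_chi_hat[OF that] Y fast_const by simp
  have 2: "sat A (e(?x := u, ?y := v)) (Var ?x =\<^sub>R Var ?y \<^bold>\<longrightarrow> Y \<cdot> Var ?x =\<^sub>R Y \<cdot> Var ?y)"
    if "represents u f" "represents v g" "f \<in> reals" "g \<in> reals" for u f v g
  proof -
    have fg: "fast f" "fast g" using that by (auto simp: reals_def)
    have "sat A (e(?x := u, ?y := v)) (Var ?x =\<^sub>R Var ?y) \<longleftrightarrow> real_val f = real_val g"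
      by (rule sat_real_eq[OF _ _ conv_real_val[OF fg(1)] conv_real_val[OF fg(2)]]) (simp_all add: that)
    moreover have "sat A (e(?x := u, ?y := v)) (Y \<cdot> Var ?x =\<^sub>R Y \<cdot> Var ?y) \<longleftrightarrow> rat_val (chi f) = rat_val (chi g)"
      by (rule sat_real_eq[OF _ _ conv_const conv_const]) (simp_all add: Y represents_chi_hat that del: fun_upd_apply, simp_all add: represents_chi_hat that)
    ultimately show ?thesis using fg by (simp add: chi_def)
  qed
  show ?thesis
    unfolding real_function_def Let_def
    by (simp add: sat_all_real 1 2 del: sat.simps fun_upd_apply)
qed

text \<open>The points together with their limit \<open>z\<close> form a compact set, and a real of
  the model is never \<open>z\<close>; so outside the points it has positive distance from all of
  them.\<close>

lemma points_separated:
  assumes "f \<in> reals" "real_val f \<notin> points"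
  shows "\<exists>q. rat_val q > 0 \<and> (\<forall>c\<in>points. rat_val q \<le> \<bar>real_val f - c\<bar>)"
proof -
  have "compact (insert z points)" unfolding points_def by (rule compact_sequence_with_limit[OF r_lim])
  then have "open (- insert z points)" using compact_imp_closed open_Compl by blast
  moreover have "real_val f \<in> - insert z points" using assms z_new by (force simp: reals_def)
  ultimately obtain d where d: "d > 0" "ball (real_val f) d \<subseteq> - insert z points"
    using open_contains_ball by blast
  obtain p where p: "p \<in> \<rat>" "0 < p" "p < d" using Rats_dense_in_real[OF d(1)] by blast
  have "p \<le> \<bar>real_val f - c\<bar>" if "c \<in> points" for c
  proof (rule ccontr)
    assume "\<not> p \<le> \<bar>real_val f - c\<bar>"
    then have "c \<in> ball (real_val f) d" using p(3) by (simp add: dist_real_def)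
    with d(2) that show False by blast
  qed
  then show ?thesis using p rat_val_code[OF p(1)] by (intro exI[of _ "code p"]) simp
qed

lemma sat_closed_set:
  assumes "eval e Y = chi_hat"
  shows "sat A e (closed_set Y)"
proof -
  let ?k = "fresh Y"
  let ?x = "(?k, One)" and ?y = "(Suc ?k, One)" and ?r = "(?k, N)"
  have Y: "eval (e(?x := u)) Y = chi_hat" "eval (e(?x := u, ?r := w, ?y := v)) Y = chi_hat" for u v w
    using assms by (simp_all add: eval_fresh)
  have "sat A (e(?x := u)) (\<^bold>\<not> Var ?x \<epsilon> Y \<^bold>\<longrightarrow>
          (\<^bold>\<exists>?r. rat_zero <\<^sub>Q Var ?r \<^bold>\<and>
             (\<^bold>\<forall>?y \<in> R. real_dist (Var ?x) (Var ?y) <\<^sub>R rat_real (Var ?r) \<^bold>\<longrightarrow> \<^bold>\<not> Var ?y \<epsilon> Y)))"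
    if f: "f \<in> reals" "represents u f" for f u
  proof -
    have ff: "fast f" using f by (simp add: reals_def)
    have "sat A (e(?x := u)) (Var ?x \<epsilon> Y) \<longleftrightarrow> real_val f \<in> points"
      by (rule sat_mem) (use Y f ff in auto)
    moreover have "sat A (e(?x := u)) (\<^bold>\<exists>?r. rat_zero <\<^sub>Q Var ?r \<^bold>\<and>
        (\<^bold>\<forall>?y \<in> R. real_dist (Var ?x) (Var ?y) <\<^sub>R rat_real (Var ?r) \<^bold>\<longrightarrow> \<^bold>\<not> Var ?y \<epsilon> Y))"
      if not_in_points: "real_val f \<notin> points"
    proof -
      obtain q where q: "rat_val q > 0" "\<And>c. c \<in> points \<Longrightarrow> rat_val q \<le> \<bar>real_val f - c\<bar>"
        using points_separated[OF f(1) not_in_points] by blast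
      have 1: "sat A (e(?x := u, ?r := num q)) (rat_zero <\<^sub>Q Var ?r)"
        using q(1) by simp
      have 2: "sat A (e(?x := u, ?r := num q, ?y := v))
          (real_dist (Var ?x) (Var ?y) <\<^sub>R rat_real (Var ?r) \<^bold>\<longrightarrow> \<^bold>\<not> Var ?y \<epsilon> Y)"
        if g: "g \<in> reals" "represents v g" for g v
      proof -
        let ?e = "e(?x := u, ?r := num q, ?y := v)"
        have fg: "fast g" using g by (simp add: reals_def)
        have xy: "represents (eval ?e (Var ?x)) f" "represents (eval ?e (Var ?y)) g" using f g by simp_all
        obtain h where h: "represents (eval ?e (real_dist (Var ?x) (Var ?y))) h" "conv h \<bar>real_val f - real_val g\<bar>"
          using real_dist_conv[OF xy conv_real_val[OF ff] conv_real_val[OF fg]] .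
        have "represents (eval ?e (rat_real (Var ?r))) (\<lambda>_. q)"
          using represents_rat_real[of ?e "Var ?r"] by simp
        from sat_real_less[OF h(1) this h(2) conv_const]
        have "sat A ?e (real_dist (Var ?x) (Var ?y) <\<^sub>R rat_real (Var ?r)) \<longleftrightarrow> \<bar>real_val f - real_val g\<bar> < rat_val q" .
        moreover have "sat A ?e (Var ?y \<epsilon> Y) \<longleftrightarrow> real_val g \<in> points"
          by (rule sat_mem[OF Y(2) xy(2) fg])
        ultimately show ?thesis using q(2)[of "real_val g"] by auto
      qed
      have "sat A (e(?x := u, ?r := num q))
          (\<^bold>\<forall>?y \<in> R. real_dist (Var ?x) (Var ?y) <\<^sub>R rat_real (Var ?r) \<^bold>\<longrightarrow> \<^bold>\<not> Var ?y \<epsilon> Y)"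
        by (subst sat_all_real) (use 2 in auto)
      with 1 show ?thesis by (auto simp del: fun_upd_apply)
    qed
    ultimately show ?thesis by (simp del: fun_upd_apply)
  qed
  then show ?thesis
    unfolding closed_set_def open_where_def Let_def by (subst sat_all_real) auto
qed

text \<open>The ends of an interval are rational and thus in \<open>cover\<close>, so
  \<open>z\<close> lies strictly outside the closed interval, and by convergence almost all points
  do. Finitely many such conditions hold together from some index on.\<close>

lemma no_finite_subcover: "\<exists>j. \<forall>n\<le>k. \<not> (left_end n < real_val (r j) \<and> real_val (r j) < right_end n)"
proof -
  have "\<forall>\<^sub>F j in sequentially. \<not> (left_end n < real_val (r j) \<and> real_val (r j) < right_end n)" for n
  proof -
    have "z \<noteq> left_end n" "z \<noteq> right_end n" using z_cover ends_Rats Rats_cover by blast+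
    moreover have "\<not> (left_end n < z \<and> z < right_end n)" using z_cover by (auto simp: cover_def)
    ultimately consider "z < left_end n" | "right_end n < z" by linarith
    then show ?thesis
    proof cases
      case 1
      from order_tendstoD(2)[OF r_lim this] show ?thesis by eventually_elim simp
    next
      case 2
      from order_tendstoD(1)[OF r_lim this] show ?thesis by eventually_elim simp
    qed
  qed
  then have "\<forall>\<^sub>F j in sequentially. \<forall>n\<in>{..k}. \<not> (left_end n < real_val (r j) \<and> real_val (r j) < right_end n)"
    by (intro eventually_ball_finite) auto
  then show ?thesis by (auto dest!: eventually_happens)
qed

lemma sat_AllD: "sat A e (\<^bold>\<forall>v. \<phi>) \<Longrightarrow> elem A (snd v) u \<Longrightarrow> sat A (e(v := u)) \<phi>"
  by simp

lemma not_sat_HBC: "\<not> sat A e HBC"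
proof
  assume HBC: "sat A e HBC"
  let ?C = "(0, One \<rightarrow> One)" and ?a = "(0, N \<rightarrow> One)" and ?b = "(1, N \<rightarrow> One)"
  let ?n = "(0, N)" and ?m = "(1, N)" and ?x = "(0, One)"
  let ?cov = "Var ?a \<cdot> Var ?n <\<^sub>R Var ?x \<^bold>\<and> Var ?x <\<^sub>R Var ?b \<cdot> Var ?n"
  define e1 where "e1 = e(?C := chi_hat)"
  define e2 where "e2 = e1(?a := rep2 (\<lambda>n m. code (left_end n)), ?b := rep2 (\<lambda>n m. code (right_end n)))"
  have C1: "eval e1 (Var ?C) = chi_hat" by (simp add: e1_def)
  have mem: "sat A (e'(?x := u)) (Var ?x \<epsilon> Var ?C) \<longleftrightarrow> real_val f \<in> points"
    if "e' ?C = chi_hat" "f \<in> reals" "represents u f" for e' f u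
    by (rule sat_mem) (use that in \<open>auto simp: reals_def\<close>)
  have ab: "represents (app (e2 ?a) (num n)) (\<lambda>_. code (left_end n))" "represents (app (e2 ?b) (num n)) (\<lambda>_. code (right_end n))" for n
    using represents_rep2[of "\<lambda>n. code (left_end n)"] represents_rep2[of "\<lambda>n. code (right_end n)"] by (simp_all add: e2_def)
  \<comment> \<open>Stated for all assignments that agree with \<open>e2\<close> on the two
    sequences, because it is applied both with and without a bound assigned to
    \<open>?m\<close>.\<close>
  have covered: "sat A (e') ?cov \<longleftrightarrow> left_end n < real_val f \<and> real_val f < right_end n"
    if "f \<in> reals" "represents (e' ?x) f" "e' ?n = num n" "e' ?a = e2 ?a" "e' ?b = e2 ?b" for e' f n
  proof -
    have f: "conv f (real_val f)" using that(1) conv_real_val by (simp add: reals_def)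
    have x: "represents (eval e' (Var ?x)) f" using that(2) by simp
    have 1: "represents (eval e' (Var ?a \<cdot> Var ?n)) (\<lambda>_. code (left_end n))"
      "represents (eval e' (Var ?b \<cdot> Var ?n)) (\<lambda>_. code (right_end n))"
      using ab[of n] that(3-5) by simp_all
    show ?thesis
      using sat_real_less[OF 1(1) x conv_const f] sat_real_less[OF x 1(2) f conv_const]
      by (simp only: sat_connectives rat_val_code ends_Rats)
  qed
  have sub: "sat A e1 (\<^bold>\<forall>?x \<in> R. Var ?x \<epsilon> Var ?C \<^bold>\<longrightarrow>
      rat_real rat_zero \<le>\<^sub>R Var ?x \<^bold>\<and> Var ?x \<le>\<^sub>R rat_real rat_one)"
  proof (subst sat_all_real, simp, intro ballI allI impI)
    fix f u assume f: "f \<in> reals" "represents u f"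
    let ?e = "e1(?x := u)"
    have fast: "fast f" using f by (simp add: reals_def)
    have x: "represents (eval ?e (Var ?x)) f" using f(2) by simp
    have "sat A ?e (Var ?x \<epsilon> Var ?C) \<longleftrightarrow> real_val f \<in> points" by (rule mem) (use f C1 in auto)
    moreover have "sat A ?e (rat_real rat_zero \<le>\<^sub>R Var ?x) \<longleftrightarrow> 0 \<le> real_val f"
      using sat_real_le[OF represents_rat_real[OF eval_rat_consts(1)] x conv_const conv_real_val[OF fast]] by simp
    moreover have "sat A ?e (Var ?x \<le>\<^sub>R rat_real rat_one) \<longleftrightarrow> real_val f \<le> 1"
      using sat_real_le[OF x represents_rat_real[OF eval_rat_consts(3)] conv_real_val[OF fast] conv_const] by simp
    moreover have "0 \<le> real_val f \<and> real_val f \<le> 1" if "real_val f \<in> points" using that r_unit unfolding points_def by (auto intro: less_imp_le)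
    ultimately show "sat A ?e (Var ?x \<epsilon> Var ?C \<^bold>\<longrightarrow>
        rat_real rat_zero \<le>\<^sub>R Var ?x \<^bold>\<and> Var ?x \<le>\<^sub>R rat_real rat_one)" by simp
  qed
  have seqs: "sat A e2 (\<^bold>\<forall>?n. is_real (Var ?a \<cdot> Var ?n) \<^bold>\<and> is_real (Var ?b \<cdot> Var ?n))"
  proof -
    have "sat A (e2(?n := num n)) (is_real (Var ?a \<cdot> Var ?n))"
      "sat A (e2(?n := num n)) (is_real (Var ?b \<cdot> Var ?n))" for n
      using sat_is_real[of "e2(?n := num n)" "Var ?a \<cdot> Var ?n" "\<lambda>_. code (left_end n)"]
        sat_is_real[of "e2(?n := num n)" "Var ?b \<cdot> Var ?n" "\<lambda>_. code (right_end n)"] ab[of n] fast_const by simp_all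
    then show ?thesis by (auto simp del: fun_upd_apply)
  qed
  have C2: "e2 ?C = chi_hat" by (simp add: e1_def e2_def)
  have cover_all: "sat A e2 (\<^bold>\<forall>?x \<in> R. Var ?x \<epsilon> Var ?C \<^bold>\<longrightarrow> (\<^bold>\<exists>?n. ?cov))"
  proof (subst sat_all_real, simp, intro ballI allI impI)
    fix f u assume f: "f \<in> reals" "represents u f"
    have "\<exists>n. sat A (e2(?x := u, ?n := num n)) ?cov" if in_points: "real_val f \<in> points"
    proof -
      have "real_val f \<in> cover" using in_points r_cover unfolding points_def by auto
      then obtain n where "left_end n < real_val f" "real_val f < right_end n" unfolding cover_def by auto
      moreover have "sat A (e2(?x := u, ?n := num n)) ?cov \<longleftrightarrow> left_end n < real_val f \<and> real_val f < right_end n"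
        by (rule covered) (use f in auto)
      ultimately show ?thesis by blast
    qed
    then show "sat A (e2(?x := u)) (Var ?x \<epsilon> Var ?C \<^bold>\<longrightarrow> (\<^bold>\<exists>?n. ?cov))"
      using mem[of e2 f u, OF C2 f] by (auto simp del: fun_upd_apply)
  qed
  let ?fin = "\<^bold>\<exists>?m. \<^bold>\<forall>?x \<in> R. Var ?x \<epsilon> Var ?C \<^bold>\<longrightarrow> (\<^bold>\<exists>?n. \<^bold>\<not> Var ?m \<prec> Var ?n \<^bold>\<and> ?cov)"
  let ?Q = "(\<^bold>\<forall>?n. is_real (Var ?a \<cdot> Var ?n) \<^bold>\<and> is_real (Var ?b \<cdot> Var ?n)) \<^bold>\<and>
      (\<^bold>\<forall>?x \<in> R. Var ?x \<epsilon> Var ?C \<^bold>\<longrightarrow> (\<^bold>\<exists>?n. ?cov)) \<^bold>\<longrightarrow> ?fin"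
  have "sat A e1 (real_function (Var ?C) \<^bold>\<and> closed_set (Var ?C) \<^bold>\<and>
      (\<^bold>\<forall>?x \<in> R. Var ?x \<epsilon> Var ?C \<^bold>\<longrightarrow>
        rat_real rat_zero \<le>\<^sub>R Var ?x \<^bold>\<and> Var ?x \<le>\<^sub>R rat_real rat_one) \<^bold>\<longrightarrow>
      (\<^bold>\<forall>?a. \<^bold>\<forall>?b. ?Q))"
    using sat_AllD[OF HBC[unfolded HBC_def Let_def], of chi_hat] elem_chi_hat by (simp only: snd_conv e1_def)
  then have "sat A e1 (\<^bold>\<forall>?a. \<^bold>\<forall>?b. ?Q)"
    using sat_real_function[OF C1] sat_closed_set[OF C1] sub
    by (simp only: sat.simps(4) sat_connectives simp_thms)
  from sat_AllD[OF this, of "rep2 (\<lambda>n m. code (left_end n))"]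
  have "sat A (e1(?a := rep2 (\<lambda>n m. code (left_end n)))) (\<^bold>\<forall>?b. ?Q)"
    using elem_rat_seq[OF left_end_in] by (simp only: snd_conv)
  from sat_AllD[OF this, of "rep2 (\<lambda>n m. code (right_end n))"]
  have "sat A e2 ?Q"
    using elem_rat_seq[OF right_end_in] by (simp only: snd_conv e2_def)
  then have "sat A e2 ?fin"
    using seqs cover_all by (simp only: sat.simps(4) sat_connectives simp_thms)
  then obtain k where k: "sat A (e2(?m := num k))
      (\<^bold>\<forall>?x \<in> R. Var ?x \<epsilon> Var ?C \<^bold>\<longrightarrow> (\<^bold>\<exists>?n. \<^bold>\<not> Var ?m \<prec> Var ?n \<^bold>\<and> ?cov))"
    by (auto simp del: sat.simps(5) fun_upd_apply)
  obtain j where j: "\<forall>n\<le>k. \<not> (left_end n < real_val (r j) \<and> real_val (r j) < right_end n)" using no_finite_subcover by blast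
  have rj: "r j \<in> reals" "represents (rep1 (r j)) (r j)" using r_in r_fast represents_rep1 by (auto simp: reals_def)
  let ?e = "e2(?m := num k, ?x := rep1 (r j))"
  have "sat A ?e (Var ?x \<epsilon> Var ?C)"
    using mem[of "e2(?m := num k)" "r j" "rep1 (r j)", OF _ rj] C2 by (auto simp: points_def)
  moreover have "sat A ?e (Var ?x \<epsilon> Var ?C \<^bold>\<longrightarrow> (\<^bold>\<exists>?n. \<^bold>\<not> Var ?m \<prec> Var ?n \<^bold>\<and> ?cov))"
    using k rj by (subst (asm) sat_all_real) auto
  ultimately obtain n where n: "sat A (?e(?n := num n)) (\<^bold>\<not> Var ?m \<prec> Var ?n)"
      "sat A (?e(?n := num n)) ?cov"
    by (auto simp del: fun_upd_apply)
  from n(1) have "n \<le> k" by auto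
  moreover from n(2) have "left_end n < real_val (r j) \<and> real_val (r j) < right_end n"
    using covered[OF rj(1), of "?e(?n := num n)" n] rj(2) by simp
  ultimately show False using j by blast
qed

end

text \<open>Every type contains a functional that is constantly 0, so typed assignments exist and
  soundness is not vacuous.\<close>

fun closed_term :: "ty \<Rightarrow> tm" where
  "closed_term N = zero"
| "closed_term (\<sigma> \<rightarrow> \<tau>) = Const (CPi \<tau> \<sigma>) \<cdot> closed_term \<tau>"

lemma closed_term_props: "wt (closed_term \<tau>) \<and> ty_of (closed_term \<tau>) = \<tau> \<and> tvars (closed_term \<tau>) = {}"
  by (induction \<tau>) auto

lemma (in world) ex_typed: "\<exists>e. typed e"
proof
  show "typed (\<lambda>v. eval e (closed_term (snd v)))" for e
    unfolding typed_def
  proof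
    fix v :: var
    show "elem A (snd v) (eval e (closed_term (snd v)))"
      using ext_eq_eval[of "closed_term (snd v)" e e] closed_term_props[of "snd v"] by simp
  qed
qed

theorem theorem3p5:
  shows "\<not> (Z2_omega \<turnstile> HBC)"
proof
  assume prov: "Z2_omega \<turnstile> HBC"
  obtain A r z where "counter_model A r z" using ex_counter_model by blast
  then interpret counter_model A r z .
  obtain e where "typed e" using ex_typed by blast
  from soundness[OF prov sat_Z2_omega this] not_sat_HBC show False by blast
qed

end
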